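(* Let $u:\mathscr{D}_T\to\mathbb{R}$ be upper semicontinuous and upper coercive, let $w:\mathscr{D}_T\to\mathbb{R}$ be lower semicontinuous and lower coercive, let $\varepsilon>0$, and suppose that $\big((\underline{\mathfrak{o}}^*,\underline{x}^* ),(\overline{\mathfrak{o}}^*,\overline{x}^* )\big)\in\mathscr{D}_T^2$ is a maximizer over $\mathscr{D}_T^2$ of $$\Phi(\underline{\mathfrak{o}},\overline{\mathfrak{o}},\underline{x},\overline{x})=u(\underline{\mathfrak{o}},\underline{x})-w(\overline{\mathfrak{o}},\overline{x})-\frac1{2\varepsilon}\,\rho(\underline{\mathfrak{o}}-\overline{\mathfrak{o}},\underline{x}-\overline{x})^2 .$$ Then there exist $\underline{\Gamma},\overline{\Gamma}\in\mathbb{S}^d$ such that $$(\Theta(\underline{x}^* ),\Delta,\underline{\Gamma})\in\overline{\mathscr{P}}^{1,2}_+u(\underline{\mathfrak{o}}^*,\underline{x}^* ),\qquad(\Theta(\overline{x}^* ),\Delta,\overline{\Gamma})\in\overline{\mathscr{P}}^{1,2}_-w(\overline{\mathfrak{o}}^*,\overline{x}^* ),$$ $$-\frac3\varepsilon\begin{pmatrix}I&0\\0&I\end{pmatrix}\le\begin{pmatrix}\underline{\Gamma}&0\\0&-\overline{\Gamma}\end{pmatrix}\le\frac3\varepsilon\begin{pmatrix}I&-I\\-I&I\end{pmatrix},$$ where $I$ is the $d\times d$ identity matrix, $\Delta=(\underline{x}^*-\overline{x}^* )/\varepsilon$, and $\Theta\in\mathscr{C}_b(\mathbb{R}^d)$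 is given by $$\Theta(x)=\frac1\varepsilon\sum_k(\underline{\mathfrak{o}}^*-\overline{\mathfrak{o}}^* )(f_k)\,f_k(x),\qquad x\in\mathbb{R}^d,$$ that is, $\Theta(x)=\delta_{\mathfrak{o}}\Psi(\underline{\mathfrak{o}}^* )(x)$ is the linear derivative at $\underline{\mathfrak{o}}^*$ of $\Psi(\mathfrak{o})=\frac1{2\varepsilon}\varrho^2(\mathfrak{o}-\overline{\mathfrak{o}}^* )$.
   Context: **Spaces.** Fix $d\ge 1$ and $T>0$. $\mathscr{M}$ is the space of finite signed Borel measures on $\mathbb{R}^d$ with the weak topology $\sigma(\mathscr{C}_b(\mathbb{R}^d),\mathscr{M})$, where $\mathscr{C}_b(\mathbb{R}^d)$ denotes bounded continuous functions; $\mathscr{M}_+$ are the nonnegative ones; $|\mathfrak{o}|$ is the total variation of $\mathfrak{o}$. Write $\mathfrak{o}(f)=\int f\,d\mathfrak{o}$. Let $q(x)=\sqrt{1+|x|^2}$ and $\mathscr{M}_q=\{\mathfrak{o}\in\mathscr{M}_+:\mathfrak{o}(q)<\infty\}$, endowed with the same weak topology. Let $\mathscr{D}=\mathscr{M}_q\times\mathbb{R}^d$ with the product topology and $\mathscr{D}_T=\{(\mathfrak{o},x)\in\mathscr{D}:|\mathfrak{o}|\le T\}$. $\mathbb{S}^d$ is the set of symmetric $d\times d$ matrices; matrix inequalities are in the sense of quadratic forms. **Norms.** Fix a family $(f_k)_{k\ge 0}\subset\mathscr{C}^1_b(\mathbb{R}^d)$ that separates $\mathscr{M}$ (i.e. $\mathfrak{o}(f_k)=\mathfrak{o}'(f_k)$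 for all $k$ implies $\mathfrak{o}=\mathfrak{o}'$), with $f_0$ a (nonzero) constant function and $\sum_k\|f_k\|_{\mathscr{C}^1}^2\le 1$, where $\|f\|_{\mathscr{C}^1}=\|f\|_\infty+\|\nabla f\|_\infty$. Set $\varrho(\mathfrak{o})=(\sum_k|\mathfrak{o}(f_k)|^2)^{1/2}$ and $\rho(\mathfrak{o},x)=\sqrt{\varrho(\mathfrak{o})^2+|x|^2}$ for $\mathfrak{o}\in\mathscr{M}$, $x\in\mathbb{R}^d$. **Coercivity.** An upper semicontinuous $u:\mathscr{D}_T\to\mathbb{R}$ is upper coercive if for every $c\in\mathbb{R}$ every sequence $(\xi_n)$ in $\mathscr{D}_T$ with $u(\xi_n)\ge c$ has a subsequence converging in $\mathscr{D}_T$. A lower semicontinuous $w$ is lower coercive if for every $c\in\mathbb{R}$ every sequence $(\xi_n)$ with $w(\xi_n)\le c$ has a subsequence converging in $\mathscr{D}_T$. **Derivatives.** The occupation derivative of $\varphi:\mathscr{D}\to\mathbb{R}$ is $\partial_{\mathfrak{o}}\varphi(\mathfrak{o},x)=\lim_{h\downarrow0}\frac{\varphi(\mathfrak{o}+h\delta_x,x)-\varphi(\mathfrak{o},x)}{h}$, when the limit exists and is finite. $\mathscr{C}^{1,2}(\mathscr{D})$ is the set of continuous $\varphi:\mathscr{D}\to\mathbb{R}$ for which $\partial_{\mathfrak{o}}\varphi$, $\nabla\varphi$, $\nabla^2\varphi$ (gradient and Hessian in $x$) exist and are continuous on $\mathscr{D}$. $\mathscr{C}^{1,2}(\mathscr{D}_T)$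 denotes the restrictions to $\mathscr{D}_T$ of functions in $\mathscr{C}^{1,2}(\mathscr{D})$ (with derivatives those of the extension). The linear derivative $\delta_{\mathfrak{o}}\Psi(\mathfrak{o})\in\mathscr{C}(\mathbb{R}^d)$ of a function $\Psi$ of measures is characterized by $\Psi(\mathfrak{o}')-\Psi(\mathfrak{o})=\int_0^1\int_{\mathbb{R}^d}\delta_{\mathfrak{o}}\Psi(\mathfrak{o}+\eta(\mathfrak{o}'-\mathfrak{o}))(y)\,(\mathfrak{o}'-\mathfrak{o})(dy)\,d\eta$. **Semijets.** For $u$ upper semicontinuous and $(\mathfrak{o},x)\in\mathscr{D}_T$, $\mathscr{P}^{1,2}_+u(\mathfrak{o},x)\subset\mathbb{R}\times\mathbb{R}^d\times\mathbb{S}^d$ is the set of $(\partial_{\mathfrak{o}}\phi,\nabla\phi,\nabla^2\phi)(\mathfrak{o},x)$ with $\phi\in\mathscr{C}^{1,2}(\mathscr{D}_T)$ and $0=(u-\phi)(\mathfrak{o},x)=\max_{\mathscr{D}_T}(u-\phi)$. For $w$ lower semicontinuous, $\mathscr{P}^{1,2}_-w(\mathfrak{o},x)$ is defined the same way with $0=(w-\phi)(\mathfrak{o},x)=\min_{\mathscr{D}_T}(w-\phi)$. Their closures are $$\overline{\mathscr{P}}^{1,2}_\pm v(\mathfrak{o},x)=\{\lim_n\zeta_n:\ \zeta_n\in\mathscr{P}^{1,2}_\pm v(\mathfrak{o}_n,x_n),\ (\mathfrak{o}_n,x_n,v(\mathfrak{o}_n,x_n))\to(\mathfrak{o},x,v(\mathfrak{o},x))\}.$$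 *)

theory Defs
  imports "HOL-Analysis.Analysis"
begin

section \<open>Finite signed Borel measures\<close>

text \<open>
  The value outside the Borel sets is fixed to be 0, so that equality on the type is equality
  on the Borel sets. The carrier for \<open>\<real>\<^sup>d\<close> is \<^typ>\<open>real ^ 'n\<close>, with \<open>d = CARD('n) \<ge> 1\<close>.
\<close>

typedef (overloaded) ('a::topological_space) signed_measure =
  "{\<nu> :: 'a set \<Rightarrow> real.
      (\<forall>A. A \<notin> sets borel \<longrightarrow> \<nu> A = 0) \<and>
      (\<forall>A :: nat \<Rightarrow> 'a set. range A \<subseteq> sets borel \<longrightarrow> disjoint_family A \<longrightarrow>
         (\<lambda>i. \<nu> (A i)) sums \<nu> (\<Union>i. A i))}"
  morphisms sval Abs_signed_measure
  by (rule exI[of _ "\<lambda>_. 0"]) auto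

setup_lifting type_definition_signed_measure

instantiation signed_measure :: (topological_space) real_vector
begin

lift_definition zero_signed_measure :: "'a signed_measure" is "\<lambda>_. 0"
  by auto

lift_definition plus_signed_measure ::
  "'a signed_measure \<Rightarrow> 'a signed_measure \<Rightarrow> 'a signed_measure" is "\<lambda>\<mu> \<nu> A. \<mu> A + \<nu> A"
  by (auto intro: sums_add)

lift_definition uminus_signed_measure :: "'a signed_measure \<Rightarrow> 'a signed_measure"
  is "\<lambda>\<mu> A. - \<mu> A"
  by (auto intro: sums_minus)

lift_definition minus_signed_measure ::
  "'a signed_measure \<Rightarrow> 'a signed_measure \<Rightarrow> 'a signed_measure" is "\<lambda>\<mu> \<nu> A. \<mu> A - \<nu> A"
  by (auto intro: sums_diff)

lift_definition scaleR_signed_measure :: "real \<Rightarrow> 'a signed_measure \<Rightarrow> 'a signed_measure"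
  is "\<lambda>r \<mu> A. r * \<mu> A"
  by (auto intro: sums_mult)

instance
  by standard (transfer; auto simp: algebra_simps)+

end

lift_definition dirac :: "'a::topological_space \<Rightarrow> 'a signed_measure"
  is "\<lambda>x A. if A \<in> sets borel then indicator A x else 0"
proof -
  fix x :: 'a
  have "(\<lambda>i. indicator (A i) x) sums (indicator (\<Union>i. A i) x :: real)"
    if "disjoint_family A" for A :: "nat \<Rightarrow> 'a set"
    using that by (intro indicator_sums) (auto simp: disjoint_family_on_def)
  then show "(\<forall>A. A \<notin> sets borel \<longrightarrow> (if A \<in> sets borel then indicator A x else 0) = (0::real)) \<and>
    (\<forall>A. range A \<subseteq> sets borel \<longrightarrow> disjoint_family A \<longrightarrow>
       (\<lambda>i. if A i \<in> sets borel then indicator (A i) x else 0) sums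
       (if (\<Union>i. A i) \<in> sets borel then indicator (\<Union>i. A i) x else (0::real)))"
    by (auto simp: image_subset_iff sets.countable_UN)
qed

text \<open>
  The positive variation \<open>\<nu>\<^sup>+(A) = sup {\<nu>(B) | B \<subseteq> A}\<close>; the negative variation is the positive
  variation of \<open>- \<nu>\<close>. \<^const>\<open>ennreal\<close> truncates negative values, which does not change the
  supremum because \<open>B = {}\<close> is admitted.
\<close>

definition pos_variation :: "'a::topological_space signed_measure \<Rightarrow> 'a measure" where
  "pos_variation \<nu> =
     measure_of UNIV (sets borel) (\<lambda>A. SUP B\<in>{B \<in> sets borel. B \<subseteq> A}. ennreal (sval \<nu> B))"

definition total_variation :: "'a::topological_space signed_measure \<Rightarrow> real" where
  "total_variation \<nu> = measure (pos_variation \<nu>) UNIV + measure (pos_variation (- \<nu>)) UNIV"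

definition signed_integrable ::
  "'a::topological_space signed_measure \<Rightarrow> ('a \<Rightarrow> real) \<Rightarrow> bool" where
  "signed_integrable \<nu> g \<longleftrightarrow>
     integrable (pos_variation \<nu>) g \<and> integrable (pos_variation (- \<nu>)) g"

definition signed_integral ::
  "'a::topological_space signed_measure \<Rightarrow> ('a \<Rightarrow> real) \<Rightarrow> real" where
  "signed_integral \<nu> g = (\<integral>x. g x \<partial>pos_variation \<nu>) - (\<integral>x. g x \<partial>pos_variation (- \<nu>))"

definition Cb :: "('a::topological_space \<Rightarrow> real) set" where
  "Cb = {g. continuous_on UNIV g \<and> bounded (range g)}"

text \<open>
  The weak topology is made the topology of the type, so that the library notions of continuity
  and convergence, on this type and on its products, refer to it.
\<close>

instantiation signed_measure :: (topological_space) topological_space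
begin

definition open_signed_measure :: "'a signed_measure set \<Rightarrow> bool" where
  "open_signed_measure =
     generate_topology {{\<nu>. signed_integral \<nu> g \<in> V} | g V. g \<in> Cb \<and> open V}"

instance
  by standard (auto simp: open_signed_measure_def intro: generate_topology.intros)

end

definition M_plus :: "'a::topological_space signed_measure set" where
  "M_plus = {\<nu>. \<forall>A. 0 \<le> sval \<nu> A}"

definition M_q :: "(real ^ 'n) signed_measure set" where
  "M_q = {\<nu> \<in> M_plus. (\<integral>\<^sup>+x. ennreal (sqrt (1 + (norm x)\<^sup>2)) \<partial>pos_variation \<nu>) < \<infinity>}"

type_synonym 'n state = "(real ^ 'n) signed_measure \<times> (real ^ 'n)"

definition Dom :: "'n::finite state set" where
  "Dom = M_q \<times> UNIV"

definition Dom_T :: "real \<Rightarrow> 'n::finite state set" where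
  "Dom_T T = {(\<nu>, x). (\<nu>, x) \<in> Dom \<and> total_variation \<nu> \<le> T}"


section \<open>Norms\<close>

definition grad :: "('a::real_inner \<Rightarrow> real) \<Rightarrow> 'a \<Rightarrow> 'a" where
  "grad g x = (THE D. GDERIV g x :> D)"

definition C1b :: "('a::real_inner \<Rightarrow> real) set" where
  "C1b = {g. (\<forall>x. \<exists>D. GDERIV g x :> D) \<and> continuous_on UNIV (grad g) \<and>
             bounded (range g) \<and> bounded (range (grad g))}"

definition C1_norm :: "('a::real_inner \<Rightarrow> real) \<Rightarrow> real" where
  "C1_norm g = (SUP x. \<bar>g x\<bar>) + (SUP x. norm (grad g x))"

definition separates_measures :: "(nat \<Rightarrow> 'a::topological_space \<Rightarrow> real) \<Rightarrow> bool" where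
  "separates_measures f \<longleftrightarrow>
     (\<forall>\<mu> \<nu>. (\<forall>k. signed_integral \<mu> (f k) = signed_integral \<nu> (f k)) \<longrightarrow> \<mu> = \<nu>)"

definition varrho ::
  "(nat \<Rightarrow> 'a::topological_space \<Rightarrow> real) \<Rightarrow> 'a signed_measure \<Rightarrow> real" where
  "varrho f \<nu> = sqrt (\<Sum>k. \<bar>signed_integral \<nu> (f k)\<bar>\<^sup>2)"

definition rho ::
  "(nat \<Rightarrow> real ^ 'n \<Rightarrow> real) \<Rightarrow> (real ^ 'n) signed_measure \<Rightarrow> real ^ 'n \<Rightarrow> real" where
  "rho f \<nu> x = sqrt ((varrho f \<nu>)\<^sup>2 + (norm x)\<^sup>2)"


section \<open>Semicontinuity and coercivity\<close>

definition usc_on :: "'a::topological_space set \<Rightarrow> ('a \<Rightarrow> real) \<Rightarrow> bool" where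
  "usc_on S u \<longleftrightarrow> (\<forall>c. openin (top_of_set S) {\<xi> \<in> S. u \<xi> < c})"

definition lsc_on :: "'a::topological_space set \<Rightarrow> ('a \<Rightarrow> real) \<Rightarrow> bool" where
  "lsc_on S w \<longleftrightarrow> (\<forall>c. openin (top_of_set S) {\<xi> \<in> S. c < w \<xi>})"

definition upper_coercive_on :: "'a::topological_space set \<Rightarrow> ('a \<Rightarrow> real) \<Rightarrow> bool" where
  "upper_coercive_on S u \<longleftrightarrow>
     (\<forall>c \<xi>. (\<forall>n::nat. \<xi> n \<in> S \<and> c \<le> u (\<xi> n)) \<longrightarrow>
        (\<exists>r l. strict_mono (r :: nat \<Rightarrow> nat) \<and> l \<in> S \<and> (\<xi> \<circ> r) \<longlonglongrightarrow> l))"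

definition lower_coercive_on :: "'a::topological_space set \<Rightarrow> ('a \<Rightarrow> real) \<Rightarrow> bool" where
  "lower_coercive_on S w \<longleftrightarrow>
     (\<forall>c \<xi>. (\<forall>n::nat. \<xi> n \<in> S \<and> w (\<xi> n) \<le> c) \<longrightarrow>
        (\<exists>r l. strict_mono (r :: nat \<Rightarrow> nat) \<and> l \<in> S \<and> (\<xi> \<circ> r) \<longlonglongrightarrow> l))"


section \<open>Derivatives\<close>

definition has_occ_derivative :: "('n::finite state \<Rightarrow> real) \<Rightarrow> real \<Rightarrow> 'n state \<Rightarrow> bool" where
  "has_occ_derivative \<phi> a \<xi> \<longleftrightarrow>
     (case \<xi> of (\<nu>, x) \<Rightarrow>
        ((\<lambda>h. (\<phi> (\<nu> + h *\<^sub>R dirac x, x) - \<phi> (\<nu>, x)) / h) \<longlongrightarrow> a) (at_right 0))"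

text \<open>
  \<open>\<phi>\<close> belongs to \<open>C\<^sup>1\<^sup>,\<^sup>2\<close> of \<^const>\<open>Dom\<close>, with occupation derivative \<open>a\<close>, gradient \<open>g\<close> and Hessian
  \<open>H\<close>. Only the values of the four functions on \<^const>\<open>Dom\<close> matter.
\<close>

definition C12_with ::
  "('n::finite state \<Rightarrow> real) \<Rightarrow> ('n state \<Rightarrow> real) \<Rightarrow> ('n state \<Rightarrow> real ^ 'n) \<Rightarrow>
   ('n state \<Rightarrow> real ^ 'n ^ 'n) \<Rightarrow> bool" where
  "C12_with \<phi> a g H \<longleftrightarrow>
     continuous_on Dom \<phi> \<and> continuous_on Dom a \<and> continuous_on Dom g \<and> continuous_on Dom H \<and>
     (\<forall>(\<nu>, x) \<in> Dom.
        has_occ_derivative \<phi> (a (\<nu>, x)) (\<nu>, x) \<and>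
        (GDERIV (\<lambda>y. \<phi> (\<nu>, y)) x :> g (\<nu>, x)) \<and>
        ((\<lambda>y. g (\<nu>, y)) has_derivative (\<lambda>v. H (\<nu>, x) *v v)) (at x))"

text \<open>
  Linear derivative of \<open>\<Psi>\<close> on a convex set \<open>S\<close> of measures. Joint continuity of \<open>D\<close>
  excludes modifications of \<open>D\<close> at single measures, which the integral identity does not see.
\<close>

definition is_linear_derivative ::
  "'a::topological_space signed_measure set \<Rightarrow> ('a signed_measure \<Rightarrow> real) \<Rightarrow>
   ('a signed_measure \<Rightarrow> 'a \<Rightarrow> real) \<Rightarrow> bool" where
  "is_linear_derivative S \<Psi> D \<longleftrightarrow>
     continuous_on (S \<times> UNIV) (\<lambda>(\<mu>, y). D \<mu> y) \<and>
     (\<forall>\<mu>\<in>S. \<forall>\<mu>'\<in>S.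
        (\<forall>\<eta>\<in>{0..1}. signed_integrable (\<mu>' - \<mu>) (D (\<mu> + \<eta> *\<^sub>R (\<mu>' - \<mu>)))) \<and>
        ((\<lambda>\<eta>. signed_integral (\<mu>' - \<mu>) (D (\<mu> + \<eta> *\<^sub>R (\<mu>' - \<mu>))))
           has_integral (\<Psi> \<mu>' - \<Psi> \<mu>)) {0..1})"


section \<open>Semijets\<close>

type_synonym 'n jet = "real \<times> (real ^ 'n) \<times> (real ^ 'n ^ 'n)"

definition semijet_plus ::
  "real \<Rightarrow> ('n::finite state \<Rightarrow> real) \<Rightarrow> 'n state \<Rightarrow> 'n jet set" where
  "semijet_plus T u \<xi> =
     {(a \<xi>, g \<xi>, H \<xi>) | \<phi> a g H.
        C12_with \<phi> a g H \<and> u \<xi> - \<phi> \<xi> = 0 \<and> (\<forall>\<zeta> \<in> Dom_T T. u \<zeta> - \<phi> \<zeta> \<le> 0)}"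

definition semijet_minus ::
  "real \<Rightarrow> ('n::finite state \<Rightarrow> real) \<Rightarrow> 'n state \<Rightarrow> 'n jet set" where
  "semijet_minus T w \<xi> =
     {(a \<xi>, g \<xi>, H \<xi>) | \<phi> a g H.
        C12_with \<phi> a g H \<and> w \<xi> - \<phi> \<xi> = 0 \<and> (\<forall>\<zeta> \<in> Dom_T T. 0 \<le> w \<zeta> - \<phi> \<zeta>)}"

definition semijet_closure ::
  "real \<Rightarrow> (('n::finite state \<Rightarrow> real) \<Rightarrow> 'n state \<Rightarrow> 'n jet set) \<Rightarrow>
   ('n state \<Rightarrow> real) \<Rightarrow> 'n state \<Rightarrow> 'n jet set" where
  "semijet_closure T P v \<xi> =
     {\<zeta>. \<exists>\<zeta>s \<xi>s. (\<forall>n::nat. \<xi>s n \<in> Dom_T T \<and> \<zeta>s n \<in> P v (\<xi>s n)) \<and>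
           \<xi>s \<longlonglongrightarrow> \<xi> \<and> (\<lambda>n. v (\<xi>s n)) \<longlonglongrightarrow> v \<xi> \<and> \<zeta>s \<longlonglongrightarrow> \<zeta>}"

definition closed_semijet_plus ::
  "real \<Rightarrow> ('n::finite state \<Rightarrow> real) \<Rightarrow> 'n state \<Rightarrow> 'n jet set" where
  "closed_semijet_plus T = semijet_closure T (semijet_plus T)"

definition closed_semijet_minus ::
  "real \<Rightarrow> ('n::finite state \<Rightarrow> real) \<Rightarrow> 'n state \<Rightarrow> 'n jet set" where
  "closed_semijet_minus T = semijet_closure T (semijet_minus T)"


section \<open>Matrices\<close>

definition sym_matrices :: "(real ^ 'n ^ 'n) set" where
  "sym_matrices = {A. transpose A = A}"

definition quad_le :: "real ^ 'm ^ 'm \<Rightarrow> real ^ 'm ^ 'm \<Rightarrow> bool" where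
  "quad_le A B \<longleftrightarrow> (\<forall>v. v \<bullet> (A *v v) \<le> v \<bullet> (B *v v))"

definition block_matrix ::
  "real ^ 'n ^ 'n \<Rightarrow> real ^ 'n ^ 'n \<Rightarrow> real ^ 'n ^ 'n \<Rightarrow> real ^ 'n ^ 'n \<Rightarrow>
   real ^ ('n + 'n) ^ ('n + 'n)" where
  "block_matrix A B C D =
     (\<chi> i j. case (i, j) of
        (Inl k, Inl l) \<Rightarrow> A $ k $ l
      | (Inl k, Inr l) \<Rightarrow> B $ k $ l
      | (Inr k, Inl l) \<Rightarrow> C $ k $ l
      | (Inr k, Inr l) \<Rightarrow> D $ k $ l)"


section \<open>The penalized functional\<close>

definition doubled ::
  "(nat \<Rightarrow> real ^ 'n \<Rightarrow> real) \<Rightarrow> ('n::finite state \<Rightarrow> real) \<Rightarrow> ('n state \<Rightarrow> real) \<Rightarrow> real \<Rightarrow>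
   'n state \<Rightarrow> 'n state \<Rightarrow> real" where
  "doubled f u w \<epsilon> = (\<lambda>(\<mu>, x) (\<nu>, y).
     u (\<mu>, x) - w (\<nu>, y) - 1 / (2 * \<epsilon>) * (rho f (\<mu> - \<nu>) (x - y))\<^sup>2)"

definition Theta ::
  "(nat \<Rightarrow> 'a::topological_space \<Rightarrow> real) \<Rightarrow> real \<Rightarrow> 'a signed_measure \<Rightarrow> 'a signed_measure \<Rightarrow>
   'a \<Rightarrow> real" where
  "Theta f \<epsilon> \<mu> \<nu> x = 1 / \<epsilon> * (\<Sum>k. signed_integral (\<mu> - \<nu>) (f k) * f k x)"

end

theory Submission
  imports Defs
begin

text \<open>
  Write \<open>\<langle>.,.\<rangle>\<close> for the inner product behind \<open>\<rho>\<close> on measures and \<open>p = \<mu> - \<nu>\<close>. Since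
  \<open>|a - b|\<^sup>2 \<le> 2|a|\<^sup>2 + 2|b|\<^sup>2\<close>, the penalty on the measures can be linearized at the maximizer: with
  \<open>u\<^sub>1(x) = sup\<^sub>\<sigma> u(\<sigma>,x) - \<langle>p,\<sigma>\<rangle>/\<epsilon> - 3|\<sigma> - \<mu>|\<^sup>2/(2\<epsilon>)\<close> and the analogous \<open>w\<^sub>1\<close>, the function
  \<open>u\<^sub>1(x) - w\<^sub>1(y) - |x - y|\<^sup>2/(2\<epsilon>)\<close> is maximal at the given pair of points, and the Crandall-Ishii
  theorem on sums in \<open>\<real>\<^sup>d\<close> applies. The constant 3 instead of 2 makes \<open>\<mu>\<close> the only maximizing measure
  above \<open>x\<close>, so by coercivity the measures belonging to the approximating jets converge to \<open>\<mu>\<close>.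

  The theorem on sums is proved with Jensen's contact sets, on which the gradient is Lipschitz, so
  that they are not negligible, and with Alexandrov's theorem. For the latter, second order
  expansions along all rational directions exist almost everywhere by the one-dimensional case and
  Fubini. Their coefficients satisfy the parallelogram law because, for almost every point of a closed
  set on which second differences are nearly constant, the set also contains \<open>x \<plusminus> tv\<close> for
  arbitrarily small \<open>t\<close>.
\<close>

section \<open>Monotone functions are differentiable almost everywhere\<close>

text \<open>Suprema over measures are taken before anything of second order happens because contact
  sets and almost everywhere expansions need a finite-dimensional space. The price is that only
  upper semicontinuity of the resulting functions on \<open>\<real>^d\<close> is known, and this is
  why sup-convolutions enter. The 3 in the matrix bounds is unrelated to the 3 in the penalty on
  measures. It comes from |d - (a - b)|^2 \<le> 3 |d|^2 + 3 |a|^2 + 3 |b|^2: sup-convolutions with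
  parameter 3/\<epsilon> satisfy the doubled inequality with |x - y|^2/(2\<epsilon>) replaced by 3|x
  - y|^2/(2\<epsilon>), and are convex after adding 3|x|^2/(2\<epsilon>). The second order condition
  at a maximum then yields the upper matrix bound, convexity the lower one. The first entry of the
  jets is \<Theta> because the linear term \<open>p / \<epsilon>\<close> has this derivative, while
  the derivative of the quadratic penalty vanishes at the limiting measure. The function w is
  treated as the upper function - w with - p in place of p.\<close>

lemma vitali_intervals:
  fixes E \<Omega> :: "real set"
  assumes fine: "\<And>x \<tau>. x \<in> E \<Longrightarrow> \<tau> > 0 \<Longrightarrow> \<exists>a b. a \<le> x \<and> x \<le> b \<and> a < b \<and> b - a < \<tau> \<and> P a b"
    and \<Omega>: "open \<Omega>" "E \<subseteq> \<Omega>"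
  obtains C where "countable C" "\<And>i. i \<in> C \<Longrightarrow> fst i < snd i \<and> {fst i..snd i} \<subseteq> \<Omega> \<and> P (fst i) (snd i)"
    "disjoint_family_on (\<lambda>i. {fst i..snd i}) C" "negligible (E - (\<Union>i\<in>C. {fst i..snd i}))"
proof -
  define K where "K = {i. fst i < snd i \<and> {fst i..snd i} \<subseteq> \<Omega> \<and> P (fst i) (snd i)}"
  \<comment> \<open>The balls of the Vitali theorem have to contain \<open>x\<close> without being
    centred there, so every interval with \<open>x\<close> in it is admissible.\<close>
  define c where "c = (\<lambda>i::real\<times>real. (fst i + snd i) / 2)"
  define r where "r = (\<lambda>i::real\<times>real. (snd i - fst i) / 2)"
  have cb: "cball (c i) (r i) = {fst i..snd i}" for i
    unfolding c_def r_def cball_eq_atLeastAtMost by (auto simp: field_simps)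
  have *: "\<exists>i. i \<in> K \<and> x \<in> cball (c i) (r i) \<and> r i < d" if xd: "x \<in> E" "0 < d" for x d
  proof -
    obtain e where e: "e > 0" "ball x e \<subseteq> \<Omega>"
      using openE[OF \<Omega>(1), of x] \<Omega>(2) xd by blast
    obtain a b where ab: "a \<le> x" "x \<le> b" "a < b" "b - a < min d e" "P a b"
      using fine[of x "min d e"] xd e by auto
    have "{a..b} \<subseteq> ball x e"
      using ab by (auto simp: dist_real_def)
    then have "(a, b) \<in> K"
      using ab e by (auto simp: K_def)
    then show ?thesis
      using ab unfolding cb by (intro exI[of _ "(a,b)"]) (auto simp: r_def)
  qed
  have rpos: "0 < r i" if "i \<in> K" for i
    using that by (simp add: K_def r_def)
  obtain C where C: "countable C" "C \<subseteq> K"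
     "pairwise (\<lambda>i j. disjnt (cball (c i) (r i)) (cball (c j) (r j))) C"
     "negligible(E - (\<Union>i \<in> C. cball (c i) (r i)))"
    using Vitali_covering_theorem_cballs[OF rpos *] by blast
  show thesis
  proof (rule that[of C])
    show "disjoint_family_on (\<lambda>i. {fst i..snd i}) C"
      using C(3) unfolding cb pairwise_def disjnt_def disjoint_family_on_def by blast
    show "negligible (E - (\<Union>i\<in>C. {fst i..snd i}))"
      using C(4) unfolding cb .
  qed (use C in \<open>auto simp: K_def\<close>)
qed

text \<open>The right derivative of a convex function on the line has both properties. Right
  continuity makes \<open>interval_measure m\<close> assign \<open>m b - m a\<close> to a half-open
  interval, so difference quotients of \<open>m\<close> become ratios of two measures and can be
  handled by coverings.\<close>

locale stieltjes =
  fixes m :: "real \<Rightarrow> real"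
  assumes mono: "\<And>x y. x \<le> y \<Longrightarrow> m x \<le> m y"
    and right_cont: "\<And>a. continuous (at_right a) m"
begin

abbreviation "\<nu> \<equiv> interval_measure m"

lemma \<nu>_Ioc: "a \<le> b \<Longrightarrow> emeasure \<nu> {a<..b} = ennreal (m b - m a)"
  by (rule emeasure_interval_measure_Ioc) (auto intro: mono right_cont)

text \<open>Disjoint intervals of a Vitali cover carry at least \<open>q\<close> times their length
  as increment, and these increments add up inside \<Omega>. \<open>E\<close> is an arbitrary set;
  what is measurable is the cover together with the null part of \<open>E\<close> that it
  misses.\<close>

lemma increment_ge_cover:
  assumes "q > 0" "open \<Omega>" "E \<subseteq> \<Omega>"
    and "\<And>x \<tau>. x \<in> E \<Longrightarrow> \<tau> > 0 \<Longrightarrow>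
           \<exists>a b. a \<le> x \<and> x \<le> b \<and> a < b \<and> b - a < \<tau> \<and> q * (b - a) \<le> m b - m a"
  shows "\<exists>S\<in>sets lebesgue. E \<subseteq> S \<and> ennreal q * emeasure lebesgue S \<le> emeasure \<nu> \<Omega>"
proof -
  obtain C where C: "countable C"
    "\<And>i. i \<in> C \<Longrightarrow> fst i < snd i \<and> {fst i..snd i} \<subseteq> \<Omega> \<and> q * (snd i - fst i) \<le> m (snd i) - m (fst i)"
    and dis: "disjoint_family_on (\<lambda>i. {fst i..snd i}) C"
    and neg: "negligible (E - (\<Union>i\<in>C. {fst i..snd i}))"
    using vitali_intervals[of E "\<lambda>a b. q * (b - a) \<le> m b - m a" \<Omega>] assms by blast
  define V where "V = (\<Union>i\<in>C. {fst i..snd i})"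
  \<comment> \<open>Half-open intervals stay disjoint and have exactly the increment as Stieltjes
    measure, even where \<open>m\<close> jumps at an endpoint.\<close>
  have dis': "disjoint_family_on (\<lambda>i. {fst i<..snd i}) C"
    using dis unfolding disjoint_family_on_def by fastforce
  have V: "V \<in> sets lebesgue"
    unfolding V_def using C(1) by (intro sets.countable_UN'') auto
  have nl: "E - V \<in> null_sets lebesgue"
    using neg by (simp add: V_def negligible_iff_null_sets)
  have "ennreal q * emeasure lebesgue V = ennreal q * (\<integral>\<^sup>+i. emeasure lebesgue {fst i..snd i} \<partial>count_space C)"
    unfolding V_def using C(1) dis by (subst emeasure_UN_countable) auto
  also have "\<dots> = (\<integral>\<^sup>+i. ennreal q * emeasure lebesgue {fst i..snd i} \<partial>count_space C)"
    by (rule nn_integral_cmult[symmetric]) simp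
  also have "\<dots> \<le> (\<integral>\<^sup>+i. emeasure \<nu> {fst i<..snd i} \<partial>count_space C)"
  proof (rule nn_integral_mono)
    fix i assume "i \<in> space (count_space C)"
    then have i: "fst i < snd i" "q * (snd i - fst i) \<le> m (snd i) - m (fst i)"
      using C(2) by auto
    show "ennreal q * emeasure lebesgue {fst i..snd i} \<le> emeasure \<nu> {fst i<..snd i}"
      using i \<open>q > 0\<close> by (simp add: \<nu>_Ioc ennreal_mult'[symmetric] ennreal_leI)
  qed
  also have "\<dots> = emeasure \<nu> (\<Union>i\<in>C. {fst i<..snd i})"
    using C(1) dis' by (subst emeasure_UN_countable) auto
  also have "\<dots> \<le> emeasure \<nu> \<Omega>"
  proof (rule emeasure_mono)
    show "(\<Union>i\<in>C. {fst i<..snd i}) \<subseteq> \<Omega>"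
      using C(2) by (force simp: subset_iff)
  qed (use \<open>open \<Omega>\<close> in auto)
  finally have "ennreal q * emeasure lebesgue (V \<union> (E - V)) \<le> emeasure \<nu> \<Omega>"
    using emeasure_Un_null_set[OF V nl] by simp
  moreover have "V \<union> (E - V) \<in> sets lebesgue"
    using V nl sets.Un null_setsD2 by blast
  ultimately show ?thesis
    by (intro bexI[of _ "V \<union> (E - V)"]) auto
qed

text \<open>Counterpart for small slopes. The set obtained has to be open so that it can serve as
  the ambient set of a second cover; dropping the countably many endpoints costs only a null
  set.\<close>

lemma increment_le_cover:
  assumes "p \<ge> 0" "open \<Omega>" "E \<subseteq> \<Omega>"
    and "\<And>x \<tau>. x \<in> E \<Longrightarrow> \<tau> > 0 \<Longrightarrow>
           \<exists>a b. a \<le> x \<and> x \<le> b \<and> a < b \<and> b - a < \<tau> \<and> m b - m a \<le> p * (b - a)"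
  shows "\<exists>\<Omega>'. open \<Omega>' \<and> negligible (E - \<Omega>') \<and> emeasure \<nu> \<Omega>' \<le> ennreal p * emeasure lebesgue \<Omega>"
proof -
  obtain C where C: "countable C"
    "\<And>i. i \<in> C \<Longrightarrow> fst i < snd i \<and> {fst i..snd i} \<subseteq> \<Omega> \<and> m (snd i) - m (fst i) \<le> p * (snd i - fst i)"
    and dis: "disjoint_family_on (\<lambda>i. {fst i..snd i}) C"
    and neg: "negligible (E - (\<Union>i\<in>C. {fst i..snd i}))"
    using vitali_intervals[of E "\<lambda>a b. m b - m a \<le> p * (b - a)" \<Omega>] assms by blast
  define V where "V = (\<Union>i\<in>C. {fst i<..<snd i})"
  have dis': "disjoint_family_on (\<lambda>i. {fst i<..snd i}) C"
    using dis unfolding disjoint_family_on_def by fastforce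
  have "E - V \<subseteq> (E - (\<Union>i\<in>C. {fst i..snd i})) \<union> (fst ` C \<union> snd ` C)"
    unfolding V_def by (force simp: image_iff less_le)
  moreover have "negligible (fst ` C \<union> snd ` C)"
    using C(1) by (auto simp: negligible_iff_null_sets intro!: countable_imp_null_set_lborel null_sets_completionI)
  ultimately have neg': "negligible (E - V)"
    using neg negligible_Un negligible_subset by blast
  have "emeasure \<nu> V \<le> emeasure \<nu> (\<Union>i\<in>C. {fst i<..snd i})"
    unfolding V_def using C(1) by (intro emeasure_mono sets.countable_UN'') auto
  also have "\<dots> = (\<integral>\<^sup>+i. emeasure \<nu> {fst i<..snd i} \<partial>count_space C)"
    using C(1) dis' by (subst emeasure_UN_countable) auto
  also have "\<dots> \<le> (\<integral>\<^sup>+i. ennreal p * emeasure lebesgue {fst i..snd i} \<partial>count_space C)"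
  proof (rule nn_integral_mono)
    fix i assume "i \<in> space (count_space C)"
    then have i: "fst i < snd i" "m (snd i) - m (fst i) \<le> p * (snd i - fst i)"
      using C(2) by auto
    show "emeasure \<nu> {fst i<..snd i} \<le> ennreal p * emeasure lebesgue {fst i..snd i}"
      using i \<open>p \<ge> 0\<close> by (simp add: \<nu>_Ioc ennreal_mult'[symmetric] ennreal_leI)
  qed
  also have "\<dots> = ennreal p * (\<integral>\<^sup>+i. emeasure lebesgue {fst i..snd i} \<partial>count_space C)"
    by (rule nn_integral_cmult) simp
  also have "\<dots> = ennreal p * emeasure lebesgue (\<Union>i\<in>C. {fst i..snd i})"
    using C(1) dis by (subst emeasure_UN_countable) auto
  also have "\<dots> \<le> ennreal p * emeasure lebesgue \<Omega>"
    using C(2) assms(2) by (intro mult_left_mono emeasure_mono) auto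
  finally have "emeasure \<nu> V \<le> ennreal p * emeasure lebesgue \<Omega>" .
  moreover have "open V"
    unfolding V_def by auto
  ultimately show ?thesis
    using neg' by blast
qed

definition small_slopes :: "real \<Rightarrow> real set" where
  "small_slopes p = {x. \<forall>\<tau>>0. \<exists>a b. a \<le> x \<and> x \<le> b \<and> a < b \<and> b - a < \<tau> \<and> m b - m a \<le> p * (b - a)}"

definition large_slopes :: "real \<Rightarrow> real set" where
  "large_slopes q = {x. \<forall>\<tau>>0. \<exists>a b. a \<le> x \<and> x \<le> b \<and> a < b \<and> b - a < \<tau> \<and> q * (b - a) \<le> m b - m a}"

text \<open>\<open>s\<close> is the outer measure of \<open>E\<close>, finite since \<open>E\<close>
  is bounded. Enlarging a nearly optimal cover to an open set and shrinking that one gives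
  \<open>s \<le> c * (s + e)\<close> for every \<open>e > 0\<close>, which a positive
  \<open>s\<close> does not satisfy.\<close>

lemma negligible_bounded_cover:
  assumes "E \<subseteq> {-r<..<r}"
    and shrink: "\<And>\<Omega>. open \<Omega> \<Longrightarrow> E \<subseteq> \<Omega> \<Longrightarrow> emeasure lebesgue \<Omega> < \<infinity> \<Longrightarrow>
        \<exists>S\<in>sets lebesgue. E \<subseteq> S \<and> emeasure lebesgue S \<le> ennreal c * emeasure lebesgue \<Omega>"
    and "0 \<le> c" "c < 1"
  shows "negligible (E :: real set)"
proof -
  define \<M> where "\<M> = {S \<in> lmeasurable. E \<subseteq> S}"
  define s where "s = Inf (measure lebesgue ` \<M>)"
  have bdd: "bdd_below (measure lebesgue ` \<M>)"
    by (intro bdd_belowI[of _ 0]) auto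
  have "{-r<..<r} \<in> \<M>"
    using assms by (auto simp: \<M>_def)
  then have ne: "measure lebesgue ` \<M> \<noteq> {}"
    by blast
  have step: "s \<le> c * (measure lebesgue S + e)" if Se: "S \<in> \<M>" "e > 0" for S e
  proof -
    obtain \<Omega> where \<Omega>: "open \<Omega>" "S \<subseteq> \<Omega>" "\<Omega> - S \<in> lmeasurable" "emeasure lebesgue (\<Omega> - S) < ennreal e"
      using sets_lebesgue_outer_open[of S e] Se unfolding \<M>_def by blast
    have S: "S \<in> lmeasurable"
      using that by (simp add: \<M>_def)
    have "\<Omega> = S \<union> (\<Omega> - S)"
      using \<Omega> by auto
    then have \<Omega>m: "\<Omega> \<in> lmeasurable" and "measure lebesgue \<Omega> \<le> measure lebesgue S + measure lebesgue (\<Omega> - S)"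
      using S \<Omega>(3) by (metis fmeasurable.Un, metis measure_Un_le fmeasurableD)
    moreover have "measure lebesgue (\<Omega> - S) < e"
      using \<Omega>(3,4) that by (simp add: emeasure_eq_measure2 ennreal_less_iff)
    ultimately have \<Omega>e: "measure lebesgue \<Omega> < measure lebesgue S + e"
      by linarith
    obtain S' where S': "S' \<in> sets lebesgue" "E \<subseteq> S'" "emeasure lebesgue S' \<le> ennreal c * emeasure lebesgue \<Omega>"
      using shrink[of \<Omega>] \<Omega> \<Omega>m Se by (auto simp: \<M>_def fmeasurable_def)
    have fin: "emeasure lebesgue S' < \<infinity>"
      using S'(3) \<Omega>m by (auto simp: fmeasurable_def ennreal_mult_less_top intro: le_less_trans)
    then have "S' \<in> \<M>"
      using S' by (auto simp: \<M>_def fmeasurable_def)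
    then have "s \<le> measure lebesgue S'"
      unfolding s_def by (intro cInf_lower bdd) auto
    also have "\<dots> \<le> c * measure lebesgue \<Omega>"
    proof -
      have "ennreal (measure lebesgue S') \<le> ennreal (c * measure lebesgue \<Omega>)"
        using S'(3) \<Omega>m \<open>0 \<le> c\<close> \<open>S' \<in> \<M>\<close>
        by (simp add: \<M>_def emeasure_eq_measure2 ennreal_mult')
      then show ?thesis
        using \<open>0 \<le> c\<close> by (subst (asm) ennreal_le_iff) auto
    qed
    also have "\<dots> \<le> c * (measure lebesgue S + e)"
      using \<Omega>e \<open>0 \<le> c\<close> by (intro mult_left_mono) auto
    finally show ?thesis .
  qed
  have "s \<le> c * (s + e)" if "e > 0" for e
  proof -
    have "Inf (measure lebesgue ` \<M>) < s + e / 2"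
      using that by (simp add: s_def)
    then obtain S where "S \<in> \<M>" "measure lebesgue S < s + e / 2"
      using cInf_lessD[OF ne] by blast
    then have "s \<le> c * (measure lebesgue S + e / 2)"
      using step that by simp
    also have "\<dots> \<le> c * (s + e)"
      using \<open>measure lebesgue S < s + e / 2\<close> \<open>0 \<le> c\<close> by (intro mult_left_mono) auto
    finally show ?thesis .
  qed
  note se = this
  have "s \<le> 0"
  proof (rule ccontr)
    assume "\<not> s \<le> 0"
    then have "s \<le> c * (s + (1 - c) * s / 2)"
      using \<open>c < 1\<close> by (intro se) auto
    also have "\<dots> = c * s + c * ((1 - c) * s / 2)"
      by (simp add: algebra_simps)
    also have "c * ((1 - c) * s / 2) \<le> (1 - c) * s / 2"
      using \<open>c < 1\<close> \<open>0 \<le> c\<close> \<open>\<not> s \<le> 0\<close> mult_right_mono[of c 1 "(1 - c) * s / 2"] by simp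
    finally have "s - c * s \<le> (1 - c) * s / 2"
      by linarith
    then have "(1 - c) * s \<le> (1 - c) * s / 2"
      by (simp only: left_diff_distrib mult_1)
    then show False
      using \<open>\<not> s \<le> 0\<close> \<open>c < 1\<close> by (simp add: mult_le_0_iff)
  qed
  show ?thesis
    unfolding negligible_outer_le
  proof (intro allI impI)
    fix e :: real assume "e > 0"
    then have "Inf (measure lebesgue ` \<M>) < e"
      using \<open>s \<le> 0\<close> by (simp add: s_def)
    then obtain S where "S \<in> \<M>" "measure lebesgue S < e"
      using cInf_lessD[OF ne] by blast
    then show "\<exists>T. E \<subseteq> T \<and> T \<in> lmeasurable \<and> measure lebesgue T \<le> e"
      by (auto simp: \<M>_def intro!: exI[of _ S])
  qed
qed

lemma negligible_if_bounded_parts: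
  assumes "\<And>r. negligible (E \<inter> {-r<..<r::real})"
  shows "negligible E"
proof -
  have "E = (\<Union>k::nat. E \<inter> {-real k<..<real k})"
  proof -
    have "\<exists>k::nat. - real k < x \<and> x < real k" for x
      using reals_Archimedean2[of "\<bar>x\<bar>"] by (metis abs_less_iff minus_less_iff)
    then show ?thesis by auto
  qed
  then show ?thesis
    using negligible_countable_Union[of "range (\<lambda>k::nat. E \<inter> {-real k<..<real k})"] assms by auto
qed

text \<open>Small slopes give an open set whose Stieltjes mass is at most \<open>p\<close> times the
  length of \<Omega>; large slopes inside it bound the length of a new cover by that mass divided by
  \<open>q\<close>. Together the two covers shrink by the factor \<open>p / q\<close>.\<close>

lemma negligible_slope_gap:
  assumes "p < q"
  shows "negligible (small_slopes p \<inter> large_slopes q)"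
proof (cases "p < 0")
  case True
  have "m b - m a > p * (b - a)" if "a < b" for a b
    using mono[of a b] that True by (smt (verit) mult_neg_pos)
  then have "x \<notin> small_slopes p" for x
    unfolding small_slopes_def mem_Collect_eq not_all not_imp
    by (intro exI[of _ "1::real"]) (auto simp: not_le[symmetric])
  then have "small_slopes p = {}"
    by blast
  then show ?thesis by simp
next
  case False
  then have q: "q > 0" using assms by simp
  show ?thesis
  proof (rule negligible_if_bounded_parts)
    fix r
    define E where "E = small_slopes p \<inter> large_slopes q \<inter> {-r<..<r}"
    show "negligible (small_slopes p \<inter> large_slopes q \<inter> {-r<..<r})"
      unfolding E_def[symmetric]
    proof (rule negligible_bounded_cover[of _ r "p / q"])
      fix \<Omega> assume \<Omega>: "open \<Omega>" "E \<subseteq> \<Omega>" "emeasure lebesgue \<Omega> < \<infinity>"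
      obtain \<Omega>' where \<Omega>': "open \<Omega>'" "negligible (E - \<Omega>')" "emeasure \<nu> \<Omega>' \<le> ennreal p * emeasure lebesgue \<Omega>"
        using increment_le_cover[of p \<Omega> E] \<Omega> False unfolding E_def small_slopes_def by fastforce
      obtain S where S: "S \<in> sets lebesgue" "E \<inter> \<Omega>' \<subseteq> S" "ennreal q * emeasure lebesgue S \<le> emeasure \<nu> \<Omega>'"
        using increment_ge_cover[of q \<Omega>' "E \<inter> \<Omega>'"] \<Omega>' q unfolding E_def large_slopes_def by fastforce
      have nl: "E - \<Omega>' \<in> null_sets lebesgue"
        using \<Omega>'(2) by (simp add: negligible_iff_null_sets)
      have "ennreal q * emeasure lebesgue S \<le> ennreal p * emeasure lebesgue \<Omega>"
        using S \<Omega>' by order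
      then have "ennreal (1/q) * (ennreal q * emeasure lebesgue S) \<le> ennreal (1/q) * (ennreal p * emeasure lebesgue \<Omega>)"
        by (intro mult_left_mono) auto
      then have "emeasure lebesgue S \<le> ennreal (p / q) * emeasure lebesgue \<Omega>"
        using q False by (simp add: mult.assoc[symmetric] ennreal_mult'[symmetric])
      then have "emeasure lebesgue (S \<union> (E - \<Omega>')) \<le> ennreal (p / q) * emeasure lebesgue \<Omega>"
        using emeasure_Un_null_set[OF S(1) nl] by simp
      moreover have "S \<union> (E - \<Omega>') \<in> sets lebesgue"
        using S nl by auto
      ultimately show "\<exists>S\<in>sets lebesgue. E \<subseteq> S \<and> emeasure lebesgue S \<le> ennreal (p / q) * emeasure lebesgue \<Omega>"
        using S(2) by (intro bexI[of _ "S \<union> (E - \<Omega>')"]) auto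
    next
      show "E \<subseteq> {-r<..<r}"
        unfolding E_def by blast
      show "0 \<le> p / q" "p / q < 1"
        using assms q False by simp_all
    qed
  qed
qed

text \<open>The Stieltjes mass of a bounded interval is finite, so a cover by intervals of slope at
  least \<open>k\<close> has length at most a constant over \<open>k\<close>.\<close>

lemma negligible_infinite_slope: "negligible (\<Inter>k::nat. large_slopes (real k))"
proof (rule negligible_if_bounded_parts)
  fix r
  define E where "E = (\<Inter>k::nat. large_slopes (real k)) \<inter> {-r<..<r}"
  have "negligible E"
    unfolding negligible_outer_le
  proof (intro allI impI)
    fix e :: real assume "e > 0"
    have "emeasure \<nu> {-r<..<r} \<le> emeasure \<nu> {-r<..r}"
      by (rule emeasure_mono) auto
    also have "\<dots> < \<infinity>"
      by (cases "-r \<le> r") (auto simp: \<nu>_Ioc)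
    finally obtain M where M: "emeasure \<nu> {-r<..<r} = ennreal M" "M \<ge> 0"
      by (cases "emeasure \<nu> {-r<..<r}") auto
    obtain k :: nat where k: "M / e < real k" "k > 0"
      using reals_Archimedean2[of "max (M/e) 0"] by auto
    obtain S where S: "S \<in> sets lebesgue" "E \<subseteq> S" "ennreal k * emeasure lebesgue S \<le> emeasure \<nu> {-r<..<r}"
      using increment_ge_cover[of k "{-r<..<r}" E] k unfolding E_def large_slopes_def
      by (auto 0 3)
    have fin: "emeasure lebesgue S < \<infinity>"
      using S(3) k M by (metis ennreal_0 ennreal_less_top ennreal_mult_eq_top_iff infinity_ennreal_def
          le_less_trans less_irrefl less_top of_nat_0_less_iff ennreal_eq_0_iff not_le)
    then have S': "S \<in> lmeasurable"
      using S by (auto simp: fmeasurable_def)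
    then have "ennreal (k * measure lebesgue S) \<le> ennreal M"
      using S(3) M by (simp add: emeasure_eq_measure2 ennreal_mult')
    then have "k * measure lebesgue S \<le> M"
      using M by (subst (asm) ennreal_le_iff) auto
    also have "M \<le> k * e"
      using k \<open>e > 0\<close> by (simp add: field_simps)
    finally have "measure lebesgue S \<le> e"
      using k by simp
    then show "\<exists>T. E \<subseteq> T \<and> T \<in> lmeasurable \<and> measure lebesgue T \<le> e"
      using S S' by blast
  qed
  then show "negligible ((\<Inter>k::nat. large_slopes (real k)) \<inter> {-r<..<r})"
    by (simp add: E_def)
qed

text \<open>The quotients run over all short intervals containing \<open>x\<close>, with
  \<open>x\<close> not necessarily an endpoint. Outside \<open>N\<close> they are bounded, and no
  two rationals separate their lower from their upper limit.\<close>

lemma derivative_ae: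
  "\<exists>N. negligible N \<and> (\<forall>x. x \<notin> N \<longrightarrow> (\<exists>D. \<forall>e>0. \<exists>\<tau>>0. \<forall>a b. a \<le> x \<longrightarrow> x \<le> b \<longrightarrow> b - a < \<tau> \<longrightarrow>
      \<bar>m b - m a - D * (b - a)\<bar> \<le> e * (b - a)))"
proof -
  define I where "I = {(p, q). p \<in> \<rat> \<and> q \<in> \<rat> \<and> p < (q::real)}"
  define N where "N = (\<Inter>k::nat. large_slopes (real k)) \<union> (\<Union>(p,q)\<in>I. small_slopes p \<inter> large_slopes q)"
  have "countable I"
  proof (rule countable_subset)
    show "I \<subseteq> \<rat> \<times> \<rat>" by (auto simp: I_def)
  qed (simp add: countable_rat)
  then have "negligible (\<Union>(p,q)\<in>I. small_slopes p \<inter> large_slopes q)"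
    by (intro negligible_countable_Union) (auto simp: I_def negligible_slope_gap)
  then have "negligible N"
    unfolding N_def by (intro negligible_Un negligible_infinite_slope)
  moreover have "\<exists>D. \<forall>e>0. \<exists>\<tau>>0. \<forall>a b. a \<le> x \<longrightarrow> x \<le> b \<longrightarrow> b - a < \<tau> \<longrightarrow>
      \<bar>m b - m a - D * (b - a)\<bar> \<le> e * (b - a)" if x: "x \<notin> N" for x
  proof -
    define Q where "Q = {p. p \<in> \<rat> \<and> x \<notin> small_slopes p}"
    define D where "D = Sup Q"
    obtain k :: nat where k: "x \<notin> large_slopes k"
      using x by (auto simp: N_def)
    have gap: "x \<notin> small_slopes p \<or> x \<notin> large_slopes q" if "p \<in> \<rat>" "q \<in> \<rat>" "p < q" for p q
      using x that by (auto simp: N_def I_def)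
    have bound: "p \<le> real k" if pQ: "p \<in> Q" for p
    proof (rule ccontr)
      assume "\<not> p \<le> real k"
      obtain \<tau>1 where \<tau>1: "\<tau>1 > 0" "\<And>a b. a \<le> x \<Longrightarrow> x \<le> b \<Longrightarrow> a < b \<Longrightarrow> b - a < \<tau>1 \<Longrightarrow> p * (b - a) < m b - m a"
        using pQ unfolding Q_def small_slopes_def by (force simp: not_le)
      obtain \<tau>2 where \<tau>2: "\<tau>2 > 0" "\<And>a b. a \<le> x \<Longrightarrow> x \<le> b \<Longrightarrow> a < b \<Longrightarrow> b - a < \<tau>2 \<Longrightarrow> m b - m a < real k * (b - a)"
        using k unfolding large_slopes_def by (force simp: not_le)
      define h where "h = min \<tau>1 \<tau>2 / 2"
      have h: "h > 0" "h < \<tau>1" "h < \<tau>2"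
        using \<tau>1 \<tau>2 by (auto simp: h_def)
      show False
        using \<tau>1(2)[of x "x+h"] \<tau>2(2)[of x "x+h"] h \<open>\<not> p \<le> real k\<close>
        by simp (smt (verit) mult_right_mono)
    qed
    have bdd: "bdd_above Q"
      unfolding bdd_above_def using bound by blast
    have "-1 \<in> Q"
    proof -
      have "m b - m a > - 1 * (b - a)" if "a < b" for a b
        using mono[of a b] that by auto
      then have "x \<notin> small_slopes (-1)"
        unfolding small_slopes_def mem_Collect_eq not_all not_imp
        by (intro exI[of _ "1::real"]) (auto simp: not_le[symmetric])
      then show ?thesis
        by (simp add: Q_def)
    qed
    then have ne: "Q \<noteq> {}"
      by auto
    show ?thesis
    proof (rule exI[of _ D], intro allI impI)
      fix e :: real assume "e > 0"
      have "D - e < Sup Q"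
        using \<open>e > 0\<close> by (simp add: D_def)
      then obtain p where p: "p \<in> Q" "D - e < p"
        using less_cSupD[OF ne] by blast
      \<comment> \<open>Two rationals above \<open>D\<close> are required:
        \<open>p1 \<notin> Q\<close> says that \<open>p1\<close> is a small slope at
        \<open>x\<close>, and the gap property then excludes the larger \<open>q1\<close> as a large
        slope.\<close>
      obtain p1 where p1: "p1 \<in> \<rat>" "D < p1" "p1 < D + e / 2"
        using Rats_dense_in_real[of D "D + e / 2"] \<open>e > 0\<close> by auto
      obtain q1 where q1: "q1 \<in> \<rat>" "p1 < q1" "q1 < D + e"
        using Rats_dense_in_real[of p1 "D + e"] p1 \<open>e > 0\<close> by auto
      have "p1 \<notin> Q"
        using p1(2) cSup_upper[OF _ bdd, of p1] by (auto simp: D_def)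
      then have "x \<notin> large_slopes q1"
        using gap[of p1 q1] p1 q1 by (auto simp: Q_def)
      then obtain \<tau>2 where \<tau>2: "\<tau>2 > 0" "\<And>a b. a \<le> x \<Longrightarrow> x \<le> b \<Longrightarrow> a < b \<Longrightarrow> b - a < \<tau>2 \<Longrightarrow> m b - m a < q1 * (b - a)"
        unfolding large_slopes_def by (force simp: not_le)
      obtain \<tau>1 where \<tau>1: "\<tau>1 > 0" "\<And>a b. a \<le> x \<Longrightarrow> x \<le> b \<Longrightarrow> a < b \<Longrightarrow> b - a < \<tau>1 \<Longrightarrow> p * (b - a) < m b - m a"
        using p(1) unfolding Q_def small_slopes_def by (force simp: not_le)
      show "\<exists>\<tau>>0. \<forall>a b. a \<le> x \<longrightarrow> x \<le> b \<longrightarrow> b - a < \<tau> \<longrightarrow> \<bar>m b - m a - D * (b - a)\<bar> \<le> e * (b - a)"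
      proof (intro exI[of _ "min \<tau>1 \<tau>2"] conjI allI impI)
        fix a b assume ab: "a \<le> x" "x \<le> b" "b - a < min \<tau>1 \<tau>2"
        show "\<bar>m b - m a - D * (b - a)\<bar> \<le> e * (b - a)"
        proof (cases "a < b")
          case True
          have "m b - m a < q1 * (b - a)"
            using \<tau>2(2)[of a b] ab True by simp
          also have "\<dots> \<le> (D + e) * (b - a)"
            using q1 True by (intro mult_right_mono) auto
          finally have "m b - m a \<le> (D + e) * (b - a)"
            by simp
          moreover have "(D - e) * (b - a) \<le> p * (b - a)"
            using p True by (intro mult_right_mono) auto
          moreover have "p * (b - a) < m b - m a"
            using \<tau>1(2)[of a b] ab True by simp
          ultimately show ?thesis
            unfolding abs_le_iff left_diff_distrib distrib_right by linarith
        next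
          case False
          then have "a = b"
            using ab by simp
          then show ?thesis
            by simp
        qed
      qed (use \<tau>1 \<tau>2 in auto)
    qed
  qed
  ultimately show ?thesis by blast
qed

end

section \<open>Alexandrov's theorem\<close>

text \<open>This integrates the first order expansion of \<open>m\<close> from \<open>x\<close> to
  \<open>x + t\<close> by telescoping. On each of \<open>Suc n\<close> equal steps the subgradients
  at both ends enclose the increment of \<open>g\<close>; the discretization error is of order
  \<open>D * t^2 / Suc n\<close> and disappears in the limit.\<close>

lemma subgradient_second_order:
  fixes g m :: "real \<Rightarrow> real"
  assumes sub: "\<And>y z. g y + m y * (z - y) \<le> g z"
    and D: "\<And>t. \<bar>t\<bar> < \<tau> \<Longrightarrow> \<bar>m (x + t) - m x - D * t\<bar> \<le> e * \<bar>t\<bar>"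
    and t: "\<bar>t\<bar> < \<tau>" and "e \<ge> 0"
  shows "\<bar>g (x + t) - g x - m x * t - D / 2 * t\<^sup>2\<bar> \<le> e * t\<^sup>2"
proof -
  define k where "k = (\<lambda>s. g (x + s) - m x * s - D / 2 * s\<^sup>2)"
  have inc: "\<bar>k (a + h) - k a\<bar> \<le> e * \<bar>t\<bar> * \<bar>h\<bar> + \<bar>D\<bar> * h\<^sup>2" if "\<bar>a\<bar> \<le> \<bar>t\<bar>" "\<bar>a + h\<bar> \<le> \<bar>t\<bar>" for a h
  proof -
    have est: "\<bar>m (x + c) * h - m x * h - D * c * h\<bar> \<le> e * \<bar>t\<bar> * \<bar>h\<bar>" if "\<bar>c\<bar> \<le> \<bar>t\<bar>" for c
    proof -
      have "\<bar>m (x + c) - m x - D * c\<bar> \<le> e * \<bar>t\<bar>"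
        using D[of c] that t \<open>e \<ge> 0\<close> mult_left_mono[OF that, of e] by simp
      then have "\<bar>m (x + c) - m x - D * c\<bar> * \<bar>h\<bar> \<le> e * \<bar>t\<bar> * \<bar>h\<bar>"
        by (intro mult_right_mono) auto
      then show ?thesis
        by (simp add: abs_mult[symmetric] left_diff_distrib)
    qed
    \<comment> \<open>The same increment is written with the slope at \<open>x + a\<close> and with
      the slope at \<open>x + (a + h)\<close>: the subgradient inequality at the first point bounds
      it from below, the one at the second point from above.\<close>
    have "k (a + h) - k a = g (x + (a + h)) - g (x + a) - m x * h - D * a * h - D / 2 * h\<^sup>2"
      by (simp add: k_def power2_eq_square field_simps)
    moreover have "k (a + h) - k a = g (x + (a + h)) - g (x + a) - m x * h - D * (a + h) * h + D / 2 * h\<^sup>2"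
      by (simp add: k_def power2_eq_square field_simps)
    moreover have "m (x + a) * h \<le> g (x + (a + h)) - g (x + a)"
      using sub[of "x + a" "x + (a + h)"] by simp
    moreover have "g (x + (a + h)) - g (x + a) \<le> m (x + (a + h)) * h"
      using sub[of "x + (a + h)" "x + a"] by simp
    moreover have "\<bar>D / 2 * h\<^sup>2\<bar> \<le> \<bar>D\<bar> * h\<^sup>2"
      by (simp add: abs_mult mult_right_mono)
    ultimately show ?thesis
      using est[of a] est[of "a + h"] that by linarith
  qed
  have bound: "\<bar>k t - k 0\<bar> \<le> e * t\<^sup>2 + \<bar>D\<bar> * t\<^sup>2 / real (Suc n)" for n
  proof -
    define h where "h = t / real (Suc n)"
    have step: "\<bar>k (real i * h) - k 0\<bar> \<le> real i * (e * \<bar>t\<bar> * \<bar>h\<bar> + \<bar>D\<bar> * h\<^sup>2)" if "i \<le> Suc n" for i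
      using that
    proof (induction i)
      case (Suc i)
      have le: "\<bar>real j * h\<bar> \<le> \<bar>t\<bar>" if "j \<le> Suc n" for j
      proof -
        have "\<bar>real j * h\<bar> = (real j / real (Suc n)) * \<bar>t\<bar>"
          by (simp add: h_def abs_mult)
        also have "\<dots> \<le> 1 * \<bar>t\<bar>"
          using that by (intro mult_right_mono) auto
        finally show ?thesis by simp
      qed
      have "\<bar>k (real i * h + h) - k (real i * h)\<bar> \<le> e * \<bar>t\<bar> * \<bar>h\<bar> + \<bar>D\<bar> * h\<^sup>2"
        using le[of i] le[of "Suc i"] Suc.prems by (intro inc) (auto simp: distrib_right add.commute)
      moreover have "real (Suc i) * h = real i * h + h"
        by (simp add: distrib_right)
      moreover have c: "real (Suc i) * c = real i * c + c" for c :: real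
        by (simp add: distrib_right)
      ultimately show ?case
        using Suc.IH[OF Suc_leD[OF Suc.prems]] unfolding c by linarith
    qed simp
    have "r * (e * \<bar>t\<bar> * \<bar>t / r\<bar> + \<bar>D\<bar> * (t / r)\<^sup>2) = e * t\<^sup>2 + \<bar>D\<bar> * t\<^sup>2 / r" if "r > 0" for r
      using that by (simp add: abs_mult power2_eq_square field_simps)
    from this[of "real (Suc n)"]
    have "real (Suc n) * (e * \<bar>t\<bar> * \<bar>h\<bar> + \<bar>D\<bar> * h\<^sup>2) = e * t\<^sup>2 + \<bar>D\<bar> * t\<^sup>2 / real (Suc n)"
      by (simp add: h_def)
    moreover have "real (Suc n) * h = t"
      by (simp add: h_def)
    ultimately show ?thesis
      using step[of "Suc n"] by simp
  qed
  have "(\<lambda>n. e * t\<^sup>2 + \<bar>D\<bar> * t\<^sup>2 / real (Suc n)) \<longlonglongrightarrow> e * t\<^sup>2 + 0"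
    by (intro tendsto_intros LIMSEQ_Suc[OF lim_const_over_n])
  then have "\<bar>k t - k 0\<bar> \<le> e * t\<^sup>2 + 0"
    by (rule LIMSEQ_le_const) (use bound in auto)
  moreover have "k t - k 0 = g (x + t) - g x - m x * t - D / 2 * t\<^sup>2"
    by (simp add: k_def)
  ultimately show ?thesis
    by simp
qed

definition slope :: "('a::real_vector \<Rightarrow> real) \<Rightarrow> 'a \<Rightarrow> 'a \<Rightarrow> real \<Rightarrow> real" where
  "slope U v x t = (U (x + t *\<^sub>R v) - U x) / t"

text \<open>
  For continuous \<open>U\<close> these sets are closed, which makes the set of points without a second order
  expansion along \<open>v\<close> a Borel set and Fubini applicable.
\<close>

definition slope_stable :: "('a::real_vector \<Rightarrow> real) \<Rightarrow> 'a \<Rightarrow> real \<Rightarrow> nat \<Rightarrow> real \<Rightarrow> 'a set" where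
  "slope_stable U v \<delta> n q =
     {x. \<forall>s t. s \<noteq> 0 \<longrightarrow> t \<noteq> 0 \<longrightarrow> \<bar>s\<bar> < 1 / real (Suc n) \<longrightarrow> \<bar>t\<bar> < 1 / real (Suc n) \<longrightarrow>
        \<bar>slope U v x t - slope U v x s - q * (t - s)\<bar> \<le> \<delta> * (\<bar>s\<bar> + \<bar>t\<bar>)}"

text \<open>If the right derivative \<open>m\<close> has derivative \<open>D\<close> at
  \<open>x\<close>, the slope over \<open>t\<close> is \<open>m x + D / 2 * t\<close> up to a small
  multiple of \<open>t\<close>. Differences of slopes no longer contain \<open>m x\<close>, so only
  a number near \<open>D / 2\<close> has to be recorded. It may be rational, which keeps the family
  of sets countable.\<close>

lemma convex_slope_stable_ae:
  fixes g :: "real \<Rightarrow> real"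
  assumes "convex_on UNIV g"
  shows "\<exists>N. negligible N \<and> (\<forall>x. x \<notin> N \<longrightarrow> (\<forall>\<delta>>0. \<exists>n. \<exists>q\<in>\<rat>. x \<in> slope_stable g 1 \<delta> n q))"
proof -
  \<comment> \<open>The infimum of the difference quotients to the right is the right derivative of
    \<open>g\<close>. In this form it is a subgradient, and being below every single quotient yields
    its right continuity.\<close>
  define m where "m = (\<lambda>x. Inf ((\<lambda>t. (g x - g t) / (x - t)) ` ({x<..} \<inter> UNIV)))"
  have sub: "g y + m y * (z - y) \<le> g z" for y z
    using convex_le_Inf_differential[OF assms, of y z] by (simp add: m_def)
  have m_le: "m y \<le> (g y - g t) / (y - t)" if "y < t" for y t
    using sub[of y t] that by (simp add: field_simps)
  have mono: "m a \<le> m b" if "a \<le> b" for a b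
  proof (cases "a = b")
    case False
    have "m a * (b - a) \<le> m b * (b - a)"
      using sub[of a b] sub[of b a] by (simp add: algebra_simps)
    then show ?thesis
      using that False by simp
  qed simp
  have cont_g: "isCont g x" for x
    using convex_on_continuous[OF _ assms] by (simp add: continuous_on_eq_continuous_at)
  have rc: "continuous (at_right a) m" for a
    unfolding continuous_within
  proof (rule order_tendstoI)
    fix c assume "c < m a"
    then show "\<forall>\<^sub>F x in at_right a. c < m x"
      unfolding eventually_at_right_field using mono by (intro exI[of _ "a + 1"]) (force intro: less_le_trans)
  next
    fix c assume "m a < c"
    then have "Inf ((\<lambda>t. (g a - g t) / (a - t)) ` ({a<..} \<inter> UNIV)) < c"
      by (simp add: m_def)
    from cInf_lessD[OF _ this] obtain t where t: "a < t" "(g a - g t) / (a - t) < c"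
      using gt_ex[of a] by auto
    have "((\<lambda>x. (g x - g t) / (x - t)) \<longlongrightarrow> (g a - g t) / (a - t)) (at_right a)"
      using t cont_g[of a] by (intro tendsto_intros) (auto simp: isCont_def filterlim_at_split)
    then have "\<forall>\<^sub>F x in at_right a. (g x - g t) / (x - t) < c"
      using t order_tendstoD(2) by blast
    moreover have "\<forall>\<^sub>F x in at_right a. x < t"
      unfolding eventually_at_right_field using t by auto
    ultimately show "\<forall>\<^sub>F x in at_right a. m x < c"
    proof eventually_elim
      case (elim x)
      then show ?case using m_le[of x t] by linarith
    qed
  qed
  interpret stieltjes m
    by unfold_locales (use mono rc in auto)
  obtain N where N: "negligible N"
    and der: "\<And>x. x \<notin> N \<Longrightarrow> \<exists>D. \<forall>e>0. \<exists>\<tau>>0. \<forall>a b. a \<le> x \<longrightarrow> x \<le> b \<longrightarrow> b - a < \<tau> \<longrightarrow>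
      \<bar>m b - m a - D * (b - a)\<bar> \<le> e * (b - a)"
    using derivative_ae by blast
  have "\<exists>n. \<exists>q\<in>\<rat>. x \<in> slope_stable g 1 \<delta> n q" if x: "x \<notin> N" and \<delta>: "\<delta> > 0" for x \<delta>
  proof -
    obtain D where D: "\<And>e. e > 0 \<Longrightarrow> \<exists>\<tau>>0. \<forall>a b. a \<le> x \<longrightarrow> x \<le> b \<longrightarrow> b - a < \<tau> \<longrightarrow>
      \<bar>m b - m a - D * (b - a)\<bar> \<le> e * (b - a)"
      using der[OF x] by blast
    obtain \<tau> where \<tau>: "\<tau> > 0" "\<And>a b. a \<le> x \<Longrightarrow> x \<le> b \<Longrightarrow> b - a < \<tau> \<Longrightarrow> \<bar>m b - m a - D * (b - a)\<bar> \<le> \<delta> / 2 * (b - a)"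
      using D[of "\<delta> / 2"] \<delta> by auto
    have md: "\<bar>m (x + t) - m x - D * t\<bar> \<le> \<delta> / 2 * \<bar>t\<bar>" if "\<bar>t\<bar> < \<tau>" for t
    proof (cases "t \<ge> 0")
      case True then show ?thesis using \<tau>(2)[of x "x + t"] that by auto
    next
      case False then show ?thesis using \<tau>(2)[of "x + t" x] that by auto
    qed
    \<comment> \<open>Half of the tolerance is spent on replacing \<open>D / 2\<close> by
      \<open>q\<close>, the other half on the expansions of the two slopes.\<close>
    obtain q where q: "q \<in> \<rat>" "D / 2 < q" "q < D / 2 + \<delta> / 2"
      using Rats_dense_in_real[of "D / 2" "D / 2 + \<delta> / 2"] \<delta> by auto
    obtain n where n: "1 / real (Suc n) < \<tau>"
      using nat_approx_posE[OF \<tau>(1)] by blast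
    have sl: "\<bar>slope g 1 x t - m x - D / 2 * t\<bar> \<le> \<delta> / 2 * \<bar>t\<bar>" if "t \<noteq> 0" "\<bar>t\<bar> < 1 / real (Suc n)" for t
    proof -
      have "\<bar>g (x + t) - g x - m x * t - D / 2 * t\<^sup>2\<bar> \<le> \<delta> / 2 * t\<^sup>2"
        by (rule subgradient_second_order[OF sub md]) (use that n \<delta> in auto)
      then have "\<bar>g (x + t) - g x - m x * t - D / 2 * t\<^sup>2\<bar> / \<bar>t\<bar> \<le> \<delta> / 2 * t\<^sup>2 / \<bar>t\<bar>"
        by (intro divide_right_mono) auto
      moreover have "\<delta> / 2 * t\<^sup>2 / \<bar>t\<bar> = \<delta> / 2 * \<bar>t\<bar>"
        using that by (simp add: field_simps power2_eq_square)
      moreover have "(g (x + t) - g x - m x * t - D / 2 * t\<^sup>2) / t = slope g 1 x t - m x - D / 2 * t"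
        using that by (simp add: slope_def field_simps power2_eq_square)
      ultimately show ?thesis
        by (simp flip: abs_divide)
    qed
    have "x \<in> slope_stable g 1 \<delta> n q"
      unfolding slope_stable_def mem_Collect_eq
    proof (intro allI impI)
      fix s t :: real assume st: "s \<noteq> 0" "t \<noteq> 0" "\<bar>s\<bar> < 1 / real (Suc n)" "\<bar>t\<bar> < 1 / real (Suc n)"
      have "\<bar>(D / 2 - q) * (t - s)\<bar> \<le> \<delta> / 2 * (\<bar>s\<bar> + \<bar>t\<bar>)"
        unfolding abs_mult using q \<delta> by (intro mult_mono) auto
      moreover have "slope g 1 x t - slope g 1 x s - q * (t - s) =
        (slope g 1 x t - m x - D / 2 * t) - (slope g 1 x s - m x - D / 2 * s) + (D / 2 - q) * (t - s)"
        unfolding left_diff_distrib right_diff_distrib by linarith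
      moreover have "\<delta> * (\<bar>s\<bar> + \<bar>t\<bar>) = \<delta> / 2 * (\<bar>s\<bar> + \<bar>t\<bar>) + \<delta> / 2 * \<bar>s\<bar> + \<delta> / 2 * \<bar>t\<bar>"
        by (simp add: field_simps)
      ultimately show "\<bar>slope g 1 x t - slope g 1 x s - q * (t - s)\<bar> \<le> \<delta> * (\<bar>s\<bar> + \<bar>t\<bar>)"
        using sl[OF st(1,3)] sl[OF st(2,4)] by linarith
    qed
    then show ?thesis
      using q by blast
  qed
  then show ?thesis
    using N by blast
qed

text \<open>Integrate the indicator of \<open>x + t *\<^sub>R v \<in> S\<close> over all
  \<open>x\<close> and over \<open>t\<close> in the unit interval. Integrating over \<open>x\<close>
  first gives the measure of \<open>S\<close> by translation invariance, integrating over
  \<open>t\<close> first gives 0. No coordinates adapted to \<open>v\<close> are chosen.\<close>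

lemma negligible_lines:
  fixes S :: "'a::euclidean_space set"
  assumes S: "S \<in> sets borel" and lines: "\<And>x. negligible {t::real. x + t *\<^sub>R v \<in> S}"
  shows "negligible S"
proof -
  define F :: "'a \<times> real \<Rightarrow> ennreal" where
    "F = (\<lambda>z. indicator {0..1} (snd z) * indicator S (fst z + snd z *\<^sub>R v))"
  have [measurable]: "S \<in> sets borel" by fact
  have meas: "F \<in> borel_measurable (lborel \<Otimes>\<^sub>M lborel)"
    unfolding F_def by measurable
  have inner1: "(\<integral>\<^sup>+x. F (x, t) \<partial>lborel) = indicator {0..1} t * emeasure lborel S" for t
  proof -
    have "(\<integral>\<^sup>+x. F (x, t) \<partial>lborel) = indicator {0..1} t * (\<integral>\<^sup>+x. indicator S (t *\<^sub>R v + x) \<partial>lborel)"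
      unfolding F_def by (subst nn_integral_cmult[symmetric]) (auto simp: add.commute)
    also have "(\<integral>\<^sup>+x. indicator S (t *\<^sub>R v + x) \<partial>lborel) = (\<integral>\<^sup>+x. indicator S x \<partial>distr lborel borel ((+) (t *\<^sub>R v)))"
      by (subst nn_integral_distr) auto
    also have "\<dots> = emeasure lborel S"
      by (simp add: lborel_distr_plus)
    finally show ?thesis .
  qed
  have inner2: "(\<integral>\<^sup>+t. F (x, t) \<partial>lborel) = 0" for x
  proof -
    have "{t. x + t *\<^sub>R v \<in> S} \<in> null_sets lebesgue"
      using lines[of x] by (simp add: negligible_iff_null_sets)
    moreover have m: "{t. x + t *\<^sub>R v \<in> S} \<in> sets borel"
      using measurable_sets_borel[of "\<lambda>t. x + t *\<^sub>R v" borel S] by (simp add: vimage_def S)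
    ultimately have nl: "{t. x + t *\<^sub>R v \<in> S} \<in> null_sets lborel"
      by (metis null_setsD1 null_setsI emeasure_completion main_part_sets sets_lborel sets.sets_into_space
          null_sets_completion_iff)
    have "AE t in lborel. F (x, t) = 0"
      by (rule AE_I'[OF nl]) (auto simp: F_def indicator_def)
    moreover have "(\<lambda>t. F (x, t)) \<in> borel_measurable lborel"
      using meas by measurable
    ultimately show ?thesis
      by (simp add: nn_integral_0_iff_AE)
  qed
  have "emeasure lborel S = (\<integral>\<^sup>+t. indicator {0..1::real} t * emeasure lborel S \<partial>lborel)"
    by (subst nn_integral_multc) auto
  also have "\<dots> = (\<integral>\<^sup>+t. (\<integral>\<^sup>+x. F (x, t) \<partial>lborel) \<partial>lborel)"
    by (simp add: inner1)
  also have "\<dots> = (\<integral>\<^sup>+x. (\<integral>\<^sup>+t. F (x, t) \<partial>lborel) \<partial>lborel)"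
    by (rule lborel_pair.Fubini) (rule meas)
  also have "\<dots> = 0"
    by (simp add: inner2)
  finally have "S \<in> null_sets lborel"
    using S by auto
  then show ?thesis
    by (simp add: negligible_iff_null_sets null_sets_completionI)
qed

lemma closed_slope_stable:
  fixes U :: "'a::real_normed_vector \<Rightarrow> real"
  assumes "continuous_on UNIV U"
  shows "closed (slope_stable U v \<delta> n q)"
proof -
  have c: "continuous_on UNIV (\<lambda>x. slope U v x t)" for t
    unfolding slope_def
    by (cases "t = 0") (auto intro!: continuous_intros continuous_on_compose2[OF assms])
  have "closed {x. P \<longrightarrow> \<bar>slope U v x t - slope U v x s - q * (t - s)\<bar> \<le> \<delta> * (\<bar>s\<bar> + \<bar>t\<bar>)}" for s t P
    by (cases P) (auto intro!: closed_Collect_le continuous_intros c)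
  then show ?thesis
    unfolding slope_stable_def imp_conjL[symmetric] by (intro closed_Collect_all)
qed

lemma slope_stable_ae:
  fixes U :: "'a::euclidean_space \<Rightarrow> real"
  assumes "convex_on UNIV U" "\<delta> > 0"
  shows "negligible (- (\<Union>n. \<Union>q\<in>\<rat>. slope_stable U v \<delta> n q))"
proof (rule negligible_lines[where v = v])
  have cont: "continuous_on UNIV U"
    using convex_on_continuous[OF _ assms(1)] by simp
  have "(\<Union>n. \<Union>q\<in>\<rat>. slope_stable U v \<delta> n q) \<in> sets borel"
    using closed_slope_stable[OF cont] countable_rat
    by (intro sets.countable_UN'' sets.countable_UN) auto
  then show "- (\<Union>n. \<Union>q\<in>\<rat>. slope_stable U v \<delta> n q) \<in> sets borel"
    by (rule borel_comp)
next
  fix x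
  define g where "g = (\<lambda>t. U (x + t *\<^sub>R v))"
  have "convex_on UNIV g"
  proof (rule convex_onI)
    fix t a b :: real assume "0 < t" "t < 1"
    have "x + ((1 - t) *\<^sub>R a + t *\<^sub>R b) *\<^sub>R v = (1 - t) *\<^sub>R (x + a *\<^sub>R v) + t *\<^sub>R (x + b *\<^sub>R v)"
      by (simp add: algebra_simps)
    then show "g ((1 - t) *\<^sub>R a + t *\<^sub>R b) \<le> (1 - t) * g a + t * g b"
      unfolding g_def using convex_onD[OF assms(1), of t] \<open>0 < t\<close> \<open>t < 1\<close> by simp
  qed simp
  then obtain N where N: "negligible N" "\<And>y. y \<notin> N \<Longrightarrow> \<exists>n. \<exists>q\<in>\<rat>. y \<in> slope_stable g 1 \<delta> n q"
    using convex_slope_stable_ae[of g] assms(2) by metis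
  have "slope g 1 y t = slope U v (x + y *\<^sub>R v) t" for y t
    by (simp add: slope_def g_def algebra_simps)
  then have "y \<in> slope_stable g 1 \<delta> n q \<longleftrightarrow> x + y *\<^sub>R v \<in> slope_stable U v \<delta> n q" for y n q
    by (simp add: slope_stable_def)
  note iff = this
  have "{t. x + t *\<^sub>R v \<in> - (\<Union>n. \<Union>q\<in>\<rat>. slope_stable U v \<delta> n q)} \<subseteq> N"
  proof (rule subsetI, rule ccontr)
    fix t assume t: "t \<in> {t. x + t *\<^sub>R v \<in> - (\<Union>n. \<Union>q\<in>\<rat>. slope_stable U v \<delta> n q)}" "t \<notin> N"
    obtain n q where "q \<in> \<rat>" "t \<in> slope_stable g 1 \<delta> n q"
      using N(2)[OF t(2)] by blast
    then show False
      using t(1) by (simp add: iff)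
  qed
  then show "negligible {t. x + t *\<^sub>R v \<in> - (\<Union>n. \<Union>q\<in>\<rat>. slope_stable U v \<delta> n q)}"
    using N(1) negligible_subset by blast
qed

text \<open>Let \<open>W\<close> be an open set around a compact piece \<open>K k\<close> with
  \<open>W - K k\<close> small. One short \<open>t\<close> moves all of \<open>K k\<close> into
  \<open>W\<close> in both directions, so a point without symmetric return lies in one of two
  translates of \<open>W - K k\<close>. Both signs have to share the same \<open>t\<close> because
  the pair enters one second difference.\<close>

lemma closed_symmetric_return_ae:
  fixes A :: "'a::euclidean_space set"
  assumes "closed A"
  shows "negligible {x \<in> A. \<exists>\<tau>>0. \<forall>t. 0 < t \<longrightarrow> t < \<tau> \<longrightarrow> \<not> (x + t *\<^sub>R v \<in> A \<and> x - t *\<^sub>R v \<in> A)}"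
proof -
  define K where "K = (\<lambda>k::nat. A \<inter> cball 0 (real k))"
  define E where "E = (\<lambda>k j. {x \<in> K k. \<forall>t. 0 < t \<longrightarrow> t < 1 / real (Suc j) \<longrightarrow> \<not> (x + t *\<^sub>R v \<in> A \<and> x - t *\<^sub>R v \<in> A)})"
  have "negligible (E k j)" for k j
    unfolding negligible_outer_le
  proof (intro allI impI)
    fix e :: real assume "e > 0"
    have cK: "compact (K k)"
      unfolding K_def using assms by (simp add: closed_Int_compact)
    obtain W where W: "open W" "K k \<subseteq> W" "W - K k \<in> lmeasurable" "emeasure lebesgue (W - K k) < ennreal (e / 2)"
      using sets_lebesgue_outer_open[of "K k" "e / 2"] cK \<open>e > 0\<close>
      by (metis half_gt_zero lmeasurable_compact fmeasurableD)
    have mW: "measure lebesgue (W - K k) < e / 2"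
      using W \<open>e > 0\<close> by (simp add: emeasure_eq_measure2 ennreal_less_iff)
    obtain r where r: "r > 0" "(\<Union>x\<in>K k. ball x r) \<subseteq> W"
      using compact_subset_open_imp_ball_epsilon_subset[OF cK W(1,2)] by blast
    \<comment> \<open>\<open>norm v + 1\<close> covers \<open>v = 0\<close> as well, and halving
      makes both inequalities strict.\<close>
    define t where "t = min (1 / real (Suc j)) (r / (norm v + 1)) / 2"
    have t: "0 < t" "t < 1 / real (Suc j)"
    proof -
      define a where "a = min (1 / real (Suc j)) (r / (norm v + 1))"
      have "0 < a" "a \<le> 1 / real (Suc j)"
        using r by (auto simp: a_def add_nonneg_pos)
      then show "0 < t" "t < 1 / real (Suc j)"
        unfolding t_def a_def[symmetric] by linarith+
    qed
    have "t < r / (norm v + 1)"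
      using t(1) unfolding t_def by linarith
    then have "t * (norm v + 1) < r"
      by (subst (asm) pos_less_divide_eq) (auto simp: add_nonneg_pos)
    then have tv: "t * norm v < r"
      using t by (simp add: distrib_left)
    let ?T = "(+) (- (t *\<^sub>R v)) ` (W - K k) \<union> (+) (t *\<^sub>R v) ` (W - K k)"
    have "E k j \<subseteq> ?T"
    proof
      fix x assume x: "x \<in> E k j"
      then have xK: "x \<in> K k" and "\<not> (x + t *\<^sub>R v \<in> K k \<and> x - t *\<^sub>R v \<in> K k)"
        using t by (auto simp: E_def K_def)
      moreover have "x + t *\<^sub>R v \<in> W" "x - t *\<^sub>R v \<in> W"
        using r xK tv t by (auto intro!: subsetD[OF r(2)] bexI[of _ x] simp: dist_norm)
      ultimately have "x + t *\<^sub>R v \<in> W - K k \<or> x - t *\<^sub>R v \<in> W - K k"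
        by blast
      then show "x \<in> ?T"
      proof
        assume "x + t *\<^sub>R v \<in> W - K k"
        then show ?thesis
          by (intro UnI1 image_eqI[of _ _ "x + t *\<^sub>R v"]) auto
      next
        assume "x - t *\<^sub>R v \<in> W - K k"
        then show ?thesis
          by (intro UnI2 image_eqI[of _ _ "x - t *\<^sub>R v"]) auto
      qed
    qed
    moreover have "?T \<in> lmeasurable"
      using W(3) by (intro fmeasurable.Un measurable_translation)
    moreover have "measure lebesgue ?T \<le> e"
    proof -
      have "measure lebesgue ?T \<le> measure lebesgue ((+) (- (t *\<^sub>R v)) ` (W - K k)) + measure lebesgue ((+) (t *\<^sub>R v) ` (W - K k))"
        using W(3) by (intro measure_Un_le fmeasurableD measurable_translation)
      then show ?thesis
        using mW by (simp only: measure_translation)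
    qed
    ultimately show "\<exists>T. E k j \<subseteq> T \<and> T \<in> lmeasurable \<and> measure lebesgue T \<le> e"
      by (intro exI[of _ ?T]) simp
  qed
  then have "negligible (\<Union>(range (\<lambda>(k, j). E k j)))"
    by (intro negligible_countable_Union) auto
  moreover have "{x \<in> A. \<exists>\<tau>>0. \<forall>t. 0 < t \<longrightarrow> t < \<tau> \<longrightarrow> \<not> (x + t *\<^sub>R v \<in> A \<and> x - t *\<^sub>R v \<in> A)} \<subseteq> (\<Union>(range (\<lambda>(k, j). E k j)))"
  proof
    fix x assume "x \<in> {x \<in> A. \<exists>\<tau>>0. \<forall>t. 0 < t \<longrightarrow> t < \<tau> \<longrightarrow> \<not> (x + t *\<^sub>R v \<in> A \<and> x - t *\<^sub>R v \<in> A)}"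
    then obtain \<tau> where x: "x \<in> A" "\<tau> > 0" "\<And>t. 0 < t \<Longrightarrow> t < \<tau> \<Longrightarrow> \<not> (x + t *\<^sub>R v \<in> A \<and> x - t *\<^sub>R v \<in> A)"
      by blast
    obtain j where j: "1 / real (Suc j) < \<tau>"
      using nat_approx_posE[OF x(2)] by blast
    obtain k :: nat where k: "norm x \<le> real k"
      using real_arch_simple by blast
    have "x \<in> E k j"
      using x(1) x(3) j k by (auto simp: E_def K_def)
    then show "x \<in> (\<Union>(range (\<lambda>(k, j). E k j)))"
      by (intro UN_I[of "(k, j)"]) auto
  qed
  ultimately show ?thesis
    using negligible_subset by blast
qed

section \<open>Rational directions and quadratic forms on them\<close>

definition rational_points :: "'a::euclidean_space set" where
  "rational_points = {v. \<forall>i\<in>Basis. v \<bullet> i \<in> \<rat>}"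

lemma countable_rational_points: "countable (rational_points :: 'a::euclidean_space set)"
proof -
  have rep: "v = (\<Sum>i\<in>Basis. restrict (\<lambda>i. v \<bullet> i) Basis i *\<^sub>R i)" for v :: 'a
    by (simp add: euclidean_representation)
  then have "(rational_points :: 'a set) \<subseteq> (\<lambda>r. \<Sum>i\<in>Basis. r i *\<^sub>R i) ` (Basis \<rightarrow>\<^sub>E \<rat>)"
  proof (intro subsetI)
    fix v :: 'a assume "v \<in> rational_points"
    then have "restrict (\<lambda>i. v \<bullet> i) Basis \<in> Basis \<rightarrow>\<^sub>E \<rat>"
      by (simp add: rational_points_def restrict_PiE_iff)
    then show "v \<in> (\<lambda>r. \<Sum>i\<in>Basis. r i *\<^sub>R i) ` (Basis \<rightarrow>\<^sub>E \<rat>)"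
      by (subst rep) (rule imageI)
  qed
  then show ?thesis
    by (rule countable_subset) (intro countable_image countable_PiE, auto simp: countable_rat)
qed

lemma rational_points_dense:
  fixes v :: "'a::euclidean_space"
  assumes "e > 0"
  shows "\<exists>w\<in>rational_points. dist v w < e"
proof -
  obtain a b where ab: "\<forall>i\<in>Basis. a \<bullet> i \<in> \<rat> \<and> b \<bullet> i \<in> \<rat>" "v \<in> box a b" "box a b \<subseteq> ball v e"
    using rational_boxes[OF assms, of v] by metis
  then have "(1/2) *\<^sub>R (a + b) \<in> box a b"
    by (auto simp: mem_box inner_simps field_simps)
  moreover have "(1/2) *\<^sub>R (a + b) \<in> rational_points"
    using ab(1) by (auto simp: rational_points_def inner_simps intro!: Rats_divide Rats_add)
  ultimately show ?thesis
    using ab(3) by (metis mem_ball subsetD)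
qed

lemma rational_points_add: "v \<in> rational_points \<Longrightarrow> w \<in> rational_points \<Longrightarrow> v + w \<in> rational_points"
  and rational_points_diff: "v \<in> rational_points \<Longrightarrow> w \<in> rational_points \<Longrightarrow> v - w \<in> rational_points"
  and rational_points_scale: "r \<in> \<rat> \<Longrightarrow> v \<in> rational_points \<Longrightarrow> r *\<^sub>R v \<in> rational_points"
  and rational_points_0: "0 \<in> rational_points"
  and rational_points_Basis: "i \<in> Basis \<Longrightarrow> i \<in> rational_points"
  by (auto simp: rational_points_def inner_simps inner_Basis)

lemma parallelogram_quadratic:
  fixes L :: "'a::euclidean_space \<Rightarrow> real"
  assumes par: "\<And>v w. v \<in> rational_points \<Longrightarrow> w \<in> rational_points \<Longrightarrow> L (v + w) + L (v - w) = 2 * L v + 2 * L w"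
  obtains B where "\<And>i j. B i j = B j i"
    "\<And>v. v \<in> rational_points \<Longrightarrow> L v = (\<Sum>i\<in>Basis. \<Sum>j\<in>Basis. (v \<bullet> i) * (v \<bullet> j) * B i j)"
proof -
  note cl [simp] = rational_points_add rational_points_diff rational_points_scale rational_points_0 rational_points_Basis
  define \<beta> where "\<beta> = (\<lambda>v w. L (v + w) - L (v - w))"
  have L0: "L 0 = 0"
    using par[of 0 0] by simp
  have even: "L (- w) = L w" if "w \<in> rational_points" for w
    using par[of 0 w] that L0 by simp
  have even': "L (w - v) = L (v - w)" if "v \<in> rational_points" "w \<in> rational_points" for v w
    using even[of "v - w"] that by simp
  have sym: "\<beta> v w = \<beta> w v" if "v \<in> rational_points" "w \<in> rational_points" for v w
    using even'[OF that] by (simp add: \<beta>_def add.commute)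
  have diag: "\<beta> v v = 4 * L v" if "v \<in> rational_points" for v
    using par[of v v] that L0 by (simp add: \<beta>_def)
  have \<beta>0: "\<beta> 0 w = 0" if "w \<in> rational_points" for w
    using even[OF that] by (simp add: \<beta>_def)
  \<comment> \<open>Two parallelogram laws are subtracted. With \<open>u = (a + b) / 2\<close> and
    \<open>v = (a - b) / 2\<close> the left-hand side is the sum of the values at \<open>a\<close>
    and \<open>b\<close>; taking \<open>v = u\<close> instead identifies the right-hand side as the
    value at \<open>a + b\<close>.\<close>
  have mid: "\<beta> (u + v) w + \<beta> (u - v) w = 2 * \<beta> u w"
    if u: "u \<in> rational_points" and v: "v \<in> rational_points" and w: "w \<in> rational_points" for u v w
  proof -
    have "L ((u + w) + v) + L ((u + w) - v) = 2 * L (u + w) + 2 * L v"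
      "L ((u - w) + v) + L ((u - w) - v) = 2 * L (u - w) + 2 * L v"
      using u v w by (auto intro!: par)
    moreover have eqs: "u + v + w = (u + w) + v" "u - v + w = (u + w) - v" "u + v - w = (u - w) + v" "u - v - w = (u - w) - v"
      by auto
    ultimately show ?thesis
      unfolding \<beta>_def eqs by simp
  qed
  have add: "\<beta> (a + b) w = \<beta> a w + \<beta> b w"
    if a: "a \<in> rational_points" and b: "b \<in> rational_points" and w: "w \<in> rational_points" for a b w
  proof -
    define u where "u = (1/2) *\<^sub>R (a + b)"
    define v where "v = (1/2) *\<^sub>R (a - b)"
    have uv: "u \<in> rational_points" "v \<in> rational_points"
      unfolding u_def v_def using a b by auto
    have "u + v = a" "u - v = b" "u + u = a + b"
      unfolding u_def v_def by (simp_all add: algebra_simps flip: scaleR_add_left)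
    then show ?thesis
      using mid[OF uv w] mid[OF uv(1) uv(1) w] \<beta>0[OF w] by simp
  qed
  have nat: "\<beta> (real n *\<^sub>R v) w = real n * \<beta> v w" if "v \<in> rational_points" "w \<in> rational_points" for n v w
  proof (induction n)
    case (Suc n)
    have "\<beta> (v + real n *\<^sub>R v) w = \<beta> v w + \<beta> (real n *\<^sub>R v) w"
      using that by (intro add) auto
    then show ?case
      using Suc by (simp add: algebra_simps)
  qed (use \<beta>0 that in auto)
  have minus: "\<beta> (- v) w = - \<beta> v w" if "v \<in> rational_points" "w \<in> rational_points" for v w
    using mid[OF cl(4) that] \<beta>0[OF that(2)] by simp
  have int: "\<beta> (real_of_int k *\<^sub>R v) w = real_of_int k * \<beta> v w" if "v \<in> rational_points" "w \<in> rational_points" for k v w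
  proof (cases k)
    case (nonneg n) then show ?thesis using nat[OF that, of n] by simp
  next
    case (neg n)
    have "real_of_int k *\<^sub>R v = - (real (Suc n) *\<^sub>R v)" "real_of_int k = - real (Suc n)"
      unfolding neg by (simp_all add: algebra_simps)
    moreover have "real (Suc n) *\<^sub>R v \<in> rational_points"
      by (rule cl(3)) (use that in auto)
    ultimately show ?thesis
      using nat[OF that, of "Suc n"] minus[of "real (Suc n) *\<^sub>R v" w] that by (simp only: mult_minus_left)
  qed
  have rat: "\<beta> (r *\<^sub>R v) w = r * \<beta> v w" if r: "r \<in> \<rat>" and v: "v \<in> rational_points" and w: "w \<in> rational_points" for r v w
  proof -
    obtain a b where ab: "b > 0" "r = real_of_int a / real_of_int b"
      using Rats_cases'[OF r] by metis
    have "real_of_int b * \<beta> (r *\<^sub>R v) w = \<beta> (real_of_int b *\<^sub>R (r *\<^sub>R v)) w"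
      using int[of "r *\<^sub>R v" w b] r v w by simp
    also have "\<dots> = real_of_int a * \<beta> v w"
      using ab int[OF v w, of a] by simp
    finally have "\<beta> (r *\<^sub>R v) w = real_of_int a * \<beta> v w / real_of_int b"
      using ab(1) by (simp add: eq_divide_eq mult.commute)
    then show ?thesis
      using ab(2) by simp
  qed
  have memb: "(\<Sum>i\<in>I. c i *\<^sub>R i) \<in> rational_points"
    if "finite I" "I \<subseteq> Basis" "\<And>i. i \<in> I \<Longrightarrow> c i \<in> \<rat>" for I and c :: "'a \<Rightarrow> real"
    using that by (induction I rule: finite_induct) auto
  have sum: "\<beta> (\<Sum>i\<in>I. c i *\<^sub>R i) w = (\<Sum>i\<in>I. c i * \<beta> i w)"
    if "finite I" "I \<subseteq> Basis" "\<And>i. i \<in> I \<Longrightarrow> c i \<in> \<rat>" "w \<in> rational_points" for I c w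
    using that
  proof (induction I rule: finite_induct)
    case (insert i I)
    have "(\<Sum>i\<in>I. c i *\<^sub>R i) \<in> rational_points"
      using insert.prems by (intro memb insert.hyps) auto
    then show ?case
      using insert by (subst sum.insert, simp, simp, subst add) (auto simp: rat subset_iff)
  qed (simp add: \<beta>0)
  show thesis
  \<comment> \<open>The guard makes \<open>B\<close> symmetric for all arguments, as
    \<open>\<beta>\<close> is known to be symmetric on rational points only. The 4 stems from
    \<open>\<beta> v v = 4 * L v\<close>.\<close>
  proof (rule that[of "\<lambda>i j. if i \<in> Basis \<and> j \<in> Basis then \<beta> i j / 4 else 0"])
    fix v :: 'a assume v: "v \<in> rational_points"
    then have c: "v \<bullet> i \<in> \<rat>" if "i \<in> Basis" for i
      using that by (simp add: rational_points_def)
    have rep: "v = (\<Sum>i\<in>Basis. (v \<bullet> i) *\<^sub>R i)"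
      by (simp add: euclidean_representation)
    have "4 * L v = \<beta> (\<Sum>i\<in>Basis. (v \<bullet> i) *\<^sub>R i) v"
      using diag[OF v] rep by simp
    also have "\<dots> = (\<Sum>i\<in>Basis. (v \<bullet> i) * \<beta> v i)"
      using sum[of Basis "\<lambda>i. v \<bullet> i" v] c v by (simp add: sym)
    also have "\<dots> = (\<Sum>i\<in>Basis. (v \<bullet> i) * (\<Sum>j\<in>Basis. (v \<bullet> j) * \<beta> i j))"
    proof (rule sum.cong[OF refl])
      fix i :: 'a assume i: "i \<in> Basis"
      have "\<beta> v i = \<beta> (\<Sum>j\<in>Basis. (v \<bullet> j) *\<^sub>R j) i"
        using rep by simp
      also have "\<dots> = (\<Sum>j\<in>Basis. (v \<bullet> j) * \<beta> j i)"
        using c i by (intro sum) auto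
      finally show "(v \<bullet> i) * \<beta> v i = (v \<bullet> i) * (\<Sum>j\<in>Basis. (v \<bullet> j) * \<beta> i j)"
        using i by (simp add: sym)
    qed
    finally show "L v = (\<Sum>i\<in>Basis. \<Sum>j\<in>Basis. (v \<bullet> i) * (v \<bullet> j) * (if i \<in> Basis \<and> j \<in> Basis then \<beta> i j / 4 else 0))"
      by (simp add: sum_distrib_left mult.assoc flip: sum_divide_distrib)
  qed (auto simp: sym)
qed

lemma limit_at_0_if_approx:
  fixes F :: "real \<Rightarrow> real"
  assumes approx: "\<And>\<delta>. \<delta> > 0 \<Longrightarrow> \<exists>q. \<exists>\<tau>>0. \<forall>t. t \<noteq> 0 \<longrightarrow> \<bar>t\<bar> < \<tau> \<longrightarrow> \<bar>F t - q\<bar> \<le> \<delta>"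
  shows "\<exists>L. (F \<longlongrightarrow> L) (at 0)"
proof -
  define X where "X = (\<lambda>n. F (1 / real (Suc n)))"
  have small: "\<forall>\<^sub>F n in sequentially. 1 / real (Suc n) < \<tau>" if "\<tau> > 0" for \<tau> :: real
    using order_tendstoD(2)[OF LIMSEQ_inverse_real_of_nat that] by (simp add: inverse_eq_divide)
  have "Cauchy X"
    unfolding Cauchy_altdef2
  proof (intro allI impI)
    fix e :: real assume "e > 0"
    then obtain q \<tau> where q: "\<tau> > 0" "\<And>t. t \<noteq> 0 \<Longrightarrow> \<bar>t\<bar> < \<tau> \<Longrightarrow> \<bar>F t - q\<bar> \<le> e / 3"
      using approx[of "e / 3"] by auto
    obtain N where N: "\<And>n. n \<ge> N \<Longrightarrow> 1 / real (Suc n) < \<tau>"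
      using small[OF q(1)] unfolding eventually_sequentially by blast
    have Xq: "\<bar>X n - q\<bar> \<le> e / 3" if "n \<ge> N" for n
      unfolding X_def using N[OF that] by (intro q(2)) auto
    then have "dist (X n) (X N) < e" if "n \<ge> N" for n
      using Xq[OF that] Xq[of N] \<open>e > 0\<close> unfolding dist_real_def by linarith
    then show "\<exists>N. \<forall>n\<ge>N. dist (X n) (X N) < e"
      by blast
  qed
  then obtain L where L: "X \<longlonglongrightarrow> L"
    using Cauchy_convergent convergent_def by blast
  have "(F \<longlongrightarrow> L) (at 0)"
  proof (rule tendstoI)
    fix e :: real assume "e > 0"
    then obtain q \<tau> where q: "\<tau> > 0" "\<And>t. t \<noteq> 0 \<Longrightarrow> \<bar>t\<bar> < \<tau> \<Longrightarrow> \<bar>F t - q\<bar> \<le> e / 3"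
      using approx[of "e / 3"] by auto
    have "\<forall>\<^sub>F n in sequentially. \<bar>X n - q\<bar> \<le> e / 3"
      using small[OF q(1)] by eventually_elim (unfold X_def, rule q(2), simp_all)
    then have Lq: "\<bar>L - q\<bar> \<le> e / 3"
      by (intro tendsto_upperbound[of "\<lambda>n. \<bar>X n - q\<bar>"]) (auto intro!: tendsto_intros L)
    show "\<forall>\<^sub>F t in at 0. dist (F t) L < e"
      unfolding eventually_at
    proof (intro exI[of _ \<tau>] conjI ballI impI)
      fix t :: real assume "t \<noteq> 0 \<and> dist t 0 < \<tau>"
      then have "\<bar>F t - q\<bar> \<le> e / 3"
        by (intro q(2)) auto
      then show "dist (F t) L < e"
        using Lq \<open>e > 0\<close> unfolding dist_real_def by linarith
    qed (use q in auto)
  qed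
  then show ?thesis ..
qed

text \<open>The subgradient is a prescribed selection \<open>G\<close>, so that the expansions found
  almost everywhere have precisely \<open>G x\<close> as gradient. For a sup-convolution this ties
  the expansion at \<open>x\<close> to the point where the supremum is attained.\<close>

locale subgradient =
  fixes U :: "'a::euclidean_space \<Rightarrow> real" and G :: "'a \<Rightarrow> 'a"
  assumes sub: "\<And>x y. U x + G x \<bullet> (y - x) \<le> U y"
begin

lemma convex: "convex_on UNIV U"
proof (rule convex_onI)
  fix t :: real and x y :: 'a assume t: "0 < t" "t < 1"
  define z where "z = (1 - t) *\<^sub>R x + t *\<^sub>R y"
  have "(1 - t) * (U z + G z \<bullet> (x - z)) + t * (U z + G z \<bullet> (y - z)) \<le> (1 - t) * U x + t * U y"
    using t by (intro add_mono mult_left_mono sub) auto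
  moreover have "(1 - t) * (G z \<bullet> (x - z)) + t * (G z \<bullet> (y - z)) = G z \<bullet> ((1 - t) *\<^sub>R (x - z) + t *\<^sub>R (y - z))"
    by (simp add: inner_add_right)
  moreover have "(1 - t) *\<^sub>R (x - z) + t *\<^sub>R (y - z) = 0"
    by (simp add: z_def algebra_simps)
  ultimately have "(1 - t) * U z + t * U z \<le> (1 - t) * U x + t * U y"
    by (simp add: distrib_left)
  then show "U ((1 - t) *\<^sub>R x + t *\<^sub>R y) \<le> (1 - t) * U x + t * U y"
    by (simp add: z_def[symmetric] left_diff_distrib)
qed simp

lemma continuous: "continuous_on UNIV U"
  using convex_on_continuous[OF _ convex] by simp

definition remainder :: "'a \<Rightarrow> 'a \<Rightarrow> real \<Rightarrow> real" where
  "remainder x v t = (U (x + t *\<^sub>R v) - U x - t * (G x \<bullet> v)) / t\<^sup>2"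

lemma remainder_nonneg: "remainder x v t \<ge> 0"
  using sub[of x "x + t *\<^sub>R v"] by (simp add: remainder_def)

text \<open>A subgradient lies between the backward and the forward slope, and stability lets these
  differ by at most a multiple of \<open>s\<close>. Letting \<open>s\<close> tend to 0 in the
  stability inequality thus replaces the slope over \<open>s\<close> by
  \<open>G x \<bullet> v\<close>.\<close>

lemma remainder_stable:
  assumes x: "x \<in> slope_stable U v \<delta> n q" and t: "t \<noteq> 0" "\<bar>t\<bar> < 1 / real (Suc n)" and "\<delta> > 0"
  shows "\<bar>remainder x v t - q\<bar> \<le> \<delta>"
proof -
  let ?S = "slope U v x" and ?p = "G x \<bullet> v"
  define C where "C = 2 * (\<bar>q\<bar> + \<delta>)"
  have st: "\<bar>?S t - ?S s - q * (t - s)\<bar> \<le> \<delta> * (\<bar>s\<bar> + \<bar>t\<bar>)"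
    if "s \<noteq> 0" "t \<noteq> 0" "\<bar>s\<bar> < 1 / real (Suc n)" "\<bar>t\<bar> < 1 / real (Suc n)" for s t
    using x that by (auto simp: slope_stable_def)
  have near: "\<bar>?S s - ?p\<bar> \<le> C * s" if s: "0 < s" "s < 1 / real (Suc n)" for s
  proof -
    have "?p \<le> ?S s"
      using sub[of x "x + s *\<^sub>R v"] s by (simp add: slope_def field_simps)
    moreover have "?S (- s) \<le> ?p"
      using sub[of x "x + (- s) *\<^sub>R v"] s by (simp add: slope_def field_simps)
    moreover have "\<bar>?S s - ?S (- s) - 2 * (q * s)\<bar> \<le> 2 * (\<delta> * s)"
      using st[of "- s" s] s by (simp add: algebra_simps)
    moreover have "q * s \<le> \<bar>q\<bar> * s"
      using s by (intro mult_right_mono) auto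
    ultimately show ?thesis
      unfolding C_def mult.assoc distrib_right distrib_left by linarith
  qed
  have "\<bar>?S t - ?p - q * t\<bar> \<le> \<delta> * \<bar>t\<bar> + e" if "e > 0" for e
  proof -
    \<comment> \<open>\<open>K\<close> collects the three errors that vanish with \<open>s\<close>:
      the tolerance, the term \<open>q * s\<close> and the distance between the slope over
      \<open>s\<close> and the subgradient.\<close>
    define K where "K = \<delta> + \<bar>q\<bar> + C"
    have K: "K > 0" using \<open>\<delta> > 0\<close> by (auto simp: K_def C_def)
    define s where "s = min (e / K) (1 / real (Suc n) / 2)"
    have s: "0 < s" "s \<le> e / K"
      using that K by (auto simp: s_def)
    have s': "s < 1 / real (Suc n)"
    proof -
      have "1 / real (Suc n) / 2 < 1 / real (Suc n)"
        by (simp add: field_simps)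
      then show ?thesis unfolding s_def by linarith
    qed
    have "K * s \<le> e"
      using s K by (simp add: field_simps)
    then have "\<delta> * s + \<bar>q\<bar> * s + C * s \<le> e"
      by (simp add: K_def distrib_right)
    moreover have "\<bar>q * s\<bar> = \<bar>q\<bar> * s"
      using s by (simp add: abs_mult)
    moreover have "\<bar>?S t - ?S s - q * (t - s)\<bar> \<le> \<delta> * \<bar>t\<bar> + \<delta> * s"
      using st[of s t] s s' t by (simp add: distrib_left)
    moreover have "q * (t - s) = q * t - q * s"
      by (simp add: right_diff_distrib)
    ultimately show ?thesis
      using near[OF s(1) s'] by linarith
  qed
  then have "\<bar>?S t - ?p - q * t\<bar> \<le> \<delta> * \<bar>t\<bar>"
    by (rule field_le_epsilon)
  then have "\<bar>?S t - ?p - q * t\<bar> / \<bar>t\<bar> \<le> \<delta>"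
    using t by (simp add: field_simps)
  moreover have "(?S t - ?p - q * t) / t = remainder x v t - q"
    using t by (simp add: slope_def remainder_def field_simps power2_eq_square)
  ultimately show ?thesis
    by (simp flip: abs_divide)
qed

definition second_difference :: "'a \<Rightarrow> 'a \<Rightarrow> real \<Rightarrow> real" where
  "second_difference x v t = (U (x + t *\<^sub>R v) + U (x - t *\<^sub>R v) - 2 * U x) / t\<^sup>2"

lemma second_difference_remainder:
  "t \<noteq> 0 \<Longrightarrow> second_difference x v t = remainder x v t + remainder x v (- t)"
  by (simp add: second_difference_def remainder_def field_simps)

text \<open>
  The right-hand side is small as soon as \<open>x\<close> and \<open>x \<plusminus> tv\<close> lie in a set on which the second
  differences in direction \<open>w\<close> are nearly constant.
\<close>

lemma second_difference_parallelogram: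
  "second_difference x (v + w) t + second_difference x (v - w) t
     - 2 * second_difference x v t - 2 * second_difference x w t
   = second_difference (x + t *\<^sub>R v) w t + second_difference (x - t *\<^sub>R v) w t - 2 * second_difference x w t"
proof -
  have e: "x + t *\<^sub>R (v + w) = x + t *\<^sub>R v + t *\<^sub>R w" "x - t *\<^sub>R (v + w) = x - t *\<^sub>R v - t *\<^sub>R w"
    "x + t *\<^sub>R (v - w) = x + t *\<^sub>R v - t *\<^sub>R w" "x - t *\<^sub>R (v - w) = x - t *\<^sub>R v + t *\<^sub>R w"
    by (auto simp: algebra_simps)
  show ?thesis
    unfolding second_difference_def e add_divide_distrib diff_divide_distrib by simp
qed

lemma second_difference_stable:
  assumes "x \<in> slope_stable U v \<delta> n q" "t \<noteq> 0" "\<bar>t\<bar> < 1 / real (Suc n)" "\<delta> > 0"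
  shows "\<bar>second_difference x v t - 2 * q\<bar> \<le> 2 * \<delta>"
  using remainder_stable[OF assms] remainder_stable[OF assms(1), of "- t"] assms
  by (simp add: second_difference_remainder)

end

lemma slope_stable_mono: "\<delta> \<le> \<delta>' \<Longrightarrow> slope_stable U v \<delta> n q \<subseteq> slope_stable U v \<delta>' n q"
  unfolding slope_stable_def by (auto intro!: order_trans[OF _ mult_right_mono[of \<delta> \<delta>']])

text \<open>The segment from \<open>w\<close> through \<open>v\<close> is prolonged to length 1. Its
  end \<open>z\<close> stays in the ball of radius 3, which is why the bounds are assumed there
  while the points have norm at most 2. The lower bound 0 allows the factor \<open>1 - s\<close> to
  be dropped.\<close>

lemma convex_bounded_lipschitz:
  fixes F :: "'a::real_normed_vector \<Rightarrow> real"
  assumes conv: "convex_on UNIV F" and bound: "\<And>z. norm z \<le> 3 \<Longrightarrow> 0 \<le> F z \<and> F z \<le> C"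
    and "norm v \<le> 2" "norm w \<le> 2" "norm (v - w) \<le> 1"
  shows "\<bar>F v - F w\<bar> \<le> C * norm (v - w)"
proof -
  have le: "F v \<le> F w + C * norm (v - w)" if "norm v \<le> 2" "norm w \<le> 2" "norm (v - w) \<le> 1" for v w
  proof (cases "v = w")
    case False
    define s where "s = norm (v - w)"
    have s: "0 < s" "s \<le> 1" using False that by (auto simp: s_def)
    define z where "z = w + (1 / s) *\<^sub>R (v - w)"
    have "norm ((1 / s) *\<^sub>R (v - w)) = 1"
      using s by (simp add: s_def)
    then have "norm z \<le> 3"
      unfolding z_def using that norm_triangle_ineq[of w "(1 / s) *\<^sub>R (v - w)"] by linarith
    have "v = (1 - s) *\<^sub>R w + s *\<^sub>R z"
      using s by (simp add: z_def algebra_simps)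
    then have "F v \<le> (1 - s) * F w + s * F z"
      using convex_onD[OF conv, of s w z] s by simp
    also have "\<dots> \<le> 1 * F w + s * C"
      using s bound[OF \<open>norm z \<le> 3\<close>] bound[of w] that by (intro add_mono mult_right_mono mult_left_mono) auto
    finally show ?thesis
      by (simp add: s_def mult.commute)
  qed simp
  show ?thesis
    using le[of v w] le[of w v] assms by (simp add: norm_minus_commute)
qed

text \<open>A Taylor expansion at the single point \<open>x\<close>, as in Alexandrov's theorem;
  \<open>F\<close> need not be differentiable at neighbouring points.\<close>

definition second_order :: "('a::real_inner \<Rightarrow> real) \<Rightarrow> 'a \<Rightarrow> 'a \<Rightarrow> ('a \<Rightarrow> 'a) \<Rightarrow> bool" where
  "second_order F x p A \<longleftrightarrow> linear A \<and> (\<forall>v w. v \<bullet> A w = A v \<bullet> w) \<and>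
     (\<forall>e>0. \<exists>\<tau>>0. \<forall>h. norm h < \<tau> \<longrightarrow>
        \<bar>F (x + h) - F x - p \<bullet> h - h \<bullet> A h / 2\<bar> \<le> e * (norm h)\<^sup>2)"

lemma second_orderD:
  assumes "second_order F x p A"
  shows "linear A" "\<And>v w. v \<bullet> A w = A v \<bullet> w"
    and "\<And>e. e > 0 \<Longrightarrow> \<exists>\<tau>>0. \<forall>h. norm h < \<tau> \<longrightarrow>
        \<bar>F (x + h) - F x - p \<bullet> h - h \<bullet> A h / 2\<bar> \<le> e * (norm h)\<^sup>2"
  using assms unfolding second_order_def by blast+

section \<open>Alexandrov's theorem for a subgradient selection\<close>

context subgradient begin

text \<open>The exceptional sets are indexed by rational directions, tolerances
  \<open>1 / Suc j\<close>, scales \<open>n\<close> and rational \<open>q\<close>, so their union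
  stays negligible. Other tolerances follow from the monotonicity of
  \<open>slope_stable\<close>.\<close>

lemma stable_ae:
  "\<exists>N. negligible N \<and> (\<forall>x. x \<notin> N \<longrightarrow> (\<forall>v\<in>rational_points. \<forall>\<delta>>0. \<exists>n q. x \<in> slope_stable U v \<delta> n q) \<and>
     (\<forall>v\<in>rational_points. \<forall>w\<in>rational_points. \<forall>\<delta>>0. \<exists>n q. x \<in> slope_stable U w \<delta> n q \<and>
        (\<forall>\<tau>>0. \<exists>t. 0 < t \<and> t < \<tau> \<and> x + t *\<^sub>R v \<in> slope_stable U w \<delta> n q \<and> x - t *\<^sub>R v \<in> slope_stable U w \<delta> n q)))"
proof -
  let ?R = "rational_points :: 'a set"
  let ?J = "\<lambda>j::nat. 1 / real (Suc j)"
  define N1 where "N1 = (\<lambda>(v, j). - (\<Union>n. \<Union>q\<in>\<rat>. slope_stable U v (?J j) n q))"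
  define ex where "ex = (\<lambda>(A :: 'a set) v. {x \<in> A. \<exists>\<tau>>0. \<forall>t. 0 < t \<longrightarrow> t < \<tau> \<longrightarrow> \<not> (x + t *\<^sub>R v \<in> A \<and> x - t *\<^sub>R v \<in> A)})"
  define N2 where "N2 = (\<lambda>(v, w, j, n, q). ex (slope_stable U w (?J j) n q) v)"
  define N where "N = (\<Union>i\<in>?R \<times> UNIV. N1 i) \<union> (\<Union>i\<in>?R \<times> ?R \<times> UNIV \<times> UNIV \<times> \<rat>. N2 i)"
  have "negligible (N1 i)" for i
    unfolding N1_def by (cases i) (simp only: case_prod_conv, rule slope_stable_ae[OF convex], simp)
  then have "negligible (\<Union>i\<in>?R \<times> UNIV. N1 i)"
    by (intro negligible_countable_Union countable_image countable_SIGMA countable_rational_points) auto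
  moreover have "negligible (N2 i)" for i
    unfolding N2_def ex_def
    by (cases i) (simp only: case_prod_conv, rule closed_symmetric_return_ae[OF closed_slope_stable[OF continuous]])
  then have "negligible (\<Union>i\<in>?R \<times> ?R \<times> UNIV \<times> UNIV \<times> \<rat>. N2 i)"
    by (intro negligible_countable_Union countable_image countable_SIGMA countable_rational_points countable_rat) auto
  ultimately have "negligible N"
    unfolding N_def by (rule negligible_Un)
  moreover have st: "\<exists>n. \<exists>q\<in>\<rat>. x \<in> slope_stable U v (?J j) n q" if "x \<notin> N" "v \<in> ?R" for x v j
  proof -
    have "x \<notin> N1 (v, j)"
      using that unfolding N_def by blast
    then show ?thesis
      unfolding N1_def by simp
  qed
  moreover have "\<exists>n q. x \<in> slope_stable U v \<delta> n q" if "x \<notin> N" "v \<in> ?R" "\<delta> > 0" for x v \<delta>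
  proof -
    obtain j where "?J j < \<delta>"
      using nat_approx_posE[OF \<open>\<delta> > 0\<close>] by blast
    then show ?thesis
      using st[OF that(1,2), of j] slope_stable_mono[of "?J j" \<delta> U v] by (meson less_imp_le subsetD)
  qed
  moreover have "\<exists>n q. x \<in> slope_stable U w \<delta> n q \<and>
        (\<forall>\<tau>>0. \<exists>t. 0 < t \<and> t < \<tau> \<and> x + t *\<^sub>R v \<in> slope_stable U w \<delta> n q \<and> x - t *\<^sub>R v \<in> slope_stable U w \<delta> n q)"
    if x: "x \<notin> N" and v: "v \<in> ?R" and w: "w \<in> ?R" and "\<delta> > 0" for x v w \<delta>
  proof -
    obtain j where j: "?J j < \<delta>"
      using nat_approx_posE[OF \<open>\<delta> > 0\<close>] by blast
    obtain n q where nq: "q \<in> \<rat>" "x \<in> slope_stable U w (?J j) n q"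
      using st[OF x w, of j] by blast
    have sub: "slope_stable U w (?J j) n q \<subseteq> slope_stable U w \<delta> n q"
      using j by (intro slope_stable_mono) simp
    have "x \<notin> N2 (v, w, j, n, q)"
    proof
      assume "x \<in> N2 (v, w, j, n, q)"
      then have "x \<in> (\<Union>i\<in>?R \<times> ?R \<times> UNIV \<times> UNIV \<times> \<rat>. N2 i)"
        by (rule UN_I[rotated]) (use v w nq in simp)
      then show False
        using x unfolding N_def by (rule notE[OF _ UnI2, rotated])
    qed
    then have "x \<notin> ex (slope_stable U w (?J j) n q) v"
      by (simp add: N2_def)
    then have "\<forall>\<tau>>0. \<exists>t. 0 < t \<and> t < \<tau> \<and> x + t *\<^sub>R v \<in> slope_stable U w (?J j) n q \<and> x - t *\<^sub>R v \<in> slope_stable U w (?J j) n q"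
      using nq(2) unfolding ex_def by blast
    then show ?thesis
      using sub nq(2) by (intro exI[of _ n] exI[of _ q]) (meson subsetD)
  qed
  ultimately show ?thesis
    by (intro exI[of _ N]) blast
qed

lemma convex_remainder: "convex_on UNIV (\<lambda>v. remainder x v t)"
proof (rule convex_onI)
  fix s :: real and a b :: 'a assume s: "0 < s" "s < 1"
  have e: "x + t *\<^sub>R ((1 - s) *\<^sub>R a + s *\<^sub>R b) = (1 - s) *\<^sub>R (x + t *\<^sub>R a) + s *\<^sub>R (x + t *\<^sub>R b)"
    by (simp add: algebra_simps)
  have "U (x + t *\<^sub>R ((1 - s) *\<^sub>R a + s *\<^sub>R b)) - U x - t * (G x \<bullet> ((1 - s) *\<^sub>R a + s *\<^sub>R b))
      \<le> (1 - s) * (U (x + t *\<^sub>R a) - U x - t * (G x \<bullet> a)) + s * (U (x + t *\<^sub>R b) - U x - t * (G x \<bullet> b))"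
    unfolding e using convex_onD[OF convex, of s "x + t *\<^sub>R a" "x + t *\<^sub>R b"] s
    by (simp add: inner_add_right algebra_simps)
  then show "remainder x ((1 - s) *\<^sub>R a + s *\<^sub>R b) t \<le> (1 - s) * remainder x a t + s * remainder x b t"
    unfolding remainder_def times_divide_eq_right add_divide_distrib[symmetric] by (rule divide_right_mono) simp
qed simp

text \<open>\<open>v\<close> is the average of its coordinate vectors stretched by the dimension,
  and each of these lies between \<open>- c *\<^sub>R i\<close> and \<open>c *\<^sub>R i\<close>
  because the coordinates of \<open>v\<close> are at most 3. Convexity and nonnegativity then give a
  bound by finitely many fixed rational vectors, along which the remainders converge.\<close>

lemma remainder_bound:
  assumes "norm v \<le> 3"
  defines "c \<equiv> 3 * real DIM('a)"
  shows "remainder x v t \<le> (\<Sum>i\<in>Basis. remainder x (c *\<^sub>R i) t + remainder x (- c *\<^sub>R i) t)"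
proof -
  let ?d = "real DIM('a)"
  have c: "c > 0" by (simp add: c_def)
  have coord: "remainder x (s *\<^sub>R i) t \<le> remainder x (c *\<^sub>R i) t + remainder x (- c *\<^sub>R i) t" if "\<bar>s\<bar> \<le> c" for s i
  proof -
    define \<theta> where "\<theta> = (c + s) / (2 * c)"
    have \<theta>: "0 \<le> \<theta>" "\<theta> \<le> 1"
      using that c by (auto simp: \<theta>_def field_simps)
    have "\<theta> * c - (1 - \<theta>) * c = s"
      using c by (simp add: \<theta>_def field_simps)
    then have "s *\<^sub>R i = (1 - \<theta>) *\<^sub>R (- c *\<^sub>R i) + \<theta> *\<^sub>R (c *\<^sub>R i)"
      by (metis (no_types, lifting) add.commute diff_conv_add_uminus mult_minus_right scaleR_add_left scaleR_scaleR)
    then have "remainder x (s *\<^sub>R i) t \<le> (1 - \<theta>) * remainder x (- c *\<^sub>R i) t + \<theta> * remainder x (c *\<^sub>R i) t"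
      using convex_onD[OF convex_remainder \<theta>, of "- c *\<^sub>R i" "c *\<^sub>R i" x t] by simp
    also have "\<dots> \<le> 1 * remainder x (- c *\<^sub>R i) t + 1 * remainder x (c *\<^sub>R i) t"
      using \<theta> by (intro add_mono mult_right_mono remainder_nonneg) auto
    finally show ?thesis by simp
  qed
  have "v = (\<Sum>i\<in>Basis. (1 / ?d) *\<^sub>R ((?d * (v \<bullet> i)) *\<^sub>R i))"
    by (simp add: euclidean_representation)
  then have "remainder x v t = remainder x (\<Sum>i\<in>Basis. (1 / ?d) *\<^sub>R ((?d * (v \<bullet> i)) *\<^sub>R i)) t"
    by simp
  also have "\<dots> \<le> (\<Sum>i\<in>Basis. (1 / ?d) * remainder x ((?d * (v \<bullet> i)) *\<^sub>R i) t)"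
    by (rule convex_on_sum[OF _ _ convex_remainder]) auto
  also have "\<dots> \<le> (\<Sum>i\<in>Basis. 1 * remainder x ((?d * (v \<bullet> i)) *\<^sub>R i) t)"
    by (intro sum_mono mult_right_mono remainder_nonneg) (auto simp: Suc_le_eq)
  also have "\<dots> \<le> (\<Sum>i\<in>Basis. remainder x (c *\<^sub>R i) t + remainder x (- c *\<^sub>R i) t)"
  proof (rule sum_mono)
    fix i :: 'a assume i: "i \<in> Basis"
    have "\<bar>v \<bullet> i\<bar> \<le> 3"
      using Basis_le_norm[OF i, of v] assms(1) by simp
    then have "\<bar>?d * (v \<bullet> i)\<bar> \<le> c"
      by (simp add: abs_mult c_def)
    then show "1 * remainder x ((?d * (v \<bullet> i)) *\<^sub>R i) t \<le> remainder x (c *\<^sub>R i) t + remainder x (- c *\<^sub>R i) t"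
      using coord by simp
  qed
  finally show ?thesis .
qed

text \<open>The remainders are convex in the direction and, for small \<open>t\<close>, bounded on
  the ball of radius 3, hence equally Lipschitz near the sphere. Convergence on a finite rational
  net of the sphere therefore suffices.\<close>

lemma remainder_uniform:
  assumes lim: "\<And>v. v \<in> rational_points \<Longrightarrow> (remainder x v \<longlongrightarrow> Q v) (at 0)"
    and Q: "continuous_on UNIV Q" and "e > 0"
  shows "\<forall>\<^sub>F t in at 0. \<forall>v. norm v = 1 \<longrightarrow> \<bar>remainder x v t - Q v\<bar> \<le> e"
proof -
  define c where "c = 3 * real DIM('a)"
  define S where "S = (\<lambda>t. \<Sum>i\<in>Basis. remainder x (c *\<^sub>R i) t + remainder x (- c *\<^sub>R i) t)"
  have "c \<in> \<rat>" "- c \<in> \<rat>"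
    by (auto simp: c_def)
  then have "(S \<longlongrightarrow> (\<Sum>i\<in>Basis. Q (c *\<^sub>R i) + Q (- c *\<^sub>R i))) (at 0)"
    unfolding S_def by (intro tendsto_intros lim rational_points_scale rational_points_Basis) auto
  define C where "C = \<bar>\<Sum>i\<in>Basis. Q (c *\<^sub>R i) + Q (- c *\<^sub>R i)\<bar> + 1"
  have "C > 0" by (simp add: C_def)
  have evC: "\<forall>\<^sub>F t in at 0. S t < C"
    by (rule order_tendstoD(2)[OF \<open>(S \<longlongrightarrow> _) (at 0)\<close>]) (simp add: C_def)
  have "uniformly_continuous_on (cball 0 2) Q"
    by (rule compact_uniformly_continuous) (auto intro: continuous_on_subset[OF Q])
  then obtain d where d: "d > 0" "\<And>v w. norm v \<le> 2 \<Longrightarrow> norm w \<le> 2 \<Longrightarrow> dist w v < d \<Longrightarrow> dist (Q w) (Q v) < e / 3"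
    unfolding uniformly_continuous_on_def using \<open>e > 0\<close> by (metis mem_cball_0 divide_pos_pos zero_less_numeral)
  \<comment> \<open>\<open>r \<le> d\<close> controls \<open>Q\<close>,
    \<open>r \<le> e / (3 * C)\<close> controls the remainders, and \<open>r \<le> 1\<close> keeps
    the relevant part of the net in the ball of radius 2.\<close>
  define r where "r = min (min d 1) (e / (3 * C))"
  have r: "r > 0" "r \<le> d" "r \<le> 1" "r \<le> e / (3 * C)"
    using d \<open>e > 0\<close> \<open>C > 0\<close> by (auto simp: r_def)
  then have rC: "C * r \<le> e / 3"
    using \<open>C > 0\<close> by (simp add: field_simps)
  have "sphere (0::'a) 1 \<subseteq> (\<Union>w\<in>rational_points. ball w r)"
    using rational_points_dense[OF r(1)] by (auto simp: dist_commute)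
  then obtain W where W: "W \<subseteq> rational_points" "finite W" "sphere (0::'a) 1 \<subseteq> (\<Union>w\<in>W. ball w r)"
    using compactE_image[OF compact_sphere, of rational_points "\<lambda>w. ball w r" 0 1] by (metis open_ball)
  have "\<forall>\<^sub>F t in at 0. dist (remainder x w t) (Q w) < e / 3" if "w \<in> W" for w
    using lim that W(1) \<open>e > 0\<close> by (intro tendstoD) auto
  then have "\<forall>\<^sub>F t in at 0. \<forall>w\<in>W. dist (remainder x w t) (Q w) < e / 3"
    using W(2) by (simp add: eventually_ball_finite)
  with evC show ?thesis
  proof eventually_elim
    case (elim t)
    show ?case
    proof (intro allI impI)
      fix v :: 'a assume v: "norm v = 1"
      have "v \<in> (\<Union>w\<in>W. ball w r)"
        by (rule subsetD[OF W(3)]) (simp add: v)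
      then obtain w where w: "w \<in> W" "dist w v < r"
        by auto
      then have "norm (w - v) < r" by (simp add: dist_norm)
      then have nw: "norm w \<le> 2" "norm (v - w) \<le> 1" "norm (v - w) \<le> r"
        using v r norm_triangle_sub[of w v] by (auto simp: norm_minus_commute)
      have "0 \<le> remainder x z t \<and> remainder x z t \<le> C" if "norm z \<le> 3" for z
        using remainder_bound[OF that, of x t] remainder_nonneg elim(1) by (auto simp: S_def c_def)
      then have "\<bar>remainder x v t - remainder x w t\<bar> \<le> C * norm (v - w)"
        using v nw by (intro convex_bounded_lipschitz[OF convex_remainder]) auto
      also have "\<dots> \<le> e / 3"
        using rC nw(3) \<open>C > 0\<close> mult_left_mono[OF nw(3), of C] by linarith
      finally have "\<bar>remainder x v t - remainder x w t\<bar> \<le> e / 3" .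
      moreover have "dist (Q w) (Q v) < e / 3"
        using d(2)[of v w] v nw w r by simp
      moreover have "dist (remainder x w t) (Q w) < e / 3"
        using elim(2) w by blast
      ultimately show "\<bar>remainder x v t - Q v\<bar> \<le> e"
        unfolding dist_real_def by linarith
    qed
  qed
qed

theorem second_order_ae: "\<exists>N. negligible N \<and> (\<forall>x. x \<notin> N \<longrightarrow> (\<exists>A. second_order U x (G x) A))"
proof -
  let ?R = "rational_points :: 'a set"
  obtain N where N: "negligible N"
    and st: "\<And>x v \<delta>. x \<notin> N \<Longrightarrow> v \<in> ?R \<Longrightarrow> \<delta> > 0 \<Longrightarrow> \<exists>n q. x \<in> slope_stable U v \<delta> n q"
    and ret: "\<And>x v w \<delta>. x \<notin> N \<Longrightarrow> v \<in> ?R \<Longrightarrow> w \<in> ?R \<Longrightarrow> \<delta> > 0 \<Longrightarrow> \<exists>n q. x \<in> slope_stable U w \<delta> n q \<and>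
        (\<forall>\<tau>>0. \<exists>t. 0 < t \<and> t < \<tau> \<and> x + t *\<^sub>R v \<in> slope_stable U w \<delta> n q \<and> x - t *\<^sub>R v \<in> slope_stable U w \<delta> n q)"
    using stable_ae by metis
  show ?thesis
  proof (intro exI[of _ N] conjI allI impI N)
    fix x assume x: "x \<notin> N"
    have "\<exists>L. (remainder x v \<longlongrightarrow> L) (at 0)" if v: "v \<in> ?R" for v
    proof (rule limit_at_0_if_approx)
      fix \<delta> :: real assume "\<delta> > 0"
      then obtain n q where "x \<in> slope_stable U v \<delta> n q"
        using st[OF x v] by blast
      then have "\<forall>t. t \<noteq> 0 \<longrightarrow> \<bar>t\<bar> < 1 / real (Suc n) \<longrightarrow> \<bar>remainder x v t - q\<bar> \<le> \<delta>"
        using remainder_stable \<open>\<delta> > 0\<close> by blast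
      then show "\<exists>q. \<exists>\<tau>>0. \<forall>t. t \<noteq> 0 \<longrightarrow> \<bar>t\<bar> < \<tau> \<longrightarrow> \<bar>remainder x v t - q\<bar> \<le> \<delta>"
        by (intro exI[of _ q] exI[of _ "1 / real (Suc n)"]) simp
    qed
    then obtain L where L: "\<And>v. v \<in> ?R \<Longrightarrow> (remainder x v \<longlongrightarrow> L v) (at 0)"
      by metis
    have L2: "(second_difference x v \<longlongrightarrow> 2 * L v) (at 0)" if "v \<in> ?R" for v
    proof -
      have "((\<lambda>t. remainder x v (- t)) \<longlongrightarrow> L v) (at 0)"
        by (rule filterlim_compose[OF L[OF that]]) (auto simp: filterlim_at eventually_at_filter intro!: tendsto_eq_intros)
      then have "((\<lambda>t. remainder x v t + remainder x v (- t)) \<longlongrightarrow> L v + L v) (at 0)"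
        by (intro tendsto_add L that)
      moreover have "\<forall>\<^sub>F t in at 0. remainder x v t + remainder x v (- t) = second_difference x v t"
        unfolding eventually_at_filter by (auto simp: second_difference_remainder)
      ultimately have "(second_difference x v \<longlongrightarrow> L v + L v) (at 0)"
        by (rule Lim_transform_eventually)
      then show ?thesis
        by (simp only: mult_2)
    qed
    \<comment> \<open>The combination of second differences has a limit \<open>d\<close>, twice the
      defect in the parallelogram law. It is therefore enough that \<open>D t\<close> is small for
      arbitrarily small \<open>t\<close>, and the times of symmetric return are such
      \<open>t\<close>.\<close>
    have par: "L (v + w) + L (v - w) = 2 * L v + 2 * L w" if v: "v \<in> ?R" and w: "w \<in> ?R" for v w
    proof -
      define D where "D = (\<lambda>t. second_difference x (v + w) t + second_difference x (v - w) t
         - 2 * second_difference x v t - 2 * second_difference x w t)"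
      define d where "d = 2 * L (v + w) + 2 * L (v - w) - 2 * (2 * L v) - 2 * (2 * L w)"
      have "(D \<longlongrightarrow> d) (at 0)"
        unfolding D_def d_def by (intro tendsto_intros L2 rational_points_add rational_points_diff v w)
      have "\<bar>d\<bar> \<le> 0 + e" if "e > 0" for e
      proof -
        \<comment> \<open>The three second differences close to \<open>2 * q\<close> cost
          \<open>8 * \<delta>\<close>, namely 2 + 2 + 2 * 2; one further \<delta> pays for the
          approximation of \<open>d\<close> by \<open>D t\<close>.\<close>
        define \<delta> where "\<delta> = e / 9"
        have "\<delta> > 0" using that by (simp add: \<delta>_def)
        obtain n q where nq: "x \<in> slope_stable U w \<delta> n q"
          and r: "\<And>\<tau>. \<tau> > 0 \<Longrightarrow> \<exists>t. 0 < t \<and> t < \<tau> \<and> x + t *\<^sub>R v \<in> slope_stable U w \<delta> n q \<and> x - t *\<^sub>R v \<in> slope_stable U w \<delta> n q"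
          using ret[OF x v w \<open>\<delta> > 0\<close>] by blast
        obtain \<tau> where \<tau>: "\<tau> > 0" "\<And>t. t \<noteq> 0 \<Longrightarrow> \<bar>t\<bar> < \<tau> \<Longrightarrow> \<bar>D t - d\<bar> < \<delta>"
          using tendstoD[OF \<open>(D \<longlongrightarrow> d) (at 0)\<close> \<open>\<delta> > 0\<close>] unfolding eventually_at dist_real_def by auto
        obtain t where t: "0 < t" "t < min \<tau> (1 / real (Suc n))"
          "x + t *\<^sub>R v \<in> slope_stable U w \<delta> n q" "x - t *\<^sub>R v \<in> slope_stable U w \<delta> n q"
          using r[of "min \<tau> (1 / real (Suc n))"] \<tau>(1) by auto
        have t': "t \<noteq> 0" "\<bar>t\<bar> < 1 / real (Suc n)" using t by auto
        have "\<bar>D t\<bar> \<le> 8 * \<delta>"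
          unfolding D_def second_difference_parallelogram
          using second_difference_stable[OF t(3) t' \<open>\<delta> > 0\<close>] second_difference_stable[OF t(4) t' \<open>\<delta> > 0\<close>]
            second_difference_stable[OF nq t' \<open>\<delta> > 0\<close>] by linarith
        then show ?thesis
          using \<tau>(2)[of t] t \<delta>_def by linarith
      qed
      then have "\<bar>d\<bar> \<le> 0"
        by (rule field_le_epsilon)
      then show ?thesis
        by (simp add: d_def)
    qed
    obtain B where B: "\<And>i j. B i j = B j i"
      "\<And>v. v \<in> ?R \<Longrightarrow> L v = (\<Sum>i\<in>Basis. \<Sum>j\<in>Basis. (v \<bullet> i) * (v \<bullet> j) * B i j)"
      using parallelogram_quadratic[of L] par by blast
    \<comment> \<open>\<open>L\<close> is the limit of the remainders, hence half the second
      derivative; the factor 2 makes up for the division by 2 in the expansion.\<close>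
    define A where "A = (\<lambda>v. \<Sum>i\<in>Basis. (\<Sum>j\<in>Basis. 2 * (v \<bullet> j) * B i j) *\<^sub>R i)"
    define Q where "Q = (\<lambda>v. v \<bullet> A v / 2)"
    have "linear A"
      unfolding A_def
      by (intro linearI) (auto simp: inner_add_left algebra_simps sum.distrib sum_distrib_left scaleR_sum_right scaleR_sum_left)
    moreover have vA: "v \<bullet> A w = (\<Sum>i\<in>Basis. \<Sum>j\<in>Basis. 2 * (v \<bullet> i) * (w \<bullet> j) * B i j)" for v w
      by (simp add: A_def inner_sum_right sum_distrib_left sum_distrib_right mult_ac)
    have "v \<bullet> A w = A v \<bullet> w" for v w
    proof -
      have "v \<bullet> A w = (\<Sum>j\<in>Basis. \<Sum>i\<in>Basis. 2 * (v \<bullet> i) * (w \<bullet> j) * B i j)"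
        unfolding vA by (rule sum.swap)
      also have "\<dots> = w \<bullet> A v"
        unfolding vA by (intro sum.cong refl) (simp add: B(1) mult_ac)
      finally show ?thesis
        by (simp add: inner_commute)
    qed
    moreover have "\<exists>\<tau>>0. \<forall>h. norm h < \<tau> \<longrightarrow>
        \<bar>U (x + h) - U x - G x \<bullet> h - h \<bullet> A h / 2\<bar> \<le> e * (norm h)\<^sup>2" if "e > 0" for e
    proof -
      have LQ: "L v = Q v" if "v \<in> ?R" for v
        unfolding Q_def vA B(2)[OF that] by (simp add: sum_divide_distrib mult.assoc)
      have "continuous_on UNIV Q"
        unfolding Q_def using \<open>linear A\<close> by (intro continuous_intros linear_continuous_on linear_conv_bounded_linear[THEN iffD1]) auto
      moreover have "(remainder x v \<longlongrightarrow> Q v) (at 0)" if "v \<in> ?R" for v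
        using L[OF that] LQ[OF that] by simp
      ultimately have "\<forall>\<^sub>F t in at 0. \<forall>v. norm v = 1 \<longrightarrow> \<bar>remainder x v t - Q v\<bar> \<le> e"
        using \<open>e > 0\<close> by (intro remainder_uniform)
      then obtain \<tau> where \<tau>: "\<tau> > 0" "\<And>t v. t \<noteq> 0 \<Longrightarrow> \<bar>t\<bar> < \<tau> \<Longrightarrow> norm v = 1 \<Longrightarrow> \<bar>remainder x v t - Q v\<bar> \<le> e"
        unfolding eventually_at dist_real_def by auto
      have "\<bar>U (x + h) - U x - G x \<bullet> h - h \<bullet> A h / 2\<bar> \<le> e * (norm h)\<^sup>2" if h: "norm h < \<tau>" for h
      proof (cases "h = 0")
        case False
        define v where "v = (1 / norm h) *\<^sub>R h"
        have hv: "h = norm h *\<^sub>R v" "norm v = 1"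
          using False by (auto simp: v_def)
        have "h \<bullet> A h / 2 = (norm h)\<^sup>2 * Q v"
          using linear_scale[OF \<open>linear A\<close>, of "norm h" v] hv(1)
          by (metis (no_types, lifting) Q_def inner_scaleR_left inner_scaleR_right mult.assoc power2_eq_square times_divide_eq_right)
        moreover have "U (x + h) - U x - G x \<bullet> h = (norm h)\<^sup>2 * remainder x v (norm h)"
          using False hv(1) by (simp add: remainder_def) (metis inner_scaleR_right)
        ultimately have "\<bar>U (x + h) - U x - G x \<bullet> h - h \<bullet> A h / 2\<bar> = (norm h)\<^sup>2 * \<bar>remainder x v (norm h) - Q v\<bar>"
          by (simp add: abs_mult flip: right_diff_distrib)
        also have "\<dots> \<le> (norm h)\<^sup>2 * e"
          using False h hv(2) by (intro mult_left_mono \<tau>(2)) auto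
        finally show ?thesis
          by (simp add: mult.commute)
      qed (use linear_0[OF \<open>linear A\<close>] in simp)
      then show ?thesis
        using \<tau>(1) by blast
    qed
    ultimately show "\<exists>A. second_order U x (G x) A"
      unfolding second_order_def by (intro exI[of _ A]) blast
  qed
qed

end

section \<open>Sup-convolutions and the theorem on sums\<close>

lemma negligible_Times:
  fixes A :: "'a::euclidean_space set" and B :: "'b::euclidean_space set"
  assumes "negligible A"
  shows "negligible (A \<times> (UNIV :: 'b set))" "negligible ((UNIV :: 'b set) \<times> A)"
proof -
  have "A \<in> null_sets lebesgue"
    using assms by (simp add: negligible_iff_null_sets)
  then obtain N where N: "A \<subseteq> N" "N \<in> null_sets lborel"
    by (auto simp: null_sets_completion_iff2)
  have "N \<in> sets borel" "emeasure lborel N = 0"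
    using N(2) by (auto simp: null_sets_def)
  then have "emeasure (lborel \<Otimes>\<^sub>M lborel) (N \<times> (UNIV :: 'b set)) = 0" "emeasure (lborel \<Otimes>\<^sub>M lborel) ((UNIV :: 'b set) \<times> N) = 0"
    by (subst lborel.emeasure_pair_measure_Times; simp)+
  then have "N \<times> (UNIV :: 'b set) \<in> null_sets lborel" "(UNIV :: 'b set) \<times> N \<in> null_sets lborel"
    using \<open>N \<in> sets borel\<close> by (auto simp: lborel_prod null_sets_def borel_Times)
  then have "negligible (N \<times> (UNIV :: 'b set))" "negligible ((UNIV :: 'b set) \<times> N)"
    by (auto simp: negligible_iff_null_sets null_sets_completionI)
  then show "negligible (A \<times> (UNIV :: 'b set))" "negligible ((UNIV :: 'b set) \<times> A)"
    using N(1) negligible_subset Sigma_mono subset_refl by metis+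
qed

lemma usc_attains_sup:
  fixes F :: "'a::topological_space \<Rightarrow> real"
  assumes "compact K" "K \<noteq> {}" and usc: "\<And>c. closed {x. c \<le> F x}"
  shows "\<exists>x\<in>K. \<forall>y\<in>K. F y \<le> F x"
proof (rule ccontr)
  assume "\<not> (\<exists>x\<in>K. \<forall>y\<in>K. F y \<le> F x)"
  then have "K \<subseteq> (\<Union>y\<in>K. - {z. F y \<le> F z})"
    by (fastforce simp: not_le)
  then obtain Y where Y: "Y \<subseteq> K" "finite Y" "K \<subseteq> (\<Union>y\<in>Y. - {z. F y \<le> F z})"
    using compactE_image[OF assms(1), of K "\<lambda>y. - {z. F y \<le> F z}"] usc by (metis open_Compl)
  have "Y \<noteq> {}" using Y(3) assms(2) by auto
  then have "Max (F ` Y) \<in> F ` Y"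
    using Y(2) by (intro Max_in) auto
  then obtain y where y: "y \<in> Y" "F y = Max (F ` Y)"
    by auto
  then have "y \<in> (\<Union>y\<in>Y. - {z. F y \<le> F z})"
    using Y by blast
  then obtain y' where "y' \<in> Y" "F y < F y'"
    by (auto simp: not_le)
  moreover have "F y' \<le> F y"
    using y(2) \<open>y' \<in> Y\<close> Y(2) by simp
  ultimately show False by simp
qed

lemma usc_add_continuous:
  fixes F g :: "'a::first_countable_topology \<Rightarrow> real"
  assumes usc: "\<And>c. closed {x. c \<le> F x}" and g: "continuous_on UNIV g"
  shows "closed {x. c \<le> F x + g x}"
  unfolding closed_sequential_limits
proof (intro allI impI, elim conjE)
  fix X l assume X: "\<forall>n. X n \<in> {x. c \<le> F x + g x}" "X \<longlonglongrightarrow> l"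
  have "(\<lambda>n. g (X n)) \<longlonglongrightarrow> g l"
    using g X(2) by (intro continuous_on_tendsto_compose[OF g X(2)]) auto
  have "c - g l \<le> F l + e" if "e > 0" for e
  proof -
    have "\<forall>\<^sub>F n in sequentially. g (X n) < g l + e"
      using order_tendstoD(2)[OF \<open>(\<lambda>n. g (X n)) \<longlonglongrightarrow> g l\<close>, of "g l + e"] that by simp
    then have "\<forall>\<^sub>F n in sequentially. X n \<in> {x. c - g l - e \<le> F x}"
    proof eventually_elim
      case (elim n)
      then show ?case using X(1)[rule_format, of n] by simp
    qed
    then have "l \<in> {x. c - g l - e \<le> F x}"
      by (intro Lim_in_closed_set[OF usc _ _ X(2)]) auto
    then show ?thesis by simp
  qed
  then have "c - g l \<le> F l"
    by (rule field_le_epsilon)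
  then show "l \<in> {x. c \<le> F x + g x}"
    by simp
qed

section \<open>Superjets and sup-convolutions\<close>

definition upper_jet :: "('a::real_inner \<Rightarrow> real) \<Rightarrow> 'a \<Rightarrow> 'a \<Rightarrow> ('a \<Rightarrow> 'a) \<Rightarrow> bool" where
  "upper_jet u x p X \<longleftrightarrow> linear X \<and> (\<forall>v w. v \<bullet> X w = X v \<bullet> w) \<and>
     (\<forall>\<delta>>0. \<exists>\<tau>>0. \<forall>h. norm h < \<tau> \<longrightarrow> u (x + h) \<le> u x + p \<bullet> h + h \<bullet> X h / 2 + \<delta> * (norm h)\<^sup>2)"

lemma norm_sq_add: "(norm (a + b))\<^sup>2 = (norm a)\<^sup>2 + 2 * (a \<bullet> b) + (norm b)\<^sup>2" for a b :: "'a::real_inner"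
  by (simp add: power2_norm_eq_inner inner_add_left inner_add_right inner_commute)

lemma norm_sq_diff: "(norm (a - b))\<^sup>2 = (norm a)\<^sup>2 - 2 * (a \<bullet> b) + (norm b)\<^sup>2" for a b :: "'a::real_inner"
  by (simp add: power2_norm_eq_inner inner_diff_left inner_diff_right inner_commute)

text \<open>Scaling a vector into the small ball multiplies both sides of the local bound by the
  same \<open>t^2\<close>, so the bound holds for every vector and every \<open>e\<close>.\<close>

lemma quadratic_nonneg_local:
  fixes q :: "'a::real_normed_vector \<Rightarrow> real"
  assumes scale: "\<And>t h. q (t *\<^sub>R h) = t\<^sup>2 * q h"
    and loc: "\<And>e. e > 0 \<Longrightarrow> \<exists>\<tau>>0. \<forall>h. norm h < \<tau> \<longrightarrow> - e * (norm h)\<^sup>2 \<le> q h"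
  shows "0 \<le> q h"
proof -
  define n where "n = (norm h)\<^sup>2 + 1"
  have n: "n > 0" "(norm h)\<^sup>2 \<le> n"
    by (simp_all add: n_def add_nonneg_pos)
  have "0 \<le> q h + e" if "e > 0" for e
  proof -
    have "e / n > 0" using that n by simp
    then obtain \<tau> where \<tau>: "\<tau> > 0" "\<And>h. norm h < \<tau> \<Longrightarrow> - (e / n) * (norm h)\<^sup>2 \<le> q h"
      using loc by blast
    define t where "t = \<tau> / (norm h + 1)"
    have t: "t > 0" using \<tau>(1) by (simp add: t_def add_nonneg_pos)
    have "norm h + 1 > 0" by (simp add: add_nonneg_pos)
    then have "t * (norm h + 1) = \<tau>"
      by (simp add: t_def)
    then have "norm (t *\<^sub>R h) < \<tau>"
      using t by (simp add: distrib_left)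
    from \<tau>(2)[OF this] have "t\<^sup>2 * (- (e / n) * (norm h)\<^sup>2) \<le> t\<^sup>2 * q h"
      by (simp add: scale power_mult_distrib mult_ac)
    then have "- (e / n) * (norm h)\<^sup>2 \<le> q h"
      by (rule mult_left_le_imp_le) (use t in simp)
    moreover have "e / n * (norm h)\<^sup>2 \<le> e / n * n"
      using n that by (intro mult_left_mono) auto
    ultimately show ?thesis
      using n by simp
  qed
  then show ?thesis
    by (rule field_le_epsilon)
qed

text \<open>\<open>\<alpha> < \<kappa>\<close> leaves a strictly negative quadratic term in the
  penalized function, so the supremum is attained although \<open>u\<close> itself may grow
  quadratically.\<close>

locale sup_convolution =
  fixes u :: "'a::euclidean_space \<Rightarrow> real" and \<alpha> \<kappa> :: real
  assumes usc: "\<And>c. closed {x. c \<le> u x}"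
    and growth: "\<And>x. u x \<le> \<alpha> / 2 * (norm x)\<^sup>2"
    and \<kappa>: "0 \<le> \<alpha>" "\<alpha> < \<kappa>"
begin

definition prox :: "'a \<Rightarrow> 'a" where
  "prox x = (SOME z. \<forall>y. u y - \<kappa> / 2 * (norm (x - y))\<^sup>2 \<le> u z - \<kappa> / 2 * (norm (x - z))\<^sup>2)"

definition conv :: "'a \<Rightarrow> real" where
  "conv x = u (prox x) - \<kappa> / 2 * (norm (x - prox x))\<^sup>2"

definition W :: "'a \<Rightarrow> real" where
  "W x = conv x + \<kappa> / 2 * (norm x)\<^sup>2"

lemma prox_exists: "\<exists>z. \<forall>y. u y - \<kappa> / 2 * (norm (x - y))\<^sup>2 \<le> u z - \<kappa> / 2 * (norm (x - z))\<^sup>2"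
proof -
  define F where "F = (\<lambda>y. u y + - \<kappa> / 2 * (norm (x - y))\<^sup>2)"
  define \<beta> where "\<beta> = (\<kappa> - \<alpha>) / 2"
  have "\<beta> > 0" using \<kappa> by (simp add: \<beta>_def)
  have F: "closed {y. c \<le> F y}" for c
    unfolding F_def by (rule usc_add_continuous[OF usc]) (intro continuous_intros)
  have le: "F y \<le> \<kappa> * norm x * norm y - \<beta> * (norm y)\<^sup>2" for y
  proof -
    have "(norm (x - y))\<^sup>2 \<ge> (norm y)\<^sup>2 - 2 * (norm x * norm y)"
      unfolding norm_sq_diff using norm_cauchy_schwarz[of x y] zero_le_power2[of "norm x"] by linarith
    then have "\<kappa> / 2 * (norm (x - y))\<^sup>2 \<ge> \<kappa> / 2 * ((norm y)\<^sup>2 - 2 * (norm x * norm y))"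
      using \<kappa> by (intro mult_left_mono) auto
    then show ?thesis
      using growth[of y] by (simp add: F_def \<beta>_def field_simps)
  qed
  \<comment> \<open>Beyond this radius the decay \<open>\<beta> * (norm y)^2\<close> outweighs both
    the linear term and the value at 0, so a maximizer can be sought in a compact ball.\<close>
  define R where "R = (\<kappa> * norm x + \<bar>F 0\<bar>) / \<beta> + 1"
  have "R \<ge> 1" using \<kappa> \<open>\<beta> > 0\<close> by (simp add: R_def)
  have out: "F y \<le> F 0" if "norm y > R" for y
  proof -
    have "\<kappa> * norm x + \<bar>F 0\<bar> \<le> \<beta> * norm y"
      using that \<open>\<beta> > 0\<close> unfolding R_def by (simp add: field_simps)
    then have "(\<kappa> * norm x + \<bar>F 0\<bar>) * norm y \<le> \<beta> * norm y * norm y"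
      by (intro mult_right_mono) auto
    then have "\<kappa> * norm x * norm y - \<beta> * (norm y)\<^sup>2 \<le> - \<bar>F 0\<bar> * norm y"
      by (simp add: power2_eq_square algebra_simps)
    also have "\<dots> \<le> - \<bar>F 0\<bar> * 1"
      using that \<open>R \<ge> 1\<close> by (intro mult_left_mono_neg) auto
    finally show ?thesis
      using le[of y] by linarith
  qed
  obtain z where z: "z \<in> cball 0 R" "\<And>y. y \<in> cball 0 R \<Longrightarrow> F y \<le> F z"
    using usc_attains_sup[of "cball 0 R" F] F \<open>R \<ge> 1\<close> by auto
  have "F y \<le> F z" for y
    using z(2)[of y] z(2)[of 0] out[of y] \<open>R \<ge> 1\<close> by (cases "norm y \<le> R") auto
  then show ?thesis
    by (intro exI[of _ z]) (simp add: F_def)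
qed

lemma prox: "u y - \<kappa> / 2 * (norm (x - y))\<^sup>2 \<le> conv x"
  unfolding conv_def prox_def using someI_ex[OF prox_exists[of x]] by blast

text \<open>Expanding the square turns \<open>W x\<close> into the supremum over \<open>y\<close> of
  \<open>u y - \<kappa> / 2 * (norm y)^2 + \<kappa> * (x \<bullet> y)\<close>, a supremum of affine
  functions of \<open>x\<close>. The slope \<open>\<kappa> *\<^sub>R y\<close> of a maximizing one
  is a subgradient.\<close>

sublocale W: subgradient W "\<lambda>x. \<kappa> *\<^sub>R prox x"
proof
  fix x y
  show "W x + (\<kappa> *\<^sub>R prox x) \<bullet> (y - x) \<le> W y"
    using prox[of "prox x" y] by (simp add: W_def conv_def norm_sq_diff inner_diff_left inner_diff_right inner_commute algebra_simps)
qed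

lemma continuous_conv: "continuous_on UNIV conv"
proof -
  have "conv = (\<lambda>x. W x - \<kappa> / 2 * (norm x)\<^sup>2)"
    by (simp add: W_def fun_eq_iff)
  then show ?thesis
    using W.continuous by (auto intro!: continuous_intros)
qed

lemma expansion_nonneg:
  assumes A: "second_order W x (\<kappa> *\<^sub>R prox x) A"
  shows "0 \<le> h \<bullet> A h"
proof (rule quadratic_nonneg_local[of "\<lambda>h. h \<bullet> A h"])
  show "t *\<^sub>R h \<bullet> A (t *\<^sub>R h) = t\<^sup>2 * (h \<bullet> A h)" for t h
    by (simp add: linear_scale[OF second_orderD(1)[OF A]] power2_eq_square mult_ac)
next
  fix e :: real assume "e > 0"
  then obtain \<tau> where \<tau>: "\<tau> > 0" "\<And>h. norm h < \<tau> \<Longrightarrow>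
      \<bar>W (x + h) - W x - (\<kappa> *\<^sub>R prox x) \<bullet> h - h \<bullet> A h / 2\<bar> \<le> e / 2 * (norm h)\<^sup>2"
    using second_orderD(3)[OF A, of "e / 2"] by auto
  have "- e * (norm h)\<^sup>2 \<le> h \<bullet> A h" if "norm h < \<tau>" for h
  proof -
    have "W x + (\<kappa> *\<^sub>R prox x) \<bullet> h \<le> W (x + h)"
      using W.sub[of x "x + h"] by simp
    moreover have "- e * (norm h)\<^sup>2 = - 2 * (e / 2 * (norm h)\<^sup>2)"
      by simp
    ultimately show ?thesis
      using \<tau>(2)[OF that] by linarith
  qed
  then show "\<exists>\<tau>>0. \<forall>h. norm h < \<tau> \<longrightarrow> - e * (norm h)\<^sup>2 \<le> h \<bullet> A h"
    using \<tau>(1) by blast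
qed

text \<open>When the competitor is translated together with the point, \<open>u (prox x + h)\<close>
  stays below \<open>conv (x + h)\<close> plus a constant, with equality at \<open>h = 0\<close>.
  Expansions of \<open>conv\<close> at \<open>x\<close> thus pass to \<open>u\<close> at
  \<open>prox x\<close> with unchanged gradient and Hessian. The lower bound on \<open>X\<close>
  expresses the convexity of \<open>W\<close>.\<close>

lemma conv_expansion:
  assumes so: "second_order W x (\<kappa> *\<^sub>R prox x) A"
  defines "X \<equiv> \<lambda>v. A v - \<kappa> *\<^sub>R v" and "p \<equiv> \<kappa> *\<^sub>R (prox x - x)"
  shows "upper_jet u (prox x) p X"
    and "\<And>h. - \<kappa> * (norm h)\<^sup>2 \<le> h \<bullet> X h"
    and "second_order conv x p X"
proof -
  note A = second_orderD[OF so]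
  have X: "linear X"
    unfolding X_def by (intro linear_compose_sub A(1) linear_scaleR)
  have Xs: "v \<bullet> X w = X v \<bullet> w" for v w
    by (simp add: X_def inner_diff_left inner_diff_right A(2))
  have hX: "h \<bullet> X h = h \<bullet> A h - \<kappa> * (norm h)\<^sup>2" for h
    by (simp add: X_def inner_diff_right power2_norm_eq_inner)
  show low: "- \<kappa> * (norm h)\<^sup>2 \<le> h \<bullet> X h" for h
    using expansion_nonneg[OF so] by (simp add: hX)
  have eq: "conv (x + h) - conv x - p \<bullet> h - h \<bullet> X h / 2 = W (x + h) - W x - (\<kappa> *\<^sub>R prox x) \<bullet> h - h \<bullet> A h / 2" for h
    by (simp add: W_def hX p_def norm_sq_add inner_diff_left inner_commute[of x h] field_simps)
  show exp: "second_order conv x p X"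
    unfolding second_order_def eq using X Xs A(3) by blast
  have "\<exists>\<tau>>0. \<forall>h. norm h < \<tau> \<longrightarrow> u (prox x + h) \<le> u (prox x) + p \<bullet> h + h \<bullet> X h / 2 + \<delta> * (norm h)\<^sup>2"
    if \<delta>: "\<delta> > 0" for \<delta>
  proof -
    obtain \<tau> where \<tau>: "\<tau> > 0" "\<And>h. norm h < \<tau> \<Longrightarrow>
        \<bar>conv (x + h) - conv x - p \<bullet> h - h \<bullet> X h / 2\<bar> \<le> \<delta> * (norm h)\<^sup>2"
      using second_orderD(3)[OF exp \<delta>] by blast
    have "u (prox x + h) \<le> u (prox x) + p \<bullet> h + h \<bullet> X h / 2 + \<delta> * (norm h)\<^sup>2" if "norm h < \<tau>" for h
      using \<tau>(2)[OF that] prox[of "prox x + h" "x + h"] by (simp add: conv_def)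
    then show ?thesis
      using \<tau>(1) by blast
  qed
  then show "upper_jet u (prox x) p X"
    unfolding upper_jet_def using X Xs by blast
qed

end

text \<open>
  At a point of contact with a linear function the subgradient determines the slope, and comparing
  the touching paraboloids from above and below shows that the slope is Lipschitz there.
\<close>

locale semiconvex =
  fixes F :: "'a::euclidean_space \<Rightarrow> real" and g :: "'a \<Rightarrow> 'a" and K :: real
  assumes sub: "\<And>x y. F x + K / 2 * (norm x)\<^sup>2 + g x \<bullet> (y - x) \<le> F y + K / 2 * (norm y)\<^sup>2"
    and K: "K > 0"
begin

definition contact :: "real \<Rightarrow> 'a set" where
  "contact r = {z. \<exists>q. norm q \<le> r \<and> (\<forall>y. F y \<le> F z + q \<bullet> (y - z))}"

lemma lower: "F z + (g z - K *\<^sub>R z) \<bullet> (y - z) - K / 2 * (norm (y - z))\<^sup>2 \<le> F y"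
proof -
  have "(norm y)\<^sup>2 = (norm z)\<^sup>2 + 2 * (z \<bullet> (y - z)) + (norm (y - z))\<^sup>2"
    using norm_sq_add[of z "y - z"] by simp
  then have "K / 2 * (norm y)\<^sup>2 = K / 2 * (norm z)\<^sup>2 + K * (z \<bullet> (y - z)) + K / 2 * (norm (y - z))\<^sup>2"
    by (simp add: distrib_left)
  then show ?thesis
    using sub[of z y] unfolding inner_diff_left[of "g z"] inner_scaleR_left by linarith
qed

lemma contact_slope:
  assumes q: "\<And>y. F y \<le> F z + q \<bullet> (y - z)"
  shows "q = g z - K *\<^sub>R z"
proof -
  define a where "a = g z - K *\<^sub>R z - q"
  have "a \<bullet> d \<le> K / 2 * (norm d)\<^sup>2" for d
    using lower[of z "z + d"] q[of "z + d"] by (simp add: a_def inner_diff_left)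
  \<comment> \<open>\<open>a / K\<close> maximizes the linear minus the quadratic term, and this
    single choice already forces \<open>a = 0\<close>.\<close>
  from this[of "(1 / K) *\<^sub>R a"] have "(norm a)\<^sup>2 / K \<le> K / 2 * (norm a)\<^sup>2 / K\<^sup>2"
    using K by (simp add: power2_norm_eq_inner power_divide)
  then have "(norm a)\<^sup>2 \<le> 0"
    using K by (simp add: field_simps power2_eq_square)
  then show ?thesis
    by (simp add: a_def)
qed

lemma contact_slope_lipschitz:
  assumes q1: "\<And>y. F y \<le> F z1 + q1 \<bullet> (y - z1)" and q2: "\<And>y. F y \<le> F z2 + q2 \<bullet> (y - z2)"
  shows "norm (q1 - q2) \<le> 2 * K * norm (z1 - z2)"
proof (cases "q1 = q2")
  case False
  \<comment> \<open>Three bounds are chained: the lower paraboloid at \<open>z1\<close>, the affine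
    majorant at \<open>z2\<close>, and the affine majorant at \<open>z1\<close> evaluated at
    \<open>z2\<close>.\<close>
  have le: "(q1 - q2) \<bullet> (z - z2) \<le> K / 2 * (norm (z - z1))\<^sup>2" for z
    using lower[of z1 z] q2[of z] q1[of z2] contact_slope[OF q1]
    by (simp add: inner_diff_left inner_diff_right)
  show ?thesis
  proof (cases "z1 = z2")
    case True
    then show ?thesis
      using contact_slope[OF q1] contact_slope[OF q2] by simp
  next
    case False
    define d where "d = norm (z1 - z2)"
    have d: "d > 0" using False by (simp add: d_def)
    \<comment> \<open>A step of length \<open>d\<close> from \<open>z2\<close> in the direction of
      \<open>q1 - q2\<close> stays within \<open>2 * d\<close> of \<open>z1\<close>, so both sides
      scale alike in \<open>d\<close>.\<close>
    define b where "b = (d / norm (q1 - q2)) *\<^sub>R (q1 - q2)"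
    have nb: "norm b = d" and qb: "(q1 - q2) \<bullet> b = d * norm (q1 - q2)"
      using \<open>q1 \<noteq> q2\<close> d by (auto simp: b_def power2_norm_eq_inner[symmetric] power2_eq_square)
    have "norm (z2 + b - z1) \<le> 2 * d"
      using norm_triangle_ineq[of b "z2 - z1"] nb by (simp add: d_def norm_minus_commute algebra_simps)
    then have "(norm (z2 + b - z1))\<^sup>2 \<le> (2 * d)\<^sup>2"
      by (intro power_mono) auto
    then have "K / 2 * (norm (z2 + b - z1))\<^sup>2 \<le> K / 2 * (2 * d)\<^sup>2"
      using K by (intro mult_left_mono) auto
    then have "d * norm (q1 - q2) \<le> K / 2 * (2 * d)\<^sup>2"
      using le[of "z2 + b"] qb by simp
    then have "d * norm (q1 - q2) \<le> d * (2 * K * d)"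
      by (simp add: power2_eq_square mult_ac)
    then show ?thesis
      using d by (simp add: d_def[symmetric])
  qed
qed (use K in simp)

text \<open>Every slope in the ball of radius \<open>r\<close> occurs, so the slope map sends the
  contact set onto a set containing that ball. The Lipschitz image of a negligible set could not do
  so.\<close>

lemma contact_not_negligible:
  assumes "r > 0" and ex: "\<And>q. norm q \<le> r \<Longrightarrow> \<exists>z. \<forall>y. F y \<le> F z + q \<bullet> (y - z)"
  shows "\<not> negligible (contact r)"
proof
  assume neg: "negligible (contact r)"
  define q where "q = (\<lambda>z. g z - K *\<^sub>R z)"
  have "negligible (q ` contact r)"
  proof (rule negligible_locally_Lipschitz_image[OF _ neg])
    fix z assume z: "z \<in> contact r"
    have "norm (q y - q z) \<le> 2 * K * norm (y - z)" if y: "y \<in> contact r" for y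
    proof -
      obtain q1 q2 where "\<And>x. F x \<le> F y + q1 \<bullet> (x - y)" "\<And>x. F x \<le> F z + q2 \<bullet> (x - z)"
        using z y unfolding contact_def by blast
      then show ?thesis
        using contact_slope_lipschitz contact_slope unfolding q_def by metis
    qed
    then show "\<exists>T B. open T \<and> z \<in> T \<and> (\<forall>y\<in>contact r \<inter> T. norm (q y - q z) \<le> B * norm (y - z))"
      by (intro exI[of _ UNIV] exI[of _ "2 * K"]) auto
  qed simp
  moreover have "ball 0 r \<subseteq> q ` contact r"
  proof
    fix a :: 'a assume "a \<in> ball 0 r"
    then have "norm a \<le> r" by simp
    then obtain z where z: "\<And>y. F y \<le> F z + a \<bullet> (y - z)"
      using ex by blast
    then have "a = q z" "z \<in> contact r"
      using contact_slope[OF z] \<open>norm a \<le> r\<close> by (auto simp: q_def contact_def)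
    then show "a \<in> q ` contact r" by blast
  qed
  ultimately have "negligible (ball (0::'a) r)"
    using negligible_subset by blast
  then show False
    using open_not_negligible[of "ball (0::'a) r"] \<open>r > 0\<close> by auto
qed

end

text \<open>Normalized form of the doubled problem: values and slopes have been subtracted, so the
  maximum of \<open>u x + v y\<close> minus the quadratic coupling is 0 and is attained at the
  origin. The function to be touched from below enters through its negative
  \<open>v\<close>.\<close>

locale doubled_maximum =
  S1: sup_convolution u \<alpha> \<kappa> + S2: sup_convolution v \<alpha> \<kappa>
  for u v :: "'a::euclidean_space \<Rightarrow> real" and \<alpha> \<kappa> :: real +
  assumes zero: "u 0 = 0" "v 0 = 0"
    and le: "\<And>x y. u x + v y \<le> \<alpha> / 2 * (norm (x - y))\<^sup>2"
    and \<kappa>_eq: "\<kappa> = 3 * \<alpha>"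
begin

lemma \<kappa>_pos: "\<kappa> > 0"
  using S1.\<kappa> by simp

lemma \<alpha>_pos: "\<alpha> > 0"
  using S1.\<kappa> \<kappa>_eq by simp

lemma conv_le: "S1.conv x + S2.conv y \<le> \<kappa> / 2 * (norm (x - y))\<^sup>2"
proof -
  define a where "a = x - S1.prox x"
  define b where "b = y - S2.prox y"
  have pq: "S1.prox x - S2.prox y = (x - y) - (a - b)"
    by (simp add: a_def b_def)
  \<comment> \<open>With \<open>d = x - y\<close>, the expression 3|d|^2 + 3|a|^2 + 3|b|^2 - |d - (a
    - b)|^2 is half of the first square plus three halves of the second. The terms |a|^2 and |b|^2
    are exactly what the two sup-convolutions subtract, which is the origin of
    \<open>\<kappa> = 3 * \<alpha>\<close>.\<close>
  have "0 \<le> (norm (2 *\<^sub>R (x - y) + (a - b)))\<^sup>2" "0 \<le> (norm (a + b))\<^sup>2"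
    by simp_all
  then have "(norm ((x - y) - (a - b)))\<^sup>2 \<le> 3 * (norm (x - y))\<^sup>2 + 3 * (norm a)\<^sup>2 + 3 * (norm b)\<^sup>2"
    unfolding norm_sq_diff[of "x - y" "a - b"] norm_sq_add norm_sq_diff[of a b] by simp
  then have "\<alpha> / 2 * (norm ((x - y) - (a - b)))\<^sup>2 \<le> \<alpha> / 2 * (3 * (norm (x - y))\<^sup>2 + 3 * (norm a)\<^sup>2 + 3 * (norm b)\<^sup>2)"
    using \<alpha>_pos by (intro mult_left_mono) auto
  moreover have "u (S1.prox x) + v (S2.prox y) \<le> \<alpha> / 2 * (norm ((x - y) - (a - b)))\<^sup>2"
    using le[of "S1.prox x" "S2.prox y"] by (simp only: pq)
  moreover have k: "\<kappa> / 2 * t = \<alpha> / 2 * (3 * t)" for t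
    by (simp add: \<kappa>_eq)
  ultimately show ?thesis
    unfolding S1.conv_def S2.conv_def a_def[symmetric] b_def[symmetric] k distrib_left by linarith
qed

lemma conv_zero: "S1.conv 0 = 0" "S2.conv 0 = 0"
  using S1.prox[of 0 0] S2.prox[of 0 0] conv_le[of 0 0] zero by auto

text \<open>The \<eta> term makes the maximum at 0 strict, so contact points with small slope lie
  near 0. It reappears as the error \<open>2 * \<eta>\<close> in the matrix inequality.\<close>

definition penalty :: "real \<Rightarrow> 'a \<times> 'a \<Rightarrow> real" where
  "penalty \<eta> z = S1.conv (fst z) + S2.conv (snd z) - \<kappa> / 2 * (norm (fst z - snd z))\<^sup>2 - \<eta> * (norm z)\<^sup>2"

lemma norm_prod_sq: "(norm z)\<^sup>2 = (norm (fst z))\<^sup>2 + (norm (snd z))\<^sup>2" for z :: "'a \<times> 'a"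
  by (cases z) (simp add: norm_Pair)

definition slope_map :: "'a \<times> 'a \<Rightarrow> 'a \<times> 'a" where
  "slope_map z = (\<kappa> *\<^sub>R S1.prox (fst z) + \<kappa> *\<^sub>R (fst z + snd z), \<kappa> *\<^sub>R S2.prox (snd z) + \<kappa> *\<^sub>R (fst z + snd z))"

text \<open>The modulus has three sources: \<open>\<kappa>\<close> for the sup-convolutions,
  \<open>2 * \<kappa>\<close> because \<open>- \<kappa> / 2 * |x - y|^2\<close> plus
  \<open>\<kappa> * (|x|^2 + |y|^2)\<close> is \<open>\<kappa> / 2 * |x + y|^2\<close>, and
  \<open>2 * \<eta>\<close> to cancel the strict penalty.\<close>

lemma semiconvex_penalty:
  assumes "\<eta> > 0"
  shows "semiconvex (penalty \<eta>) slope_map (3 * \<kappa> + 2 * \<eta>)"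
proof
  show "3 * \<kappa> + 2 * \<eta> > 0"
    using \<kappa>_pos assms by simp
  fix z y :: "'a \<times> 'a"
  have eq: "penalty \<eta> z + (3 * \<kappa> + 2 * \<eta>) / 2 * (norm z)\<^sup>2
      = S1.W (fst z) + S2.W (snd z) + \<kappa> / 2 * (norm (fst z + snd z))\<^sup>2" for z
    unfolding penalty_def S1.W_def S2.W_def norm_prod_sq norm_sq_add norm_sq_diff by (simp add: field_simps)
  define s where "s = fst z + snd z"
  define t where "t = fst y + snd y"
  have "0 \<le> \<kappa> / 2 * (norm (t - s))\<^sup>2"
    using \<kappa>_pos by simp
  then have "\<kappa> / 2 * (norm s)\<^sup>2 + \<kappa> * (s \<bullet> (t - s)) \<le> \<kappa> / 2 * (norm t)\<^sup>2"
    unfolding norm_sq_diff by (simp add: inner_diff_right power2_norm_eq_inner[symmetric] inner_commute[of t s] algebra_simps)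
  moreover have "slope_map z \<bullet> (y - z) = (\<kappa> *\<^sub>R S1.prox (fst z)) \<bullet> (fst y - fst z) + (\<kappa> *\<^sub>R S2.prox (snd z)) \<bullet> (snd y - snd z) + \<kappa> * (s \<bullet> (t - s))"
    unfolding slope_map_def s_def[symmetric] inner_prod_def by (simp add: inner_add_left s_def t_def inner_diff_right inner_add_right algebra_simps)
  ultimately show "penalty \<eta> z + (3 * \<kappa> + 2 * \<eta>) / 2 * (norm z)\<^sup>2 + slope_map z \<bullet> (y - z)
      \<le> penalty \<eta> y + (3 * \<kappa> + 2 * \<eta>) / 2 * (norm y)\<^sup>2"
    unfolding eq s_def[symmetric] t_def[symmetric] using S1.W.sub[of "fst z" "fst y"] S2.W.sub[of "snd z" "snd y"] by linarith
qed

lemma penalty_le: "penalty \<eta> z \<le> - \<eta> * (norm z)\<^sup>2"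
  using conv_le[of "fst z" "snd z"] by (simp add: penalty_def)

lemma penalty_0: "penalty \<eta> 0 = 0"
  by (simp add: penalty_def conv_zero)

lemma continuous_penalty: "continuous_on UNIV (penalty \<eta>)"
  unfolding penalty_def
  by (intro continuous_intros continuous_on_compose2[OF S1.continuous_conv] continuous_on_compose2[OF S2.continuous_conv]) auto

lemma contact_bound:
  assumes "\<eta> > 0" "norm q \<le> r" and z: "\<And>y. penalty \<eta> y \<le> penalty \<eta> z + q \<bullet> (y - z)"
  shows "norm z \<le> r / \<eta>"
proof (cases "z = 0")
  case True
  have "r \<ge> 0" using assms(2) norm_ge_zero order_trans by blast
  then show ?thesis using True assms by simp
next
  case False
  have "0 \<le> penalty \<eta> z - q \<bullet> z"
    using z[of 0] penalty_0[of \<eta>] by simp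
  then have "\<eta> * (norm z)\<^sup>2 \<le> norm q * norm z"
    using penalty_le[of \<eta> z] norm_cauchy_schwarz[of "- q" z] by simp
  also have "\<dots> \<le> r * norm z"
    using assms by (intro mult_right_mono) auto
  finally have "\<eta> * norm z \<le> r"
    using False by (simp add: power2_eq_square)
  then show ?thesis
    using \<open>\<eta> > 0\<close> by (simp add: field_simps)
qed

lemma contact_exists:
  assumes "\<eta> > 0" "norm q \<le> r"
  shows "\<exists>z. \<forall>y. penalty \<eta> y \<le> penalty \<eta> z + q \<bullet> (y - z)"
proof -
  define F where "F = (\<lambda>z. penalty \<eta> z - q \<bullet> z)"
  have "r \<ge> 0" using assms(2) norm_ge_zero order_trans by blast
  have cF: "continuous_on UNIV F"
    unfolding F_def by (intro continuous_intros continuous_penalty)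
  obtain z where z: "z \<in> cball 0 (r / \<eta>)" "\<And>y. y \<in> cball 0 (r / \<eta>) \<Longrightarrow> F y \<le> F z"
    using continuous_attains_sup[of "cball 0 (r / \<eta>)" F] continuous_on_subset[OF cF subset_UNIV] \<open>r \<ge> 0\<close> \<open>\<eta> > 0\<close>
    by (metis cball_eq_empty compact_cball divide_nonneg_pos not_le)
  have "F y \<le> F z" for y
  proof (cases "norm y \<le> r / \<eta>")
    case False
    then have "r \<le> \<eta> * norm y"
      using \<open>\<eta> > 0\<close> by (simp add: field_simps)
    then have "norm q * norm y \<le> \<eta> * norm y * norm y"
      using assms(2) by (intro mult_right_mono) auto
    then have "F y \<le> 0"
      using penalty_le[of \<eta> y] norm_cauchy_schwarz[of "- q" y] by (simp add: F_def power2_eq_square)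
    also have "0 = F 0"
      by (simp add: F_def penalty_0)
    also have "\<dots> \<le> F z"
      using \<open>r \<ge> 0\<close> \<open>\<eta> > 0\<close> by (intro z(2)) simp
    finally show ?thesis .
  qed (use z(2) in auto)
  then show ?thesis
    by (intro exI[of _ z]) (simp add: F_def inner_diff_right algebra_simps)
qed

text \<open>Pairs with a bad first or second coordinate form a negligible union of cylinders, which
  cannot contain the contact set. The two gradient equations are the slope formula at a contact
  point, read in components.\<close>

lemma expansions_at_contact:
  assumes "\<eta> > 0" "r > 0"
  obtains x y q1 q2 A1 A2 where "norm x \<le> r / \<eta>" "norm y \<le> r / \<eta>" "norm q1 \<le> r" "norm q2 \<le> r"
    "\<And>z. penalty \<eta> z \<le> penalty \<eta> (x, y) + (q1, q2) \<bullet> (z - (x, y))"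
    "\<kappa> *\<^sub>R (S1.prox x - x) = q1 + \<kappa> *\<^sub>R (x - y) + (2 * \<eta>) *\<^sub>R x"
    "\<kappa> *\<^sub>R (S2.prox y - y) = q2 - \<kappa> *\<^sub>R (x - y) + (2 * \<eta>) *\<^sub>R y"
    "second_order S1.W x (\<kappa> *\<^sub>R S1.prox x) A1" "second_order S2.W y (\<kappa> *\<^sub>R S2.prox y) A2"
proof -
  interpret semiconvex "penalty \<eta>" slope_map "3 * \<kappa> + 2 * \<eta>"
    by (rule semiconvex_penalty[OF \<open>\<eta> > 0\<close>])
  obtain N1 where N1: "negligible N1" and ex1: "\<And>x. x \<notin> N1 \<Longrightarrow> \<exists>A. second_order S1.W x (\<kappa> *\<^sub>R S1.prox x) A"
    using S1.W.second_order_ae by blast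
  obtain N2 where N2: "negligible N2" and ex2: "\<And>x. x \<notin> N2 \<Longrightarrow> \<exists>A. second_order S2.W x (\<kappa> *\<^sub>R S2.prox x) A"
    using S2.W.second_order_ae by blast
  have "negligible (N1 \<times> (UNIV :: 'a set) \<union> (UNIV :: 'a set) \<times> N2)"
    by (intro negligible_Un negligible_Times N1 N2)
  moreover have "\<not> negligible (contact r)"
    by (rule contact_not_negligible[OF \<open>r > 0\<close> contact_exists[OF \<open>\<eta> > 0\<close>]])
  ultimately have "\<not> contact r \<subseteq> N1 \<times> UNIV \<union> UNIV \<times> N2"
    using negligible_subset by blast
  then obtain z where z: "z \<in> contact r" "z \<notin> N1 \<times> UNIV \<union> UNIV \<times> N2"
    by blast
  obtain q where q: "norm q \<le> r" "\<And>y. penalty \<eta> y \<le> penalty \<eta> z + q \<bullet> (y - z)"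
    using z(1) unfolding contact_def by blast
  obtain x y where xy: "z = (x, y)" by (cases z)
  obtain q1 q2 where q12: "q = (q1, q2)" by (cases q)
  have nx: "x \<notin> N1" "y \<notin> N2"
    using z(2) xy by auto
  obtain A1 where A1: "second_order S1.W x (\<kappa> *\<^sub>R S1.prox x) A1"
    using ex1[OF nx(1)] ..
  obtain A2 where A2: "second_order S2.W y (\<kappa> *\<^sub>R S2.prox y) A2"
    using ex2[OF nx(2)] ..
  have "q = slope_map z - (3 * \<kappa> + 2 * \<eta>) *\<^sub>R z"
    by (rule contact_slope[OF q(2)])
  then have qq: "q1 = \<kappa> *\<^sub>R S1.prox x + \<kappa> *\<^sub>R (x + y) - (3 * \<kappa> + 2 * \<eta>) *\<^sub>R x"
    "q2 = \<kappa> *\<^sub>R S2.prox y + \<kappa> *\<^sub>R (x + y) - (3 * \<kappa> + 2 * \<eta>) *\<^sub>R y"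
    by (simp_all add: xy q12 slope_map_def)
  have nz: "norm (x, y) \<le> r / \<eta>"
    using contact_bound[OF \<open>\<eta> > 0\<close> q] xy by simp
  show thesis
  proof (rule that)
    show "norm x \<le> r / \<eta>" "norm y \<le> r / \<eta>"
      using nz norm_fst_le[of x y] norm_snd_le[of y x] by linarith+
    show "norm q1 \<le> r" "norm q2 \<le> r"
      using q(1) norm_fst_le[of q1 q2] norm_snd_le[of q2 q1] unfolding q12 by linarith+
    show "penalty \<eta> w \<le> penalty \<eta> (x, y) + (q1, q2) \<bullet> (w - (x, y))" for w
      using q(2) unfolding xy q12 .
    show "\<kappa> *\<^sub>R (S1.prox x - x) = q1 + \<kappa> *\<^sub>R (x - y) + (2 * \<eta>) *\<^sub>R x"
      "\<kappa> *\<^sub>R (S2.prox y - y) = q2 - \<kappa> *\<^sub>R (x - y) + (2 * \<eta>) *\<^sub>R y"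
      unfolding qq by (simp_all add: algebra_simps flip: scaleR_add_left)
  qed (rule A1 A2)+
qed

text \<open>At a contact point with expansions of both sup-convolutions, the second order condition
  of the maximum is the matrix inequality; \<open>conv_expansion\<close> then carries the jets over
  to \<open>u\<close> and \<open>v\<close> at the proximal points, which are still close to
  0.\<close>

theorem jets_near_maximum:
  assumes "e > 0"
  shows "\<exists>x y p s X Y. norm x < e \<and> norm y < e \<and> norm p < e \<and> norm s < e \<and> \<bar>u x\<bar> < e \<and> \<bar>v y\<bar> < e \<and>
    upper_jet u x p X \<and> upper_jet v y s Y \<and>
    (\<forall>h. - \<kappa> * (norm h)\<^sup>2 \<le> h \<bullet> X h) \<and> (\<forall>h. - \<kappa> * (norm h)\<^sup>2 \<le> h \<bullet> Y h) \<and>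
    (\<forall>h k. h \<bullet> X h + k \<bullet> Y k \<le> \<kappa> * (norm (h - k))\<^sup>2 + e * ((norm h)\<^sup>2 + (norm k)\<^sup>2))"
proof -
  \<comment> \<open>\<open>2 * \<eta> \<le> e\<close> absorbs the Hessian of the strict penalty, and
    \<open>\<eta> \<le> 1\<close> lets slopes of size \<open>\<eta> * \<rho>\<close> be estimated by
    \<open>\<rho>\<close>.\<close>
  define \<eta> where "\<eta> = min 1 (e / 2)"
  have \<eta>: "0 < \<eta>" "\<eta> \<le> 1" "2 * \<eta> \<le> e"
    using assms by (auto simp: \<eta>_def)
  have c1: "isCont S1.conv 0" and c2: "isCont S2.conv 0"
    using S1.continuous_conv S2.continuous_conv by (auto simp: continuous_on_eq_continuous_at)
  obtain d1 where d1: "d1 > 0" "\<And>x. norm x < d1 \<Longrightarrow> \<bar>S1.conv x\<bar> < e / 2"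
    using c1[unfolded continuous_at_eps_delta, rule_format, of "e / 2"] assms conv_zero by auto
  obtain d2 where d2: "d2 > 0" "\<And>x. norm x < d2 \<Longrightarrow> \<bar>S2.conv x\<bar> < e / 2"
    using c2[unfolded continuous_at_eps_delta, rule_format, of "e / 2"] assms conv_zero by auto
  \<comment> \<open>\<open>C * \<rho>\<close> will bound the two gradients: at most
    \<open>\<rho>\<close> from the slope, \<open>2 * \<kappa> * \<rho>\<close> from
    \<open>\<kappa> *\<^sub>R (x - y)\<close>, and \<open>2 * \<rho>\<close> from the strict
    penalty.\<close>
  define C where "C = 3 + 2 * \<kappa>"
  have C: "C > 0" using \<kappa>_pos by (simp add: C_def)
  have "\<forall>\<^sub>F \<rho> in at_right 0. \<rho> < d1" "\<forall>\<^sub>F \<rho> in at_right 0. \<rho> < d2"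
    "\<forall>\<^sub>F \<rho> in at_right 0. C * \<rho> < e" "\<forall>\<^sub>F \<rho> in at_right 0. \<rho> + C * \<rho> / \<kappa> < e"
    "\<forall>\<^sub>F \<rho> in at_right 0. \<kappa> / 2 * (C * \<rho> / \<kappa>)\<^sup>2 < e / 2"
    using d1 d2 assms \<kappa>_pos by (auto intro!: order_tendstoD(2)[where y = 0] tendsto_eq_intros)
  moreover have "\<forall>\<^sub>F \<rho> in at_right 0. 0 < (\<rho>::real)"
    by (simp add: eventually_at_right_less)
  ultimately have "\<forall>\<^sub>F \<rho> in at_right 0. 0 < \<rho> \<and> \<rho> < d1 \<and> \<rho> < d2 \<and> C * \<rho> < e \<and> \<rho> + C * \<rho> / \<kappa> < e \<and> \<kappa> / 2 * (C * \<rho> / \<kappa>)\<^sup>2 < e / 2"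
    by eventually_elim simp
  then obtain \<rho> where \<rho>: "0 < \<rho>" "\<rho> < d1" "\<rho> < d2" "C * \<rho> < e" "\<rho> + C * \<rho> / \<kappa> < e" "\<kappa> / 2 * (C * \<rho> / \<kappa>)\<^sup>2 < e / 2"
    using eventually_happens'[OF trivial_limit_at_right_real] by blast
  \<comment> \<open>Slopes of norm at most \<open>\<eta> * \<rho>\<close> place the contact point
    within \<open>\<rho>\<close> of the origin.\<close>
  have "\<eta> * \<rho> > 0" using \<eta> \<rho> by simp
  have \<eta>\<rho>: "\<eta> * \<rho> / \<eta> = \<rho>" "\<eta> * \<rho> \<le> \<rho>"
    using \<eta> \<rho> by (auto simp: mult_le_cancel_right1)
  obtain x y q1 q2 A1 A2 where xy: "norm x \<le> \<rho>" "norm y \<le> \<rho>" and q: "norm q1 \<le> \<eta> * \<rho>" "norm q2 \<le> \<eta> * \<rho>"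
    and con: "\<And>z. penalty \<eta> z \<le> penalty \<eta> (x, y) + (q1, q2) \<bullet> (z - (x, y))"
    and p: "\<kappa> *\<^sub>R (S1.prox x - x) = q1 + \<kappa> *\<^sub>R (x - y) + (2 * \<eta>) *\<^sub>R x"
    and s: "\<kappa> *\<^sub>R (S2.prox y - y) = q2 - \<kappa> *\<^sub>R (x - y) + (2 * \<eta>) *\<^sub>R y"
    and A1: "second_order S1.W x (\<kappa> *\<^sub>R S1.prox x) A1" and A2: "second_order S2.W y (\<kappa> *\<^sub>R S2.prox y) A2"
    by (rule expansions_at_contact[OF \<eta>(1) \<open>\<eta> * \<rho> > 0\<close>, unfolded \<eta>\<rho>(1)]) (rule that)
  define P where "P = \<kappa> *\<^sub>R (S1.prox x - x)"
  define S where "S = \<kappa> *\<^sub>R (S2.prox y - y)"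
  define X where "X = (\<lambda>v. A1 v - \<kappa> *\<^sub>R v)"
  define Y where "Y = (\<lambda>v. A2 v - \<kappa> *\<^sub>R v)"
  note J1 = S1.conv_expansion[OF A1, folded X_def P_def]
  have Xh: "A1 h - \<kappa> *\<^sub>R h = X h" "A2 h - \<kappa> *\<^sub>R h = Y h" for h
    by (simp_all add: X_def Y_def)
  note J2 = S2.conv_expansion[OF A2, folded Y_def S_def]
  have bnd: "norm (q + \<kappa> *\<^sub>R d + (2 * \<eta>) *\<^sub>R a) \<le> C * \<rho>"
    if "norm q \<le> \<eta> * \<rho>" "norm d \<le> 2 * \<rho>" "norm a \<le> \<rho>" for q d a :: 'a
  proof -
    have "norm (q + \<kappa> *\<^sub>R d + (2 * \<eta>) *\<^sub>R a) \<le> norm q + \<kappa> * norm d + 2 * \<eta> * norm a"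
      using norm_triangle_ineq[of "q + \<kappa> *\<^sub>R d" "(2 * \<eta>) *\<^sub>R a"] norm_triangle_ineq[of q "\<kappa> *\<^sub>R d"] \<kappa>_pos \<eta> by simp
    also have "\<dots> \<le> \<rho> + \<kappa> * (2 * \<rho>) + 2 * \<rho>"
      using that \<eta>\<rho>(2) \<kappa>_pos \<eta> mult_mono[of \<eta> 1 "norm a" \<rho>] by (intro add_mono mult_left_mono) auto
    finally show ?thesis
      by (simp add: C_def algebra_simps)
  qed
  have dxy: "norm (x - y) \<le> 2 * \<rho>" "norm (y - x) \<le> 2 * \<rho>"
    using xy norm_triangle_ineq4[of x y] by (auto simp: norm_minus_commute)
  have nP: "norm P \<le> C * \<rho>"
    unfolding P_def p using bnd[OF q(1) dxy(1) xy(1)] .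
  have nS: "norm S \<le> C * \<rho>"
    using bnd[OF q(2) dxy(2) xy(2)] unfolding S_def s by (simp add: scaleR_diff_right algebra_simps)
  have near: "norm (x' - x) \<le> C * \<rho> / \<kappa>" "norm x' < e" "\<kappa> / 2 * (norm (x - x'))\<^sup>2 < e / 2"
    if "norm (\<kappa> *\<^sub>R (x' - x)) \<le> C * \<rho>" "norm x \<le> \<rho>" for x x' :: 'a
  proof -
    show 1: "norm (x' - x) \<le> C * \<rho> / \<kappa>"
    proof -
      have "\<kappa> * norm (x' - x) \<le> C * \<rho>"
        using that(1) \<kappa>_pos by (metis norm_scaleR abs_of_pos)
      then show ?thesis
        using \<kappa>_pos by (simp add: pos_le_divide_eq mult.commute)
    qed
    show "norm x' < e"
      using norm_triangle_sub[of x' x] 1 that(2) \<rho>(5) by linarith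
    have "\<kappa> / 2 * (norm (x - x'))\<^sup>2 \<le> \<kappa> / 2 * (C * \<rho> / \<kappa>)\<^sup>2"
      using 1 \<kappa>_pos by (intro mult_left_mono power_mono) (auto simp: norm_minus_commute)
    then show "\<kappa> / 2 * (norm (x - x'))\<^sup>2 < e / 2"
      using \<rho>(6) by linarith
  qed
  note near1 = near[OF nP[unfolded P_def] xy(1)] and near2 = near[OF nS[unfolded S_def] xy(2)]
  have small: "\<bar>a\<bar> < e" if "\<bar>a - b\<bar> < e / 2" "0 \<le> b" "b < e / 2" for a b :: real
    using that by linarith
  have nn: "0 \<le> \<kappa> / 2 * (norm a)\<^sup>2" for a :: 'a
    using \<kappa>_pos by simp
  have ue: "\<bar>u (S1.prox x)\<bar> < e"
    by (rule small[OF _ nn near1(3)]) (use d1(2)[of x] xy(1) \<rho>(2) in \<open>simp_all add: S1.conv_def\<close>)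
  have ve: "\<bar>v (S2.prox y)\<bar> < e"
    by (rule small[OF _ nn near2(3)]) (use d2(2)[of y] xy(2) \<rho>(3) in \<open>simp_all add: S2.conv_def\<close>)
  have quad: "h \<bullet> X h + k \<bullet> Y k \<le> \<kappa> * (norm (h - k))\<^sup>2 + e * ((norm h)\<^sup>2 + (norm k)\<^sup>2)" for h k
  proof -
    \<comment> \<open>Twice the second order defect in the contact inequality. The first order terms
      cancel by the gradient equations, and scaling removes the remainder \<open>e'\<close>.\<close>
    define Q where "Q = (\<lambda>d. \<kappa> * (norm (fst d - snd d))\<^sup>2 + 2 * \<eta> * (norm d)\<^sup>2 - fst d \<bullet> X (fst d) - snd d \<bullet> Y (snd d))"
    have lX: "linear X" and lY: "linear Y"
      using J1(1) J2(1) by (auto simp: upper_jet_def)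
    have "0 \<le> Q (h, k)"
    proof (rule quadratic_nonneg_local[of Q])
      fix t :: real and d :: "'a \<times> 'a"
      have "(norm (t *\<^sub>R fst d - t *\<^sub>R snd d))\<^sup>2 = t\<^sup>2 * (norm (fst d - snd d))\<^sup>2"
        by (simp add: power_mult_distrib flip: scaleR_diff_right)
      then show "Q (t *\<^sub>R d) = t\<^sup>2 * Q d"
        by (simp add: Q_def linear_scale[OF lX] linear_scale[OF lY] power2_eq_square algebra_simps)
    next
      fix e' :: real assume "e' > 0"
      then have "e' / 2 > 0" by simp
      obtain \<tau>1 \<tau>2 where \<tau>1: "\<tau>1 > 0" "\<And>h. norm h < \<tau>1 \<Longrightarrow>
        \<bar>S1.conv (x + h) - S1.conv x - P \<bullet> h - h \<bullet> X h / 2\<bar> \<le> e' / 2 * (norm h)\<^sup>2"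
        and \<tau>2: "\<tau>2 > 0" "\<And>h. norm h < \<tau>2 \<Longrightarrow>
        \<bar>S2.conv (y + h) - S2.conv y - S \<bullet> h - h \<bullet> Y h / 2\<bar> \<le> e' / 2 * (norm h)\<^sup>2"
        using second_orderD(3)[OF J1(3) \<open>e' / 2 > 0\<close>] second_orderD(3)[OF J2(3) \<open>e' / 2 > 0\<close>] by blast
      have "- e' * (norm d)\<^sup>2 \<le> Q d" if d: "norm d < min \<tau>1 \<tau>2" for d
      proof -
        obtain a b where ab: "d = (a, b)" by (cases d)
        have nab: "norm a < \<tau>1" "norm b < \<tau>2"
          using d ab norm_fst_le[of a b] norm_snd_le[of b a] by auto
        have pen: "penalty \<eta> (x + a, y + b) \<le> penalty \<eta> (x, y) + q1 \<bullet> a + q2 \<bullet> b"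
          using con[of "(x + a, y + b)"] by simp
        have e2: "(norm (x + a - (y + b)))\<^sup>2 = (norm (x - y))\<^sup>2 + 2 * ((x - y) \<bullet> a) - 2 * ((x - y) \<bullet> b) + (norm (a - b))\<^sup>2"
          using norm_sq_add[of "x - y" "a - b"] by (simp add: inner_diff_right algebra_simps)
        have e3: "(norm (x + a))\<^sup>2 + (norm (y + b))\<^sup>2 = (norm x)\<^sup>2 + (norm y)\<^sup>2 + 2 * (x \<bullet> a) + 2 * (y \<bullet> b) + (norm a)\<^sup>2 + (norm b)\<^sup>2"
          by (simp add: norm_sq_add)
        have 1: "S1.conv (x + a) + S2.conv (y + b) - \<kappa> * ((x - y) \<bullet> a) + \<kappa> * ((x - y) \<bullet> b) - \<kappa> / 2 * (norm (a - b))\<^sup>2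
            - 2 * \<eta> * (x \<bullet> a) - 2 * \<eta> * (y \<bullet> b) - \<eta> * ((norm a)\<^sup>2 + (norm b)\<^sup>2)
            \<le> S1.conv x + S2.conv y + q1 \<bullet> a + q2 \<bullet> b"
          using pen unfolding penalty_def norm_prod_sq fst_conv snd_conv e2 e3 by (simp add: algebra_simps)
        have 2: "P \<bullet> a = q1 \<bullet> a + \<kappa> * ((x - y) \<bullet> a) + 2 * \<eta> * (x \<bullet> a)"
          unfolding P_def p by (simp add: inner_add_left)
        have 3: "S \<bullet> b = q2 \<bullet> b - \<kappa> * ((x - y) \<bullet> b) + 2 * \<eta> * (y \<bullet> b)"
          unfolding S_def s by (simp only: inner_add_left inner_diff_left[of q2] inner_scaleR_left)
        have 4: "Q d = \<kappa> * (norm (a - b))\<^sup>2 + 2 * \<eta> * ((norm a)\<^sup>2 + (norm b)\<^sup>2) - a \<bullet> X a - b \<bullet> Y b"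
          by (simp add: Q_def ab norm_prod_sq)
        have 5: "e' * (norm d)\<^sup>2 = e' * (norm a)\<^sup>2 + e' * (norm b)\<^sup>2"
          by (simp add: ab norm_prod_sq distrib_left)
        show ?thesis
          using 1 2 3 4 5 \<tau>1(2)[OF nab(1)] \<tau>2(2)[OF nab(2)] by (simp add: abs_le_iff field_simps)
      qed
      then show "\<exists>\<tau>>0. \<forall>h. norm h < \<tau> \<longrightarrow> - e' * (norm h)\<^sup>2 \<le> Q h"
        using \<tau>1(1) \<tau>2(1) by (intro exI[of _ "min \<tau>1 \<tau>2"]) simp
    qed
    moreover have "2 * \<eta> * ((norm h)\<^sup>2 + (norm k)\<^sup>2) \<le> e * ((norm h)\<^sup>2 + (norm k)\<^sup>2)"
      using \<eta>(3) by (intro mult_right_mono) auto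
    ultimately show ?thesis
      by (simp add: Q_def norm_prod_sq)
  qed
  show ?thesis
    using near1(2) near2(2) nP nS \<rho>(4) ue ve J1(1) J2(1) J1(2)[unfolded Xh] J2(2)[unfolded Xh] quad
    by (intro exI[of _ "S1.prox x"] exI[of _ "S2.prox y"] exI[of _ P] exI[of _ S] exI[of _ X] exI[of _ Y]) auto
qed

end

section \<open>Finite signed measures\<close>

lemma sval_sums: "range A \<subseteq> sets borel \<Longrightarrow> disjoint_family A \<Longrightarrow> (\<lambda>i. sval \<nu> (A i)) sums sval \<nu> (\<Union>i. A i)"
  using sval[of \<nu>] by auto

lemma sval_empty [simp]: "sval \<nu> {} = 0"
proof -
  have "(\<lambda>i::nat. sval \<nu> {}) sums sval \<nu> (\<Union>i::nat. {})"
    by (rule sval_sums) (auto simp: disjoint_family_on_def)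
  then have "summable (\<lambda>i::nat. sval \<nu> {})"
    by (rule sums_summable)
  then show ?thesis
    using summable_LIMSEQ_zero LIMSEQ_const_iff by metis
qed

lemma sval_Un:
  assumes "A \<in> sets borel" "B \<in> sets borel" "A \<inter> B = {}"
  shows "sval \<nu> (A \<union> B) = sval \<nu> A + sval \<nu> B"
proof -
  have "(\<lambda>i. sval \<nu> (binaryset A B i)) sums sval \<nu> (\<Union>i. binaryset A B i)"
    using assms by (intro sval_sums) (auto simp: range_binaryset_eq disjoint_family_on_def binaryset_def)
  moreover have "(\<lambda>i. sval \<nu> (binaryset A B i)) sums (sval \<nu> A + sval \<nu> B)"
    by (rule binaryset_sums) simp
  ultimately show ?thesis
    by (simp add: UN_binaryset_eq sums_iff)
qed

lemma sval_Diff: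
  assumes "A \<in> sets borel" "B \<in> sets borel" "B \<subseteq> A"
  shows "sval \<nu> (A - B) = sval \<nu> A - sval \<nu> B"
proof -
  have "A = B \<union> (A - B)" using assms(3) by auto
  then have "sval \<nu> A = sval \<nu> B + sval \<nu> (A - B)"
    using sval_Un[of B "A - B" \<nu>] assms by auto
  then show ?thesis by simp
qed

lemma sval_uminus [simp]: "sval (- \<nu>) A = - sval \<nu> A"
  and sval_plus [simp]: "sval (\<mu> + \<nu>) A = sval \<mu> A + sval \<nu> A"
  and sval_minus [simp]: "sval (\<mu> - \<nu>) A = sval \<mu> A - sval \<nu> A"
  and sval_scaleR [simp]: "sval (r *\<^sub>R \<nu>) A = r * sval \<nu> A"
  and sval_zero [simp]: "sval 0 A = 0"
  by (simp_all add: uminus_signed_measure.rep_eq plus_signed_measure.rep_eq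
      minus_signed_measure.rep_eq scaleR_signed_measure.rep_eq zero_signed_measure.rep_eq)

text \<open>The bare set function behind \<open>pos_variation\<close>. \<open>measure_of\<close>
  takes it over only after countable additivity is established, and would otherwise yield the zero
  measure.\<close>

definition pos_var :: "'a::topological_space signed_measure \<Rightarrow> 'a set \<Rightarrow> ennreal" where
  "pos_var \<nu> A = (SUP B\<in>{B \<in> sets borel. B \<subseteq> A}. ennreal (sval \<nu> B))"

lemma pos_var_upper: "B \<in> sets borel \<Longrightarrow> B \<subseteq> A \<Longrightarrow> ennreal (sval \<nu> B) \<le> pos_var \<nu> A"
  unfolding pos_var_def by (intro SUP_upper) auto

lemma pos_var_mono: "A \<subseteq> A' \<Longrightarrow> pos_var \<nu> A \<le> pos_var \<nu> A'"
  unfolding pos_var_def by (intro SUP_subset_mono) auto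

text \<open>Subsets of two disjoint sets can be united. If one of the two values is negative,
  \<open>ennreal\<close> turns it into 0 and the other value alone gives the bound.\<close>

lemma pos_var_superadd:
  assumes "A \<in> sets borel" "A' \<in> sets borel" "A \<inter> A' = {}"
  shows "pos_var \<nu> A + pos_var \<nu> A' \<le> pos_var \<nu> (A \<union> A')"
proof -
  have le: "ennreal (sval \<nu> B) + ennreal (sval \<nu> B') \<le> pos_var \<nu> (A \<union> A')"
    if B: "B \<in> sets borel" "B \<subseteq> A" "B' \<in> sets borel" "B' \<subseteq> A'" for B B'
  proof -
    have "sval \<nu> (B \<union> B') = sval \<nu> B + sval \<nu> B'"
      using B assms(3) by (intro sval_Un) auto
    moreover have "ennreal (sval \<nu> (B \<union> B')) \<le> pos_var \<nu> (A \<union> A')" "ennreal (sval \<nu> B) \<le> pos_var \<nu> (A \<union> A')"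
      "ennreal (sval \<nu> B') \<le> pos_var \<nu> (A \<union> A')"
      using B by (auto intro!: pos_var_upper)
    ultimately show ?thesis
      by (cases "0 \<le> sval \<nu> B"; cases "0 \<le> sval \<nu> B'") (auto simp: ennreal_neg ennreal_plus)
  qed
  have "pos_var \<nu> A + pos_var \<nu> A' = (SUP B\<in>{B \<in> sets borel. B \<subseteq> A}. ennreal (sval \<nu> B) + pos_var \<nu> A')"
    unfolding pos_var_def[of \<nu> A] by (rule ennreal_SUP_add_left[symmetric]) auto
  also have "\<dots> \<le> pos_var \<nu> (A \<union> A')"
  proof (rule SUP_least)
    fix B assume B: "B \<in> {B \<in> sets borel. B \<subseteq> A}"
    have "ennreal (sval \<nu> B) + pos_var \<nu> A' = (SUP B'\<in>{B \<in> sets borel. B \<subseteq> A'}. ennreal (sval \<nu> B) + ennreal (sval \<nu> B'))"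
      unfolding pos_var_def[of \<nu> A'] by (rule ennreal_SUP_add_right) auto
    also have "\<dots> \<le> pos_var \<nu> (A \<union> A')"
      using B by (intro SUP_least le) auto
    finally show "ennreal (sval \<nu> B) + pos_var \<nu> A' \<le> pos_var \<nu> (A \<union> A')" .
  qed
  finally show ?thesis .
qed

text \<open>Superadditivity on finite unions gives one inequality. For the other, a subset
  \<open>B\<close> of the union is cut along the \<open>A i\<close>, and each piece is estimated by
  its positive part.\<close>

lemma countably_additive_pos_var: "countably_additive (sets borel) (pos_var \<nu>)"
  unfolding countably_additive_def
proof (intro allI impI)
  fix A :: "nat \<Rightarrow> 'a set" assume A: "range A \<subseteq> sets borel" "disjoint_family A" "(\<Union>i. A i) \<in> sets borel"
  show "(\<Sum>i. pos_var \<nu> (A i)) = pos_var \<nu> (\<Union>i. A i)"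
  proof (rule antisym)
    have "(\<Sum>i<n. pos_var \<nu> (A i)) \<le> pos_var \<nu> (\<Union>i<n. A i)" for n
    proof (induction n)
      case (Suc n)
      have "(\<Sum>i<Suc n. pos_var \<nu> (A i)) \<le> pos_var \<nu> (\<Union>i<n. A i) + pos_var \<nu> (A n)"
        using Suc by (simp add: add_right_mono)
      also have "\<dots> \<le> pos_var \<nu> ((\<Union>i<n. A i) \<union> A n)"
      proof (rule pos_var_superadd)
        have "A i \<inter> A n = {}" if "i < n" for i
          using A(2)[unfolded disjoint_family_on_def, rule_format, of i n] that by simp
        then show "(\<Union>i<n. A i) \<inter> A n = {}"
          by auto
      qed (use A(1) in auto)
      also have "(\<Union>i<n. A i) \<union> A n = (\<Union>i<Suc n. A i)"
        by (auto simp: less_Suc_eq)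
      finally show ?case .
    qed (simp add: pos_var_def)
    then have "(\<Sum>i<n. pos_var \<nu> (A i)) \<le> pos_var \<nu> (\<Union>i. A i)" for n
      by (rule order_trans) (auto intro!: pos_var_mono)
    then show "(\<Sum>i. pos_var \<nu> (A i)) \<le> pos_var \<nu> (\<Union>i. A i)"
      by (simp add: suminf_eq_SUP SUP_least)
  next
    show "pos_var \<nu> (\<Union>i. A i) \<le> (\<Sum>i. pos_var \<nu> (A i))"
      unfolding pos_var_def[of \<nu> "\<Union>i. A i"]
    proof (rule SUP_least)
      fix B assume B: "B \<in> {B \<in> sets borel. B \<subseteq> (\<Union>i. A i)}"
      have "(\<lambda>i. sval \<nu> (B \<inter> A i)) sums sval \<nu> (\<Union>i. B \<inter> A i)"
        using A B by (intro sval_sums) (auto simp: disjoint_family_on_def image_subset_iff)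
      moreover have "(\<Union>i. B \<inter> A i) = B"
        using B by auto
      ultimately have "(\<lambda>n. \<Sum>i<n. sval \<nu> (B \<inter> A i)) \<longlonglongrightarrow> sval \<nu> B"
        by (simp add: sums_def)
      then have "(\<lambda>n. ennreal (\<Sum>i<n. sval \<nu> (B \<inter> A i))) \<longlonglongrightarrow> ennreal (sval \<nu> B)"
        by (rule tendsto_ennrealI)
      moreover have "ennreal (\<Sum>i<n. sval \<nu> (B \<inter> A i)) \<le> (\<Sum>i. pos_var \<nu> (A i))" for n
      proof -
        have "(\<Sum>i<n. sval \<nu> (B \<inter> A i)) \<le> (\<Sum>i<n. max 0 (sval \<nu> (B \<inter> A i)))"
          by (intro sum_mono) auto
        then have "ennreal (\<Sum>i<n. sval \<nu> (B \<inter> A i)) \<le> ennreal (\<Sum>i<n. max 0 (sval \<nu> (B \<inter> A i)))"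
          by (rule ennreal_leI)
        also have "\<dots> = (\<Sum>i<n. ennreal (max 0 (sval \<nu> (B \<inter> A i))))"
          by (rule sum_ennreal[symmetric]) auto
        also have "\<dots> \<le> (\<Sum>i<n. pos_var \<nu> (A i))"
          using A(1) B by (intro sum_mono) (auto simp: max_def image_subset_iff intro!: pos_var_upper)
        also have "\<dots> \<le> (\<Sum>i. pos_var \<nu> (A i))"
          by (rule sum_le_suminf) auto
        finally show ?thesis .
      qed
      ultimately show "ennreal (sval \<nu> B) \<le> (\<Sum>i. pos_var \<nu> (A i))"
        by (intro LIMSEQ_le_const2[where X = "\<lambda>n. ennreal (\<Sum>i<n. sval \<nu> (B \<inter> A i))"]) auto
    qed
  qed
qed

lemma space_pos_variation [simp]: "space (pos_variation \<nu>) = UNIV"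
  by (simp add: pos_variation_def)

lemma sets_pos_variation [simp, measurable_cong]: "sets (pos_variation \<nu>) = sets borel"
  by (simp add: pos_variation_def) (metis sets.sigma_sets_eq space_borel)

lemma emeasure_pos_variation:
  assumes "A \<in> sets borel"
  shows "emeasure (pos_variation \<nu>) A = pos_var \<nu> A"
proof (rule emeasure_measure_of)
  show "pos_variation \<nu> = measure_of UNIV (sets borel) (pos_var \<nu>)"
    by (simp add: pos_variation_def pos_var_def[abs_def])
  show "positive (sets (pos_variation \<nu>)) (pos_var \<nu>)"
    by (simp add: positive_def pos_var_def)
qed (use assms in \<open>simp_all add: countably_additive_pos_var\<close>)

lemma pos_var_split:
  assumes "X \<in> sets borel" "A \<in> sets borel" "A \<subseteq> X"
  shows "pos_var \<nu> X = pos_var \<nu> A + pos_var \<nu> (X - A)"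
proof -
  have "emeasure (pos_variation \<nu>) A + emeasure (pos_variation \<nu>) (X - A) = emeasure (pos_variation \<nu>) (A \<union> (X - A))"
    using assms by (intro plus_emeasure) auto
  moreover have "A \<union> (X - A) = X" using assms(3) by auto
  ultimately show ?thesis
    using assms by (simp add: emeasure_pos_variation)
qed

text \<open>The margin \<open>1 + \<bar>sval \<nu> X\<bar>\<close> makes both \<open>A\<close> and
  \<open>X - A\<close> have a value of modulus at least 1. Whichever of them inherits the infinite
  variation is kept, and the other is split off.\<close>

lemma pos_var_infinite_step:
  assumes X: "X \<in> sets borel" "pos_var \<nu> X = \<infinity>"
  shows "\<exists>Y. Y \<in> sets borel \<and> pos_var \<nu> Y = \<infinity> \<and> Y \<subseteq> X \<and> 1 \<le> \<bar>sval \<nu> (X - Y)\<bar>"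
proof -
  have "ennreal (1 + \<bar>sval \<nu> X\<bar>) < pos_var \<nu> X"
    using X(2) by simp
  then obtain A where "A \<in> {B \<in> sets borel. B \<subseteq> X}" and big: "ennreal (1 + \<bar>sval \<nu> X\<bar>) < ennreal (sval \<nu> A)"
    unfolding pos_var_def less_SUP_iff by (elim bexE)
  then have A: "A \<in> sets borel" "A \<subseteq> X"
    by simp_all
  have big: "1 + \<bar>sval \<nu> X\<bar> < sval \<nu> A"
    using big by (subst (asm) ennreal_less_iff) auto
  have D: "sval \<nu> (X - A) = sval \<nu> X - sval \<nu> A" "X - (X - A) = A"
    using A X by (auto intro: sval_Diff)
  have "pos_var \<nu> A = \<infinity> \<or> pos_var \<nu> (X - A) = \<infinity>"
    using pos_var_split[OF X(1) A(1,2), of \<nu>] X(2) by (metis ennreal_add_eq_top infinity_ennreal_def)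
  then show ?thesis
  proof
    assume "pos_var \<nu> A = \<infinity>"
    then show ?thesis
      using A D big by (intro exI[of _ A]) auto
  next
    assume "pos_var \<nu> (X - A) = \<infinity>"
    then show ?thesis
      using A D big X by (intro exI[of _ "X - A"]) auto
  qed
qed

text \<open>Otherwise repeated splitting produces disjoint sets with values of modulus at least 1,
  whose series would have to converge by countable additivity.\<close>

lemma pos_var_finite: "pos_var \<nu> UNIV < \<infinity>"
proof (rule ccontr)
  assume "\<not> pos_var \<nu> UNIV < \<infinity>"
  then have inf: "pos_var \<nu> UNIV = \<infinity>"
    by (simp add: less_top[symmetric])
  obtain Y where Y: "\<And>n. Y n \<in> sets borel \<and> pos_var \<nu> (Y n) = \<infinity>" "\<And>n. Y (Suc n) \<subseteq> Y n \<and> 1 \<le> \<bar>sval \<nu> (Y n - Y (Suc n))\<bar>"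
  proof (rule dependent_nat_choice[of "\<lambda>_ Y. Y \<in> sets borel \<and> pos_var \<nu> Y = \<infinity>" "\<lambda>_ X Y. Y \<subseteq> X \<and> 1 \<le> \<bar>sval \<nu> (X - Y)\<bar>", THEN exE])
    show "\<exists>Y. Y \<in> sets borel \<and> pos_var \<nu> Y = \<infinity>"
      using inf by (intro exI[of _ UNIV]) auto
  next
    fix X :: "'a set" and n :: nat assume "X \<in> sets borel \<and> pos_var \<nu> X = \<infinity>"
    then show "\<exists>Y. (Y \<in> sets borel \<and> pos_var \<nu> Y = \<infinity>) \<and> Y \<subseteq> X \<and> 1 \<le> \<bar>sval \<nu> (X - Y)\<bar>"
      using pos_var_infinite_step[of X \<nu>] by blast
  qed (use that in blast)
  define D where "D = (\<lambda>n. Y n - Y (Suc n))"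
  have "disjoint_family (\<lambda>n. - Y (Suc n) - - Y n)"
    using Y(2) by (intro disjoint_family_Suc) auto
  moreover have "(\<lambda>n. - Y (Suc n) - - Y n) = D"
    by (auto simp: D_def fun_eq_iff)
  ultimately have "(\<lambda>i. sval \<nu> (D i)) sums sval \<nu> (\<Union>i. D i)"
    using Y(1) by (intro sval_sums) (auto simp: D_def)
  then have "(\<lambda>i. sval \<nu> (D i)) \<longlonglongrightarrow> 0"
    by (intro summable_LIMSEQ_zero sums_summable)
  then have "\<forall>\<^sub>F i in sequentially. dist (sval \<nu> (D i)) 0 < 1"
    by (rule tendstoD) simp
  then obtain i where "\<bar>sval \<nu> (D i)\<bar> < 1"
    by (auto simp: eventually_sequentially)
  then show False
    using Y(2)[of i] by (simp add: D_def)
qed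

lemma finite_measure_pos_variation: "finite_measure (pos_variation \<nu>)"
  using pos_var_finite[of \<nu>] by (intro finite_measureI) (simp add: emeasure_pos_variation)

text \<open>\<open>sval \<nu> A - sval \<nu> B\<close> is the value of \<open>A - B\<close> and
  hence at most the positive variation of \<open>A\<close>. For \<open>- \<nu>\<close>, with the
  supremum over \<open>B\<close>, this is one inequality; exchanging the signs gives the other. No
  Hahn set is constructed.\<close>

lemma jordan_decomposition:
  assumes "A \<in> sets borel"
  shows "sval \<nu> A = measure (pos_variation \<nu>) A - measure (pos_variation (- \<nu>)) A"
proof -
  interpret p: finite_measure "pos_variation \<nu>" by (rule finite_measure_pos_variation)
  interpret n: finite_measure "pos_variation (- \<nu>)" by (rule finite_measure_pos_variation)
  let ?p = "measure (pos_variation \<nu>) A" and ?n = "measure (pos_variation (- \<nu>)) A"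
  have pv: "pos_var \<nu> A = ennreal ?p" "pos_var (- \<nu>) A = ennreal ?n"
    using assms by (simp_all add: p.emeasure_eq_measure n.emeasure_eq_measure flip: emeasure_pos_variation)
  have bound: "sval \<mu> A - sval \<mu> B \<le> measure (pos_variation \<mu>) A"
    if "B \<in> sets borel" "B \<subseteq> A" for \<mu> :: "'a signed_measure" and B
  proof -
    interpret m: finite_measure "pos_variation \<mu>" by (rule finite_measure_pos_variation)
    have "ennreal (sval \<mu> (A - B)) \<le> ennreal (measure (pos_variation \<mu>) A)"
      using assms that pos_var_upper[of "A - B" A \<mu>] by (simp add: m.emeasure_eq_measure flip: emeasure_pos_variation)
    then show ?thesis
      using assms that sval_Diff[of A B \<mu>] measure_nonneg[of "pos_variation \<mu>" A] by (auto simp: ennreal_le_iff2)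
  qed
  have le: "measure (pos_variation \<mu>) A \<le> sval \<mu> A + measure (pos_variation (- \<mu>)) A" for \<mu> :: "'a signed_measure"
  proof -
    interpret m: finite_measure "pos_variation \<mu>" by (rule finite_measure_pos_variation)
    have *: "sval \<mu> B \<le> sval \<mu> A + measure (pos_variation (- \<mu>)) A" if "B \<in> sets borel" "B \<subseteq> A" for B
      using bound[OF that, of "- \<mu>"] by simp
    have "pos_var \<mu> A \<le> ennreal (sval \<mu> A + measure (pos_variation (- \<mu>)) A)"
      unfolding pos_var_def using * by (intro SUP_least ennreal_leI) auto
    then show ?thesis
      using *[of "{}"] assms by (simp add: m.emeasure_eq_measure flip: emeasure_pos_variation)
  qed
  show ?thesis
    using le[of \<nu>] le[of "- \<nu>"] by simp
qed

text \<open>Jordan parts do not depend linearly on the measure, only their differences do. Linearity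
  is therefore stated with the negative parts moved to the other side, where only sums of
  nonnegative integrals occur. Three measures per side correspond to the sum, its first summand and
  its scaled second summand.\<close>

lemma nn_integral_balance:
  fixes r :: ennreal
  assumes sets: "sets a = sets B" "sets b = sets B" "sets c = sets B" "sets a' = sets B" "sets b' = sets B" "sets c' = sets B"
    and eq: "\<And>A. A \<in> sets B \<Longrightarrow> emeasure a A + emeasure b A + r * emeasure c A = emeasure a' A + emeasure b' A + r * emeasure c' A"
    and g: "g \<in> borel_measurable B"
  shows "(\<integral>\<^sup>+x. g x \<partial>a) + (\<integral>\<^sup>+x. g x \<partial>b) + r * (\<integral>\<^sup>+x. g x \<partial>c) =
    (\<integral>\<^sup>+x. g x \<partial>a') + (\<integral>\<^sup>+x. g x \<partial>b') + r * (\<integral>\<^sup>+x. g x \<partial>c')"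
  using g
proof (induction g rule: borel_measurable_induct)
  case (cong f g)
  then have "(\<integral>\<^sup>+x. f x \<partial>m) = (\<integral>\<^sup>+x. g x \<partial>m)" if "sets m = sets B" for m
    using that by (intro nn_integral_cong) (simp add: sets_eq_imp_space_eq[OF that])
  then show ?case
    using cong sets by simp
next
  case (set A)
  then show ?case
    using eq sets by simp
next
  case (mult u c0)
  have "(\<integral>\<^sup>+x. c0 * u x \<partial>m) = c0 * (\<integral>\<^sup>+x. u x \<partial>m)" if "sets m = sets B" for m
    using mult(2) that by (intro nn_integral_cmult) (simp cong: measurable_cong_sets)
  then have *: "(\<integral>\<^sup>+x. c0 * u x \<partial>m1) + (\<integral>\<^sup>+x. c0 * u x \<partial>m2) + r * (\<integral>\<^sup>+x. c0 * u x \<partial>m3)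
      = c0 * ((\<integral>\<^sup>+x. u x \<partial>m1) + (\<integral>\<^sup>+x. u x \<partial>m2) + r * (\<integral>\<^sup>+x. u x \<partial>m3))"
    if "sets m1 = sets B" "sets m2 = sets B" "sets m3 = sets B" for m1 m2 m3
    using that by (simp add: distrib_left mult.left_commute)
  show ?case
    unfolding *[OF sets(1-3)] *[OF sets(4-6)] mult.IH ..
next
  case (add u v)
  have "(\<integral>\<^sup>+x. v x + u x \<partial>m) = (\<integral>\<^sup>+x. v x \<partial>m) + (\<integral>\<^sup>+x. u x \<partial>m)" if "sets m = sets B" for m
    using add(1,3) that by (intro nn_integral_add) (simp_all cong: measurable_cong_sets)
  then have *: "(\<integral>\<^sup>+x. v x + u x \<partial>m1) + (\<integral>\<^sup>+x. v x + u x \<partial>m2) + r * (\<integral>\<^sup>+x. v x + u x \<partial>m3)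
      = ((\<integral>\<^sup>+x. v x \<partial>m1) + (\<integral>\<^sup>+x. v x \<partial>m2) + r * (\<integral>\<^sup>+x. v x \<partial>m3)) + ((\<integral>\<^sup>+x. u x \<partial>m1) + (\<integral>\<^sup>+x. u x \<partial>m2) + r * (\<integral>\<^sup>+x. u x \<partial>m3))"
    if "sets m1 = sets B" "sets m2 = sets B" "sets m3 = sets B" for m1 m2 m3
    using that by (simp add: distrib_left add_ac)
  show ?case
    unfolding *[OF sets(1-3)] *[OF sets(4-6)] add.IH ..
next
  case (seq U)
  let ?I = "\<lambda>m i. \<integral>\<^sup>+x. U i x \<partial>m"
  have S: "(\<integral>\<^sup>+x. (SUP i. U i) x \<partial>m) = (SUP i. ?I m i)" if "sets m = sets B" for m
    using seq(1,3) that unfolding SUP_apply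
    by (intro nn_integral_monotone_convergence_SUP) (simp_all cong: measurable_cong_sets)
  have inc: "incseq (?I m)" for m
    using seq(3) by (auto simp: incseq_def le_fun_def intro!: nn_integral_mono)
  have *: "(SUP i. ?I m1 i) + (SUP i. ?I m2 i) + r * (SUP i. ?I m3 i) = (SUP i. ?I m1 i + ?I m2 i + r * ?I m3 i)" for m1 m2 m3
  proof -
    have "r * (SUP i. ?I m3 i) = (SUP i. r * ?I m3 i)"
      by (rule SUP_mult_left_ennreal)
    moreover have "incseq (\<lambda>i. ?I m1 i + ?I m2 i)" "incseq (\<lambda>i. r * ?I m3 i)"
      using inc by (auto simp: incseq_def intro!: add_mono mult_left_mono)
    ultimately show ?thesis
      by (simp add: ennreal_SUP_add inc)
  qed
  have "U i \<in> borel_measurable B" for i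
    by (rule seq(1))
  then show ?case
    unfolding S[OF sets(1)] S[OF sets(2)] S[OF sets(3)] S[OF sets(4)] S[OF sets(5)] S[OF sets(6)] *
    using seq by simp
qed

lemma integral_balance:
  assumes fin: "finite_measure a" "finite_measure b" "finite_measure c" "finite_measure a'" "finite_measure b'" "finite_measure c'"
    and sets: "sets a = sets B" "sets b = sets B" "sets c = sets B" "sets a' = sets B" "sets b' = sets B" "sets c' = sets B"
    and "0 \<le> r"
    and eq: "\<And>A. A \<in> sets B \<Longrightarrow> measure a A + measure b A + r * measure c A = measure a' A + measure b' A + r * measure c' A"
    and g: "g \<in> borel_measurable B" "\<And>x. \<bar>g x\<bar> \<le> C"
  shows "(\<integral>x. g x \<partial>a) + (\<integral>x. g x \<partial>b) + r * (\<integral>x. g x \<partial>c) =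
    (\<integral>x. g x \<partial>a') + (\<integral>x. g x \<partial>b') + r * (\<integral>x. g x \<partial>c')"
proof -
  have nonneg: "(\<integral>x. h x \<partial>a) + (\<integral>x. h x \<partial>b) + r * (\<integral>x. h x \<partial>c) =
    (\<integral>x. h x \<partial>a') + (\<integral>x. h x \<partial>b') + r * (\<integral>x. h x \<partial>c')"
    if h: "h \<in> borel_measurable B" "\<And>x. 0 \<le> h x" "\<And>x. \<bar>h x\<bar> \<le> C'" for h C'
  proof -
    have conv: "(\<integral>\<^sup>+x. ennreal (h x) \<partial>m) = ennreal (\<integral>x. h x \<partial>m)" "0 \<le> (\<integral>x. h x \<partial>m)"
      if "finite_measure m" "sets m = sets B" for m
    proof -
      interpret finite_measure m by fact
      have "integrable m h"
        using h(3) h(1) that(2) by (intro integrable_const_bound[of _ C']) (auto cong: measurable_cong_sets)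
      then show "(\<integral>\<^sup>+x. ennreal (h x) \<partial>m) = ennreal (\<integral>x. h x \<partial>m)"
        using h(2) by (intro nn_integral_eq_integral) auto
      show "0 \<le> (\<integral>x. h x \<partial>m)"
        using h(2) by simp
    qed
    have em: "emeasure m A = ennreal (measure m A)" if "finite_measure m" for m :: "'a measure" and A
      using that by (rule finite_measure.emeasure_eq_measure)
    have comb: "ennreal p + ennreal q + ennreal r * ennreal s = ennreal (p + q + r * s)" if "0 \<le> p" "0 \<le> q" "0 \<le> s" for p q s
      using that \<open>0 \<le> r\<close> by (simp add: ennreal_mult' ennreal_plus)
    have "(\<integral>\<^sup>+x. ennreal (h x) \<partial>a) + (\<integral>\<^sup>+x. ennreal (h x) \<partial>b) + ennreal r * (\<integral>\<^sup>+x. ennreal (h x) \<partial>c) =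
      (\<integral>\<^sup>+x. ennreal (h x) \<partial>a') + (\<integral>\<^sup>+x. ennreal (h x) \<partial>b') + ennreal r * (\<integral>\<^sup>+x. ennreal (h x) \<partial>c')"
      by (rule nn_integral_balance[OF sets]) (use h eq in \<open>simp_all add: em fin comb\<close>)
    then have "ennreal ((\<integral>x. h x \<partial>a) + (\<integral>x. h x \<partial>b) + r * (\<integral>x. h x \<partial>c)) =
      ennreal ((\<integral>x. h x \<partial>a') + (\<integral>x. h x \<partial>b') + r * (\<integral>x. h x \<partial>c'))"
      unfolding conv(1)[OF fin(1) sets(1)] conv(1)[OF fin(2) sets(2)] conv(1)[OF fin(3) sets(3)]
        conv(1)[OF fin(4) sets(4)] conv(1)[OF fin(5) sets(5)] conv(1)[OF fin(6) sets(6)]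
        comb[OF conv(2)[OF fin(1) sets(1)] conv(2)[OF fin(2) sets(2)] conv(2)[OF fin(3) sets(3)]]
        comb[OF conv(2)[OF fin(4) sets(4)] conv(2)[OF fin(5) sets(5)] conv(2)[OF fin(6) sets(6)]] .
    then show ?thesis
      using \<open>0 \<le> r\<close> conv(2) fin sets by (subst (asm) ennreal_inj) auto
  qed
  have int: "integrable m g" "integrable m (\<lambda>x. C)" if "finite_measure m" "sets m = sets B" for m
  proof -
    interpret finite_measure m by fact
    show "integrable m g"
      using g that(2) by (intro integrable_const_bound[of _ C]) (auto cong: measurable_cong_sets)
  qed (use that in \<open>simp add: finite_measure.integrable_const\<close>)
  have "0 \<le> C" using g(2) abs_ge_zero order_trans by blast
  \<comment> \<open>Adding the constant \<open>C\<close> reduces the claim to nonnegative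
    integrands; the constant satisfies the same balance and is subtracted afterwards.\<close>
  have low: "0 \<le> g x + C" "\<bar>g x + C\<bar> \<le> 2 * C" for x
    using g(2)[of x] by (auto simp: abs_le_iff)
  have "(\<integral>x. g x + C \<partial>a) + (\<integral>x. g x + C \<partial>b) + r * (\<integral>x. g x + C \<partial>c) =
    (\<integral>x. g x + C \<partial>a') + (\<integral>x. g x + C \<partial>b') + r * (\<integral>x. g x + C \<partial>c')"
    using g(1) low by (intro nonneg[of _ "2 * C"]) auto
  moreover have "(\<integral>x. C \<partial>a) + (\<integral>x. C \<partial>b) + r * (\<integral>x. C \<partial>c) =
    (\<integral>x. C \<partial>a') + (\<integral>x. C \<partial>b') + r * (\<integral>x. C \<partial>c')"
    using \<open>0 \<le> C\<close> by (intro nonneg[of _ C]) auto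
  moreover have "(\<integral>x. g x + C \<partial>m) = (\<integral>x. g x \<partial>m) + (\<integral>x. C \<partial>m)" if "finite_measure m" "sets m = sets B" for m
    using int[OF that] by (rule Bochner_Integration.integral_add)
  ultimately show ?thesis
    using fin sets by (simp add: distrib_left)
qed

section \<open>Linearity and weak continuity of the signed integral\<close>

definition bounded_measurable :: "('a::topological_space \<Rightarrow> real) \<Rightarrow> bool" where
  "bounded_measurable g \<longleftrightarrow> g \<in> borel_measurable borel \<and> (\<exists>C. \<forall>x. \<bar>g x\<bar> \<le> C)"

lemma Cb_bounded_measurable: "g \<in> Cb \<Longrightarrow> bounded_measurable g"
  by (auto simp: Cb_def bounded_measurable_def bounded_iff intro: borel_measurable_continuous_onI)

lemma integrable_pos_variation:
  assumes "bounded_measurable g"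
  shows "integrable (pos_variation \<nu>) g"
proof -
  interpret finite_measure "pos_variation \<nu>" by (rule finite_measure_pos_variation)
  obtain C where "\<And>x. \<bar>g x\<bar> \<le> C" "g \<in> borel_measurable borel"
    using assms by (auto simp: bounded_measurable_def)
  then show ?thesis
    by (intro integrable_const_bound[of _ C]) (auto cong: measurable_cong_sets)
qed

lemma signed_integrable_bounded: "bounded_measurable g \<Longrightarrow> signed_integrable \<nu> g"
  by (simp add: signed_integrable_def integrable_pos_variation)

lemma signed_integral_uminus: "signed_integral (- \<nu>) g = - signed_integral \<nu> g"
  by (simp add: signed_integral_def)

lemma signed_integral_add_scaleR:
  assumes g: "bounded_measurable g"
  shows "signed_integral (\<mu> + r *\<^sub>R \<nu>) g = signed_integral \<mu> g + r * signed_integral \<nu> g"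
proof -
  have nonneg: "signed_integral (\<mu> + r *\<^sub>R \<nu>) g = signed_integral \<mu> g + r * signed_integral \<nu> g" if "0 \<le> r" for r \<nu>
  proof -
    let ?p = "pos_variation :: 'a signed_measure \<Rightarrow> 'a measure"
    obtain C where C: "\<And>x. \<bar>g x\<bar> \<le> C" "g \<in> borel_measurable borel"
      using g by (auto simp: bounded_measurable_def)
    let ?s = "\<mu> + r *\<^sub>R \<nu>"
    have "(\<integral>x. g x \<partial>?p ?s) + (\<integral>x. g x \<partial>?p (- \<mu>)) + r * (\<integral>x. g x \<partial>?p (- \<nu>)) =
      (\<integral>x. g x \<partial>?p (- ?s)) + (\<integral>x. g x \<partial>?p \<mu>) + r * (\<integral>x. g x \<partial>?p \<nu>)"
    proof (rule integral_balance[where B = borel])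
      fix A :: "'a set" assume A: "A \<in> sets borel"
      have "measure (?p ?s) A - measure (?p (- ?s)) A = (measure (?p \<mu>) A - measure (?p (- \<mu>)) A) + r * (measure (?p \<nu>) A - measure (?p (- \<nu>)) A)"
        using jordan_decomposition[OF A, of ?s] jordan_decomposition[OF A, of \<mu>] jordan_decomposition[OF A, of \<nu>] by simp
      then show "measure (?p ?s) A + measure (?p (- \<mu>)) A + r * measure (?p (- \<nu>)) A
          = measure (?p (- ?s)) A + measure (?p \<mu>) A + r * measure (?p \<nu>) A"
        by (simp add: right_diff_distrib)
    qed (use C that in \<open>auto simp: finite_measure_pos_variation\<close>)
    then show ?thesis
      by (simp add: signed_integral_def right_diff_distrib)
  qed
  show ?thesis
  proof (cases "0 \<le> r")
    case False
    then show ?thesis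
      using nonneg[of "- r" "- \<nu>"] by (simp add: signed_integral_uminus)
  qed (rule nonneg)
qed

lemma signed_integral_zero: "bounded_measurable g \<Longrightarrow> signed_integral 0 g = 0"
  using signed_integral_add_scaleR[of g 0 1 0] by simp

lemma signed_integral_scaleR: "bounded_measurable g \<Longrightarrow> signed_integral (r *\<^sub>R \<nu>) g = r * signed_integral \<nu> g"
  using signed_integral_add_scaleR[of g 0 r \<nu>] by (simp add: signed_integral_zero)

lemma signed_integral_add: "bounded_measurable g \<Longrightarrow> signed_integral (\<mu> + \<nu>) g = signed_integral \<mu> g + signed_integral \<nu> g"
  using signed_integral_add_scaleR[of g \<mu> 1 \<nu>] by simp

lemma signed_integral_diff: "bounded_measurable g \<Longrightarrow> signed_integral (\<mu> - \<nu>) g = signed_integral \<mu> g - signed_integral \<nu> g"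
  using signed_integral_add_scaleR[of g \<mu> "-1" \<nu>] by simp

lemma total_variation_nonneg: "0 \<le> total_variation \<nu>"
  by (simp add: total_variation_def)

lemma abs_signed_integral_le:
  assumes g: "g \<in> borel_measurable borel" "\<And>x. \<bar>g x\<bar> \<le> C"
  shows "\<bar>signed_integral \<nu> g\<bar> \<le> total_variation \<nu> * C"
proof -
  have bm: "bounded_measurable g" "bounded_measurable (\<lambda>x. C)"
    using g by (auto simp: bounded_measurable_def)
  have "\<bar>\<integral>x. g x \<partial>pos_variation \<mu>\<bar> \<le> measure (pos_variation \<mu>) UNIV * C" for \<mu> :: "'a signed_measure"
  proof -
    have "\<bar>\<integral>x. g x \<partial>pos_variation \<mu>\<bar> \<le> (\<integral>x. \<bar>g x\<bar> \<partial>pos_variation \<mu>)"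
      by (rule integral_abs_bound)
    also have "\<dots> \<le> (\<integral>x. C \<partial>pos_variation \<mu>)"
      using g(2) bm by (intro integral_mono integrable_abs integrable_pos_variation) auto
    also have "\<dots> = measure (pos_variation \<mu>) UNIV * C"
      by simp
    finally show ?thesis .
  qed
  from this[of \<nu>] this[of "- \<nu>"] show ?thesis
    unfolding signed_integral_def total_variation_def distrib_right by linarith
qed

lemma emeasure_pos_variation_M_plus:
  assumes "\<nu> \<in> M_plus" "A \<in> sets borel"
  shows "emeasure (pos_variation \<nu>) A = ennreal (sval \<nu> A)" "emeasure (pos_variation (- \<nu>)) A = 0"
proof -
  have nn: "0 \<le> sval \<nu> B" for B
    using assms(1) by (simp add: M_plus_def)
  have mono: "sval \<nu> B \<le> sval \<nu> A" if "B \<in> sets borel" "B \<subseteq> A" for B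
    using sval_Diff[OF assms(2) that, of \<nu>] nn[of "A - B"] by simp
  have "pos_var \<nu> A = ennreal (sval \<nu> A)"
    unfolding pos_var_def using assms(2) mono
    by (intro antisym SUP_least SUP_upper) (auto intro: ennreal_leI)
  moreover have "pos_var (- \<nu>) A = 0"
    unfolding pos_var_def using nn by (auto simp: ennreal_neg intro!: SUP_eq_const[of _ _ 0])
  ultimately show "emeasure (pos_variation \<nu>) A = ennreal (sval \<nu> A)" "emeasure (pos_variation (- \<nu>)) A = 0"
    using assms(2) by (simp_all add: emeasure_pos_variation)
qed

text \<open>On nonnegative measures the total variation is thereby weakly continuous. This makes it
  a usable dominating factor for the series of the test family.\<close>

lemma total_variation_M_plus:
  assumes "\<nu> \<in> M_plus"
  shows "total_variation \<nu> = signed_integral \<nu> (\<lambda>_. 1)"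
  using emeasure_pos_variation_M_plus[OF assms, of UNIV]
  by (simp add: total_variation_def signed_integral_def measure_def)

lemma dirac_M_plus: "dirac x \<in> M_plus"
  by (simp add: M_plus_def dirac.rep_eq)

lemma signed_integral_dirac:
  assumes "bounded_measurable g"
  shows "signed_integral (dirac x) g = g x"
proof -
  have [measurable]: "g \<in> borel_measurable borel"
    using assms by (simp add: bounded_measurable_def)
  have "{y. g y \<noteq> g x} \<in> sets borel"
    by measurable
  then have "AE y in pos_variation (dirac x). g y = g x"
    by (intro AE_I[of _ _ "{y. g y \<noteq> g x}"]) (simp_all add: emeasure_pos_variation_M_plus[OF dirac_M_plus] dirac.rep_eq)
  then have "(\<integral>y. g y \<partial>pos_variation (dirac x)) = (\<integral>y. g x \<partial>pos_variation (dirac x))"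
    by (intro integral_cong_AE) (auto cong: measurable_cong_sets)
  also have "\<dots> = g x"
    by (simp add: measure_def emeasure_pos_variation_M_plus[OF dirac_M_plus] dirac.rep_eq)
  finally have "(\<integral>y. g y \<partial>pos_variation (dirac x)) = g x" .
  moreover have "pos_variation (- dirac x) = null_measure borel"
    by (rule measure_eqI) (simp_all add: emeasure_pos_variation_M_plus[OF dirac_M_plus])
  ultimately show ?thesis
    by (simp add: signed_integral_def)
qed

lemma continuous_on_signed_integral:
  assumes "g \<in> Cb"
  shows "continuous_on S (\<lambda>\<nu>. signed_integral \<nu> g)"
proof -
  have "open ((\<lambda>\<nu>. signed_integral \<nu> g) -` V)" if "open V" for V
    unfolding open_signed_measure_def vimage_def
    using assms that by (intro generate_topology.Basis) auto
  then have "continuous_on UNIV (\<lambda>\<nu>. signed_integral \<nu> g)"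
    by (simp add: continuous_on_open_vimage)
  then show ?thesis
    using continuous_on_subset by blast
qed

lemma const_Cb: "(\<lambda>_. c) \<in> Cb"
  by (simp add: Cb_def)

text \<open>The majorant depends on \<open>s\<close>. Dividing by \<open>1 + \<bar>B s\<bar>\<close>
  makes the Weierstrass test applicable, and multiplying by this continuous function restores the
  sum; the topology need not be metrizable.\<close>

lemma continuous_on_suminf_dominated:
  fixes h :: "nat \<Rightarrow> 'a::topological_space \<Rightarrow> real"
  assumes h: "\<And>k. continuous_on S (h k)" and B: "continuous_on S B"
    and dom: "\<And>k s. s \<in> S \<Longrightarrow> \<bar>h k s\<bar> \<le> B s * c k" and "summable c" "\<And>k. 0 \<le> c k"
  shows "continuous_on S (\<lambda>s. \<Sum>k. h k s)"
proof -
  define D where "D = (\<lambda>s. 1 + \<bar>B s\<bar>)"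
  have D: "D s > 0" for s
    by (simp add: D_def add_pos_nonneg)
  have cD: "continuous_on S D"
    unfolding D_def by (intro continuous_intros B)
  have le: "norm (h k s / D s) \<le> c k" if "s \<in> S" for k s
  proof -
    have "\<bar>h k s\<bar> \<le> D s * c k"
      by (rule order_trans[OF dom[OF that] mult_right_mono]) (simp_all add: D_def assms(5))
    then show ?thesis
      using D[of s] by (simp add: field_simps)
  qed
  have ul: "uniform_limit S (\<lambda>n s. \<Sum>k<n. h k s / D s) (\<lambda>s. \<Sum>k. h k s / D s) sequentially"
    using le \<open>summable c\<close> by (rule Weierstrass_m_test)
  have cn: "continuous_on S (\<lambda>s. \<Sum>k<n. h k s / D s)" for n
    using D by (intro continuous_intros h cD) (auto simp: less_le)
  have "continuous_on S (\<lambda>s. \<Sum>k. h k s / D s)"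
    by (rule uniform_limit_theorem[OF _ ul]) (simp_all add: cn)
  then have "continuous_on S (\<lambda>s. (\<Sum>k. h k s / D s) * D s)"
    by (intro continuous_on_mult cD)
  moreover have "(\<Sum>k. h k s / D s) * D s = (\<Sum>k. h k s)" if "s \<in> S" for s
  proof -
    have "summable (\<lambda>k. h k s / D s)"
      by (rule summable_comparison_test'[OF \<open>summable c\<close>]) (use le[OF that] in auto)
    then have "(\<Sum>k. h k s / D s * D s) = (\<Sum>k. h k s / D s) * D s"
      by (rule suminf_mult2[symmetric])
    then show ?thesis
      using D[of s] by simp
  qed
  ultimately show ?thesis
    by (simp cong: continuous_on_cong)
qed

section \<open>Test families\<close>

locale test_family =
  fixes f :: "nat \<Rightarrow> 'a::topological_space \<Rightarrow> real" and c :: "nat \<Rightarrow> real"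
  assumes cont: "\<And>k. continuous_on UNIV (f k)"
    and bound: "\<And>k x. \<bar>f k x\<bar> \<le> c k"
    and summable_c: "summable (\<lambda>k. (c k)\<^sup>2)"
begin

lemma f_Cb: "f k \<in> Cb"
  using cont bound by (auto simp: Cb_def bounded_iff)

lemma f_bounded: "bounded_measurable (f k)"
  by (rule Cb_bounded_measurable[OF f_Cb])

abbreviation coef :: "'a signed_measure \<Rightarrow> nat \<Rightarrow> real" where
  "coef \<mu> k \<equiv> signed_integral \<mu> (f k)"

lemma abs_coef_le: "\<bar>coef \<mu> k\<bar> \<le> total_variation \<mu> * c k"
  using f_bounded bound by (intro abs_signed_integral_le) (auto simp: bounded_measurable_def)

lemmas coef_linear = signed_integral_add_scaleR[OF f_bounded] signed_integral_add[OF f_bounded]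
  signed_integral_diff[OF f_bounded] signed_integral_scaleR[OF f_bounded] signed_integral_zero[OF f_bounded]

definition ip :: "'a signed_measure \<Rightarrow> 'a signed_measure \<Rightarrow> real" where
  "ip \<mu> \<nu> = (\<Sum>k. coef \<mu> k * coef \<nu> k)"

text \<open>The integral of the kernel k(x,y) = \<Sum> f_k(x) f_k(y) against \<mu> in one variable.
  It represents \<open>ip \<mu>\<close>, so its value at \<open>x\<close> is the derivative of
  \<open>ip \<mu>\<close> along \<open>dirac x\<close>.\<close>

definition pot :: "'a signed_measure \<Rightarrow> 'a \<Rightarrow> real" where
  "pot \<mu> x = (\<Sum>k. coef \<mu> k * f k x)"

lemma summable_dominated:
  assumes "\<And>k. \<bar>a k\<bar> \<le> A * c k" "\<And>k. \<bar>b k\<bar> \<le> B * c k"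
  shows "\<bar>a k * b k\<bar> \<le> A * B * (c k)\<^sup>2" "summable (\<lambda>k. a k * b k)"
proof -
  show le: "\<bar>a k * b k\<bar> \<le> A * B * (c k)\<^sup>2" for k
    using mult_mono[OF assms(1)[of k] assms(2)[of k]] assms(1)[of k]
    by (simp add: abs_mult power2_eq_square mult_ac)
  show "summable (\<lambda>k. a k * b k)"
    by (rule summable_comparison_test'[OF summable_mult[OF summable_c, of "A * B"]]) (use le in auto)
qed

lemma summable_ip: "summable (\<lambda>k. coef \<mu> k * coef \<nu> k)"
  by (rule summable_dominated[OF abs_coef_le abs_coef_le])

lemma abs_f_le: "\<bar>f k x\<bar> \<le> 1 * c k"
  using bound by simp

lemma ip_add_scaleR: "ip (\<mu> + r *\<^sub>R \<nu>) \<sigma> = ip \<mu> \<sigma> + r * ip \<nu> \<sigma>"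
proof -
  have "ip (\<mu> + r *\<^sub>R \<nu>) \<sigma> = (\<Sum>k. coef \<mu> k * coef \<sigma> k + r * (coef \<nu> k * coef \<sigma> k))"
    by (simp add: ip_def coef_linear algebra_simps)
  also have "\<dots> = ip \<mu> \<sigma> + r * ip \<nu> \<sigma>"
    unfolding ip_def by (subst suminf_add[symmetric]) (auto intro: summable_ip summable_mult simp: suminf_mult[OF summable_ip])
  finally show ?thesis .
qed

lemma ip_commute: "ip \<mu> \<nu> = ip \<nu> \<mu>"
  by (simp add: ip_def mult.commute)

lemma ip_add: "ip (\<mu> + \<nu>) \<sigma> = ip \<mu> \<sigma> + ip \<nu> \<sigma>" "ip \<sigma> (\<mu> + \<nu>) = ip \<sigma> \<mu> + ip \<sigma> \<nu>"
  using ip_add_scaleR[of \<mu> 1 \<nu> \<sigma>] by (simp_all add: ip_commute[of \<sigma>])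

lemma ip_diff: "ip (\<mu> - \<nu>) \<sigma> = ip \<mu> \<sigma> - ip \<nu> \<sigma>" "ip \<sigma> (\<mu> - \<nu>) = ip \<sigma> \<mu> - ip \<sigma> \<nu>"
  using ip_add_scaleR[of \<mu> "-1" \<nu> \<sigma>] by (simp_all add: ip_commute[of \<sigma>])

lemma ip_scaleR: "ip (r *\<^sub>R \<nu>) \<sigma> = r * ip \<nu> \<sigma>" "ip \<sigma> (r *\<^sub>R \<nu>) = r * ip \<sigma> \<nu>"
proof -
  have "ip 0 \<sigma> = 0"
    by (simp add: ip_def coef_linear)
  then show "ip (r *\<^sub>R \<nu>) \<sigma> = r * ip \<nu> \<sigma>"
    using ip_add_scaleR[of 0 r \<nu> \<sigma>] by simp
  then show "ip \<sigma> (r *\<^sub>R \<nu>) = r * ip \<sigma> \<nu>"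
    by (simp add: ip_commute[of \<sigma>])
qed

lemma ip_uminus: "ip (- \<nu>) \<sigma> = - ip \<nu> \<sigma>"
  using ip_scaleR(1)[of "-1"] by simp

lemma ip_nonneg: "0 \<le> ip \<mu> \<mu>"
  unfolding ip_def by (intro suminf_nonneg summable_ip) simp

lemma varrho_sq: "(varrho f \<mu>)\<^sup>2 = ip \<mu> \<mu>"
  using ip_nonneg[of \<mu>] by (simp add: varrho_def ip_def power2_eq_square)

lemma abs_ip_le: "\<bar>ip \<mu> \<nu>\<bar> \<le> total_variation \<mu> * total_variation \<nu> * (\<Sum>k. (c k)\<^sup>2)"
proof -
  let ?K = "total_variation \<mu> * total_variation \<nu>"
  have le: "\<bar>coef \<mu> k * coef \<nu> k\<bar> \<le> ?K * (c k)\<^sup>2" for k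
    by (rule summable_dominated[OF abs_coef_le abs_coef_le])
  have s: "summable (\<lambda>k. \<bar>coef \<mu> k * coef \<nu> k\<bar>)"
    by (rule summable_comparison_test'[OF summable_mult[OF summable_c, of ?K]]) (use le in auto)
  have "\<bar>ip \<mu> \<nu>\<bar> \<le> (\<Sum>k. \<bar>coef \<mu> k * coef \<nu> k\<bar>)"
    unfolding ip_def by (rule summable_rabs[OF s])
  also have "\<dots> \<le> (\<Sum>k. ?K * (c k)\<^sup>2)"
    by (rule suminf_le[OF le s summable_mult[OF summable_c]])
  also have "\<dots> = ?K * (\<Sum>k. (c k)\<^sup>2)"
    by (rule suminf_mult[OF summable_c])
  finally show ?thesis .
qed

lemma ip_eq_0_coef:
  assumes "ip \<mu> \<mu> \<le> 0"
  shows "coef \<mu> k = 0"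
proof -
  have "ip \<mu> \<mu> = 0"
    using assms ip_nonneg[of \<mu>] by simp
  then have "\<forall>k. coef \<mu> k * coef \<mu> k = 0"
    unfolding ip_def by (subst (asm) suminf_eq_zero_iff[OF summable_ip]) auto
  then show ?thesis by simp
qed

lemma ip_dirac: "ip \<mu> (dirac x) = pot \<mu> x"
  by (simp add: ip_def pot_def signed_integral_dirac[OF f_bounded])

lemma pot_linear: "pot (\<mu> - \<nu>) x = pot \<mu> x - pot \<nu> x" "pot (- \<mu>) x = - pot \<mu> x" "pot (r *\<^sub>R \<mu>) x = r * pot \<mu> x"
  by (simp_all add: ip_dirac[symmetric] ip_diff ip_uminus ip_scaleR)

lemma continuous_pot_diff:
  "continuous_on (M_plus \<times> UNIV) (\<lambda>(\<mu>, x). pot (\<mu> - \<nu>) x)"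
proof -
  have "continuous_on (M_plus \<times> UNIV) (\<lambda>z. \<Sum>k. coef (fst z - \<nu>) k * f k (snd z))"
  proof (rule continuous_on_suminf_dominated)
    show "continuous_on (M_plus \<times> UNIV) (\<lambda>z. coef (fst z - \<nu>) k * f k (snd z))" for k
      unfolding coef_linear
      by (intro continuous_intros continuous_on_compose2[OF continuous_on_signed_integral[OF f_Cb]]
          continuous_on_compose2[OF cont]) auto
    show "continuous_on (M_plus \<times> UNIV) (\<lambda>z::'a signed_measure \<times> 'a. signed_integral (fst z) (\<lambda>_. 1) + total_variation \<nu>)"
      by (intro continuous_intros continuous_on_compose2[OF continuous_on_signed_integral[OF const_Cb]]) auto
    fix k and z :: "'a signed_measure \<times> 'a" assume z: "z \<in> M_plus \<times> UNIV"
    let ?B = "signed_integral (fst z) (\<lambda>_. 1) + total_variation \<nu>"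
    have "\<bar>coef (fst z - \<nu>) k\<bar> \<le> ?B * c k" for k
      using abs_coef_le[of "fst z" k] abs_coef_le[of \<nu> k] z
      by (auto simp: coef_linear total_variation_M_plus distrib_right)
    from summable_dominated(1)[OF this abs_f_le]
    show "\<bar>coef (fst z - \<nu>) k * f k (snd z)\<bar> \<le> ?B * (c k)\<^sup>2"
      by simp
  qed (use summable_c in auto)
  then show ?thesis
    by (simp add: pot_def case_prod_beta')
qed

lemma continuous_ip_left: "continuous_on M_plus (\<lambda>\<mu>. ip \<nu> \<mu>)"
  unfolding ip_def
proof (rule continuous_on_suminf_dominated)
  show "continuous_on M_plus (\<lambda>\<mu>. coef \<nu> k * coef \<mu> k)" for k
    by (intro continuous_intros continuous_on_signed_integral f_Cb)
  show "continuous_on M_plus (\<lambda>\<mu>. total_variation \<nu> * signed_integral \<mu> (\<lambda>_. 1))"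
    by (intro continuous_intros continuous_on_signed_integral const_Cb)
  show "\<bar>coef \<nu> k * coef \<mu> k\<bar> \<le> total_variation \<nu> * signed_integral \<mu> (\<lambda>_. 1) * (c k)\<^sup>2" if "\<mu> \<in> M_plus" for k \<mu>
    using summable_dominated(1)[OF abs_coef_le abs_coef_le] by (simp add: total_variation_M_plus[OF that, symmetric])
qed (use summable_c in auto)

lemma continuous_ip_diag: "continuous_on M_plus (\<lambda>\<mu>. ip (\<mu> - \<nu>) (\<mu> - \<nu>))"
proof -
  have "continuous_on M_plus (\<lambda>\<mu>. ip \<mu> \<mu>)"
    unfolding ip_def
  proof (rule continuous_on_suminf_dominated)
    show "continuous_on M_plus (\<lambda>\<mu>. coef \<mu> k * coef \<mu> k)" for k
      by (intro continuous_intros continuous_on_signed_integral f_Cb)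
    show "continuous_on M_plus (\<lambda>\<mu>. signed_integral \<mu> (\<lambda>_. 1) * signed_integral \<mu> (\<lambda>_. 1))"
      by (intro continuous_intros continuous_on_signed_integral const_Cb)
    show "\<bar>coef \<mu> k * coef \<mu> k\<bar> \<le> signed_integral \<mu> (\<lambda>_. 1) * signed_integral \<mu> (\<lambda>_. 1) * (c k)\<^sup>2" if "\<mu> \<in> M_plus" for k \<mu>
      unfolding total_variation_M_plus[OF that, symmetric] by (rule summable_dominated[OF abs_coef_le abs_coef_le])
  qed (use summable_c in auto)
  moreover have "ip (\<mu> - \<nu>) (\<mu> - \<nu>) = ip \<mu> \<mu> - 2 * ip \<nu> \<mu> + ip \<nu> \<nu>" for \<mu>
    by (simp add: ip_diff ip_commute[of \<mu> \<nu>])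
  ultimately show ?thesis
    by (simp add: continuous_intros continuous_ip_left)
qed

lemma continuous_pot: "continuous_on UNIV (pot \<mu>)"
  unfolding pot_def
proof (rule continuous_on_suminf_dominated)
  show "continuous_on UNIV (\<lambda>x. coef \<mu> k * f k x)" for k
    by (intro continuous_intros cont)
  show "continuous_on UNIV (\<lambda>x::'a. total_variation \<mu> * 1)"
    by (intro continuous_intros)
  show "\<bar>coef \<mu> k * f k x\<bar> \<le> total_variation \<mu> * 1 * (c k)\<^sup>2" for k x
    by (rule summable_dominated[OF abs_coef_le abs_f_le])
qed (use summable_c in auto)

lemma pot_Cb: "pot \<mu> \<in> Cb"
proof -
  have "\<bar>pot \<mu> x\<bar> \<le> total_variation \<mu> * total_variation (dirac x) * (\<Sum>k. (c k)\<^sup>2)" for x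
    using abs_ip_le[of \<mu> "dirac x"] by (simp add: ip_dirac)
  moreover have "total_variation (dirac x) = 1" for x :: 'a
    by (simp add: total_variation_M_plus[OF dirac_M_plus] signed_integral_dirac[OF Cb_bounded_measurable[OF const_Cb]])
  ultimately show ?thesis
    using continuous_pot by (auto simp: Cb_def bounded_iff)
qed

lemma signed_integral_pot: "signed_integral \<nu> (pot \<mu>) = ip \<mu> \<nu>"
proof -
  have one: "(\<integral>x. pot \<mu> x \<partial>pos_variation \<sigma>) = (\<Sum>k. coef \<mu> k * (\<integral>x. f k x \<partial>pos_variation \<sigma>))"
    "summable (\<lambda>k. coef \<mu> k * (\<integral>x. f k x \<partial>pos_variation \<sigma>))" for \<sigma> :: "'a signed_measure"
  proof -
    let ?M = "pos_variation \<sigma>" and ?m = "measure (pos_variation \<sigma>) UNIV"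
    interpret finite_measure ?M by (rule finite_measure_pos_variation)
    have int: "integrable ?M (f k)" for k
      by (rule integrable_pos_variation[OF f_bounded])
    have abs_int: "(\<integral>x. \<bar>f k x\<bar> \<partial>?M) \<le> ?m * c k" for k
    proof -
      have "(\<integral>x. \<bar>f k x\<bar> \<partial>?M) \<le> (\<integral>x. c k \<partial>?M)"
        using int bound by (intro integral_mono) auto
      then show ?thesis by simp
    qed
    then have le: "\<bar>\<integral>x. f k x \<partial>?M\<bar> \<le> ?m * c k" for k
      using integral_abs_bound[of ?M "f k"] order_trans by blast
    show "summable (\<lambda>k. coef \<mu> k * (\<integral>x. f k x \<partial>?M))"
      by (rule summable_dominated[OF abs_coef_le le])
    have "(\<integral>x. (\<Sum>k. coef \<mu> k * f k x) \<partial>?M) = (\<Sum>k. \<integral>x. coef \<mu> k * f k x \<partial>?M)"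
    proof (rule integral_suminf)
      show "integrable ?M (\<lambda>x. coef \<mu> k * f k x)" for k
        using int by simp
      have "summable (\<lambda>k. norm (coef \<mu> k * f k x))" for x
        by (rule summable_comparison_test'[OF summable_mult[OF summable_c, of "total_variation \<mu> * 1"]])
          (use summable_dominated(1)[OF abs_coef_le abs_f_le] in auto)
      then show "AE x in ?M. summable (\<lambda>k. norm (coef \<mu> k * f k x))"
        by simp
      have "\<bar>\<bar>coef \<mu> k\<bar> * (\<integral>x. \<bar>f k x\<bar> \<partial>?M)\<bar> \<le> total_variation \<mu> * ?m * (c k)\<^sup>2" for k
        using summable_dominated(1)[of "\<lambda>k. \<bar>coef \<mu> k\<bar>" "total_variation \<mu>" "\<lambda>k. \<integral>x. \<bar>f k x\<bar> \<partial>?M" ?m k] abs_coef_le abs_int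
        by simp
      then show "summable (\<lambda>k. \<integral>x. norm (coef \<mu> k * f k x) \<partial>?M)"
        by (intro summable_comparison_test'[OF summable_mult[OF summable_c, of "total_variation \<mu> * ?m"]])
          (simp add: abs_mult)
    qed
    then show "(\<integral>x. pot \<mu> x \<partial>?M) = (\<Sum>k. coef \<mu> k * (\<integral>x. f k x \<partial>?M))"
      by (simp add: pot_def)
  qed
  show ?thesis
    unfolding signed_integral_def[of \<nu> "pot \<mu>"] one(1) ip_def
    by (subst suminf_diff[OF one(2) one(2)]) (simp add: signed_integral_def right_diff_distrib)
qed

lemma Theta_pot: "Theta f \<epsilon> \<mu> \<nu> = (\<lambda>x. 1 / \<epsilon> * pot (\<mu> - \<nu>) x)"
  by (simp add: Theta_def pot_def fun_eq_iff)

lemma Theta_Cb: "Theta f \<epsilon> \<mu> \<nu> \<in> Cb"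
proof -
  have "Theta f \<epsilon> \<mu> \<nu> = pot ((1 / \<epsilon>) *\<^sub>R (\<mu> - \<nu>))"
    by (simp add: Theta_pot pot_linear fun_eq_iff del: scaleR_right_diff_distrib)
  then show ?thesis
    using pot_Cb by simp
qed

end

lemma M_q_M_plus: "M_q \<subseteq> M_plus"
  by (auto simp: M_q_def)

lemma has_integral_affine: "((\<lambda>\<eta>. a + \<eta> * b) has_integral (a + b / 2)) {0..1::real}"
proof -
  have "((\<lambda>\<eta>. a + \<eta> * b) has_integral ((a * 1 + b * 1\<^sup>2 / 2) - (a * 0 + b * 0\<^sup>2 / 2))) {0..1::real}"
    by (rule fundamental_theorem_of_calculus)
      (auto intro!: derivative_eq_intros simp flip: has_real_derivative_iff_has_vector_derivative)
  then show ?thesis by simp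
qed

text \<open>\<open>\<Psi>\<close> is quadratic, so the integrand is affine in \<open>\<eta>\<close>
  and the integral over the unit interval contributes half of its linear coefficient.\<close>

lemma (in test_family) Theta_linear_derivative:
  assumes "S \<subseteq> M_plus" and "\<epsilon> > 0"
  shows "is_linear_derivative S (\<lambda>\<sigma>. 1 / (2 * \<epsilon>) * (varrho f (\<sigma> - \<nu>))\<^sup>2) (\<lambda>\<sigma>. Theta f \<epsilon> \<sigma> \<nu>)"
  unfolding is_linear_derivative_def
proof (intro conjI ballI)
  have "continuous_on (S \<times> UNIV) (\<lambda>(\<mu>, x). pot (\<mu> - \<nu>) x)"
    by (rule continuous_on_subset[OF continuous_pot_diff]) (use assms in auto)
  then show "continuous_on (S \<times> UNIV) (\<lambda>(\<mu>, y). Theta f \<epsilon> \<mu> \<nu> y)"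
    unfolding Theta_pot case_prod_beta' by (intro continuous_intros)
next
  fix \<mu> \<mu>' \<eta> assume "\<eta> \<in> {0..1::real}"
  show "signed_integrable (\<mu>' - \<mu>) (Theta f \<epsilon> (\<mu> + \<eta> *\<^sub>R (\<mu>' - \<mu>)) \<nu>)"
    by (intro signed_integrable_bounded Cb_bounded_measurable Theta_Cb)
next
  fix \<mu> \<mu>' :: "'a signed_measure"
  define m where "m = \<mu>' - \<mu>"
  have "signed_integral m (Theta f \<epsilon> (\<mu> + \<eta> *\<^sub>R m) \<nu>) = ip (\<mu> - \<nu>) m / \<epsilon> + \<eta> * (ip m m / \<epsilon>)" for \<eta>
  proof -
    have "Theta f \<epsilon> (\<mu> + \<eta> *\<^sub>R m) \<nu> = pot ((1 / \<epsilon>) *\<^sub>R (\<mu> + \<eta> *\<^sub>R m - \<nu>))"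
      by (simp add: Theta_pot pot_linear(3) fun_eq_iff)
    then show ?thesis
      by (simp add: signed_integral_pot ip_scaleR(1) ip_diff ip_add add_divide_distrib diff_divide_distrib)
  qed
  moreover have "1 / (2 * \<epsilon>) * (varrho f (\<mu>' - \<nu>))\<^sup>2 - 1 / (2 * \<epsilon>) * (varrho f (\<mu> - \<nu>))\<^sup>2 = ip (\<mu> - \<nu>) m / \<epsilon> + (ip m m / \<epsilon>) / 2"
  proof -
    have "\<mu>' - \<nu> = (\<mu> - \<nu>) + m" by (simp add: m_def)
    then have "ip (\<mu>' - \<nu>) (\<mu>' - \<nu>) = ip (\<mu> - \<nu>) (\<mu> - \<nu>) + 2 * ip (\<mu> - \<nu>) m + ip m m"
      by (simp only: ip_add ip_commute[of m "\<mu> - \<nu>"])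
    then show ?thesis
      using \<open>\<epsilon> > 0\<close> by (simp add: varrho_sq field_simps)
  qed
  ultimately show "((\<lambda>\<eta>. signed_integral (\<mu>' - \<mu>) (Theta f \<epsilon> (\<mu> + \<eta> *\<^sub>R (\<mu>' - \<mu>)) \<nu>)) has_integral
      (1 / (2 * \<epsilon>) * (varrho f (\<mu>' - \<nu>))\<^sup>2 - 1 / (2 * \<epsilon>) * (varrho f (\<mu> - \<nu>))\<^sup>2)) {0..1}"
    using has_integral_affine[of "ip (\<mu> - \<nu>) m / \<epsilon>" "ip m m / \<epsilon>"] by (simp add: m_def[symmetric])
qed

section \<open>Penalized maximization over measures\<close>

text \<open>Coercivity supplies convergent sequences, so upper semicontinuity is used in sequential
  form. Variable bounds \<open>a n\<close> make room for adding a convergent penalty.\<close>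

lemma usc_on_sequential:
  assumes "usc_on S u" and X: "\<And>n::nat. X n \<in> S" "X \<longlonglongrightarrow> l" "l \<in> S"
    and a: "\<forall>\<^sub>F n in sequentially. a n \<le> u (X n)" "a \<longlonglongrightarrow> A"
  shows "A \<le> u l"
proof (rule ccontr)
  assume "\<not> A \<le> u l"
  define b where "b = (u l + A) / 2"
  have b: "u l < b" "b < A"
    using \<open>\<not> A \<le> u l\<close> by (auto simp: b_def)
  have "openin (top_of_set S) {\<xi> \<in> S. u \<xi> < b}"
    using assms(1) by (simp add: usc_on_def)
  then obtain O' where O': "open O'" "{\<xi> \<in> S. u \<xi> < b} = S \<inter> O'"
    by (auto simp: openin_open)
  have "l \<in> O'"
    using O' b(1) X(3) by auto
  then have "\<forall>\<^sub>F n in sequentially. X n \<in> O'"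
    using topological_tendstoD[OF X(2) O'(1)] by simp
  moreover have "\<forall>\<^sub>F n in sequentially. b < a n"
    using order_tendstoD(1)[OF a(2) b(2)] .
  ultimately have "\<forall>\<^sub>F n in sequentially. False"
    using a(1)
  proof eventually_elim
    case (elim n)
    have "X n \<in> {\<xi> \<in> S. u \<xi> < b}"
      using elim(1) X(1) O'(2) by auto
    then show False
      using elim(2,3) by simp
  qed
  then show False by simp
qed

lemma Dom_T_iff: "(\<mu>, x) \<in> Dom_T T \<longleftrightarrow> \<mu> \<in> M_q \<and> total_variation \<mu> \<le> T"
  by (auto simp: Dom_T_def Dom_def)

text \<open>One side of the doubled problem, to be used with \<open>u, p\<close> and with
  \<open>- w, - p\<close>. The hypothesis \<open>maximal\<close> has coefficient
  \<open>1 / \<epsilon>\<close> in front of the squared distance to \<open>m0\<close>, the penalty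
  \<open>pen\<close> below has \<open>3 / (2 * \<epsilon>)\<close>; the difference
  \<open>1 / (2 * \<epsilon>)\<close> is what singles out \<open>m0\<close>.\<close>

locale penalized = test_family f c
  for f :: "nat \<Rightarrow> real ^ 'n::finite \<Rightarrow> real" and c +
  fixes T \<epsilon> :: real and u :: "'n state \<Rightarrow> real" and p m0 :: "(real ^ 'n) signed_measure" and x0 :: "real ^ 'n"
  assumes sep: "separates_measures f" and \<epsilon>: "\<epsilon> > 0"
    and usc: "usc_on (Dom_T T) u" and coercive: "upper_coercive_on (Dom_T T) u"
    and base: "(m0, x0) \<in> Dom_T T"
    and maximal: "\<And>\<mu>. (\<mu>, x0) \<in> Dom_T T \<Longrightarrow>
      u (\<mu>, x0) - ip p \<mu> / \<epsilon> - ip (\<mu> - m0) (\<mu> - m0) / \<epsilon> \<le> u (m0, x0) - ip p m0 / \<epsilon>"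
begin

definition pen :: "(real ^ 'n) signed_measure \<Rightarrow> real" where
  "pen \<mu> = ip p \<mu> / \<epsilon> + 3 / (2 * \<epsilon>) * ip (\<mu> - m0) (\<mu> - m0)"

definition G :: "'n state \<Rightarrow> real" where
  "G \<xi> = u \<xi> - pen (fst \<xi>)"

definition M_T :: "(real ^ 'n) signed_measure set" where
  "M_T = {\<mu> \<in> M_q. total_variation \<mu> \<le> T}"

lemma Dom_T_M_T: "\<xi> \<in> Dom_T T \<longleftrightarrow> fst \<xi> \<in> M_T"
  by (cases \<xi>) (simp add: Dom_T_iff M_T_def)

lemma M_T_M_plus: "\<mu> \<in> M_T \<Longrightarrow> \<mu> \<in> M_plus"
  using M_q_M_plus by (auto simp: M_T_def)

lemma m0: "m0 \<in> M_T"
  using base by (simp add: Dom_T_M_T)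

lemma continuous_pen: "continuous_on M_plus pen"
  unfolding pen_def by (intro continuous_intros continuous_ip_left continuous_ip_diag) (use \<epsilon> in auto)

lemma pen_tendsto:
  assumes "\<And>n. X n \<in> Dom_T T" "X \<longlonglongrightarrow> l" "l \<in> Dom_T T"
  shows "(\<lambda>n. pen (fst (X n))) \<longlonglongrightarrow> pen (fst l)"
  by (rule continuous_on_tendsto_compose[OF continuous_pen])
    (use assms in \<open>auto intro!: tendsto_fst M_T_M_plus always_eventually simp: Dom_T_M_T\<close>)

definition L :: real where
  "L = total_variation p * T * (\<Sum>k. (c k)\<^sup>2) / \<epsilon>"

lemma pen_ge: "\<mu> \<in> M_T \<Longrightarrow> - L \<le> pen \<mu>"
proof -
  assume \<mu>: "\<mu> \<in> M_T"
  have "\<bar>ip p \<mu>\<bar> \<le> total_variation p * total_variation \<mu> * (\<Sum>k. (c k)\<^sup>2)"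
    by (rule abs_ip_le)
  also have "\<dots> \<le> total_variation p * T * (\<Sum>k. (c k)\<^sup>2)"
    using \<mu> by (intro mult_right_mono mult_left_mono total_variation_nonneg suminf_nonneg summable_c) (auto simp: M_T_def)
  finally have "\<bar>ip p \<mu>\<bar> / \<epsilon> \<le> L"
    unfolding L_def using \<epsilon> by (intro divide_right_mono) auto
  moreover have "- (\<bar>ip p \<mu>\<bar> / \<epsilon>) \<le> ip p \<mu> / \<epsilon>"
    using \<epsilon> divide_right_mono[of "- \<bar>ip p \<mu>\<bar>" "ip p \<mu>" \<epsilon>] by simp
  moreover have "0 \<le> 3 / (2 * \<epsilon>) * ip (\<mu> - m0) (\<mu> - m0)"
    using \<epsilon> ip_nonneg by simp
  ultimately show "- L \<le> pen \<mu>"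
    unfolding pen_def by linarith
qed

text \<open>On measures of total variation at most \<open>T\<close> the penalty is bounded below, so
  lower bounds on \<open>G\<close> are lower bounds on \<open>u\<close> and coercivity
  applies.\<close>

lemma compact:
  assumes "\<And>n::nat. \<xi> n \<in> Dom_T T" "\<And>n. b \<le> G (\<xi> n)"
  shows "\<exists>r l. strict_mono (r :: nat \<Rightarrow> nat) \<and> l \<in> Dom_T T \<and> (\<xi> \<circ> r) \<longlonglongrightarrow> l"
proof -
  have "b - L \<le> u (\<xi> n)" for n
    using assms(2)[of n] pen_ge[of "fst (\<xi> n)"] assms(1)[of n] by (simp add: G_def Dom_T_M_T)
  then show ?thesis
    using coercive assms(1) unfolding upper_coercive_on_def by blast
qed

lemma G_limit:
  assumes X: "\<And>n. X n \<in> Dom_T T" "X \<longlonglongrightarrow> l" "l \<in> Dom_T T"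
    and a: "\<And>n. a n \<le> G (X n)" "a \<longlonglongrightarrow> A"
  shows "A \<le> G l"
proof -
  have t: "(\<lambda>n. a n + pen (fst (X n))) \<longlonglongrightarrow> A + pen (fst l)"
    by (intro tendsto_add a pen_tendsto X)
  have e: "\<forall>\<^sub>F n in sequentially. a n + pen (fst (X n)) \<le> u (X n)"
    using a(1) by (simp add: G_def algebra_simps)
  have "A + pen (fst l) \<le> u l"
    by (rule usc_on_sequential[OF usc X e t])
  then show ?thesis
    by (simp add: G_def)
qed

lemma G_bounded: "\<exists>C. \<forall>\<xi>\<in>Dom_T T. G \<xi> \<le> C"
proof (rule ccontr)
  assume "\<not> (\<exists>C. \<forall>\<xi>\<in>Dom_T T. G \<xi> \<le> C)"
  then have "\<forall>n::nat. \<exists>\<xi>. \<xi> \<in> Dom_T T \<and> real n \<le> G \<xi>"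
    by (meson less_imp_le not_le)
  then obtain \<xi> where \<xi>: "\<And>n::nat. \<xi> n \<in> Dom_T T" "\<And>n. real n \<le> G (\<xi> n)"
    by metis
  then have "0 \<le> G (\<xi> n)" for n
    using order_trans[OF of_nat_0_le_iff] by blast
  then obtain r l where r: "strict_mono r" "l \<in> Dom_T T" "(\<xi> \<circ> r) \<longlonglongrightarrow> l"
    using compact[of \<xi> 0] \<xi>(1) by blast
  \<comment> \<open>From \<open>N\<close> on the values are at least \<open>G l + 1\<close>, which
    contradicts upper semicontinuity at the limit \<open>l\<close>.\<close>
  obtain N :: nat where N: "G l + 1 \<le> real N"
    using real_arch_simple by blast
  have "strict_mono (\<lambda>n. r (n + N))"
    using r(1) by (auto simp: strict_mono_def)
  have "G l + 1 \<le> G l"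
  proof (rule G_limit)
    show "(\<lambda>n. \<xi> (r (n + N))) \<longlonglongrightarrow> l"
      using LIMSEQ_ignore_initial_segment[OF r(3), of N] by (simp add: o_def)
    show "G l + 1 \<le> G (\<xi> (r (n + N)))" for n
    proof -
      have "N \<le> r (n + N)"
        using seq_suble[OF r(1), of "n + N"] by simp
      then show ?thesis
        using \<xi>(2)[of "r (n + N)"] N by (meson of_nat_mono order_trans)
    qed
  qed (use \<xi>(1) r(2) in auto)
  then show False by simp
qed

definition u1 :: "real ^ 'n \<Rightarrow> real" where
  "u1 x = (SUP \<mu>\<in>M_T. G (\<mu>, x))"

lemma bdd_G: "bdd_above ((\<lambda>\<mu>. G (\<mu>, x)) ` M_T)"
proof -
  obtain C where "\<forall>\<xi>\<in>Dom_T T. G \<xi> \<le> C" using G_bounded ..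
  then show ?thesis
    by (intro bdd_aboveI2[of _ _ C]) (auto simp: Dom_T_M_T)
qed

lemma G_le_u1: "\<mu> \<in> M_T \<Longrightarrow> G (\<mu>, x) \<le> u1 x"
  unfolding u1_def by (intro cSUP_upper bdd_G)

lemma u1_bounded: "\<exists>C. \<forall>x. u1 x \<le> C"
proof -
  obtain C where "\<forall>\<xi>\<in>Dom_T T. G \<xi> \<le> C" using G_bounded ..
  then have "u1 x \<le> C" for x
    unfolding u1_def using m0 by (intro cSUP_least) (auto simp: Dom_T_M_T)
  then show ?thesis by blast
qed

lemma u1_attained: "\<exists>\<mu>\<in>M_T. G (\<mu>, x) = u1 x"
proof -
  have "\<exists>\<mu>\<in>M_T. u1 x - 1 / real (Suc n) < G (\<mu>, x)" for n
  proof -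
    have "u1 x - 1 / real (Suc n) < u1 x" by simp
    then show ?thesis
      unfolding u1_def using less_cSUP_iff[OF _ bdd_G] m0 by blast
  qed
  then obtain \<mu> where \<mu>: "\<And>n. \<mu> n \<in> M_T" "\<And>n. u1 x - 1 / real (Suc n) < G (\<mu> n, x)"
    by metis
  have low: "u1 x - 1 \<le> G (\<mu> n, x)" for n
  proof -
    have "1 / real (Suc n) \<le> 1" by simp
    then show ?thesis using \<mu>(2)[of n] by linarith
  qed
  obtain r l where r: "strict_mono r" "l \<in> Dom_T T" "((\<lambda>n. (\<mu> n, x)) \<circ> r) \<longlonglongrightarrow> l"
    using compact[of "\<lambda>n. (\<mu> n, x)" "u1 x - 1"] low \<mu>(1) by (auto simp: Dom_T_M_T)
  have "(\<lambda>n. snd (((\<lambda>n. (\<mu> n, x)) \<circ> r) n)) \<longlonglongrightarrow> snd l"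
    by (intro tendsto_snd r(3))
  then have "snd l = x"
    using LIMSEQ_unique tendsto_const by (simp add: o_def) blast
  have "u1 x \<le> G l"
  proof (rule G_limit[OF _ r(3,2)])
    have "(\<lambda>n. 1 / real (Suc n)) \<longlonglongrightarrow> 0"
      by (rule LIMSEQ_Suc[OF lim_1_over_n])
    then have "(\<lambda>n. u1 x - 1 / real (Suc n)) \<longlonglongrightarrow> u1 x - 0"
      by (intro tendsto_intros)
    then have "(\<lambda>n. u1 x - 1 / real (Suc n)) \<longlonglongrightarrow> u1 x"
      by simp
    then show "(\<lambda>n. u1 x - 1 / real (Suc (r n))) \<longlonglongrightarrow> u1 x"
      using LIMSEQ_subseq_LIMSEQ[OF _ r(1)] by (fastforce simp: o_def)
    show "u1 x - 1 / real (Suc (r n)) \<le> G (((\<lambda>n. (\<mu> n, x)) \<circ> r) n)" for n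
      using \<mu>(2)[of "r n"] by simp
  qed (use \<mu>(1) in \<open>auto simp: Dom_T_M_T\<close>)
  moreover have "G l \<le> u1 x"
    using G_le_u1[of "fst l" x] r(2) \<open>snd l = x\<close> by (cases l) (auto simp: Dom_T_M_T)
  ultimately show ?thesis
    using r(2) \<open>snd l = x\<close> by (intro bexI[of _ "fst l"]) (auto simp: Dom_T_M_T)
qed

definition argmax :: "real ^ 'n \<Rightarrow> (real ^ 'n) signed_measure" where
  "argmax x = (SOME \<mu>. \<mu> \<in> M_T \<and> G (\<mu>, x) = u1 x)"

lemma argmax: "argmax x \<in> M_T" "G (argmax x, x) = u1 x"
proof -
  have "argmax x \<in> M_T \<and> G (argmax x, x) = u1 x"
    unfolding argmax_def by (rule someI_ex) (use u1_attained in blast)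
  then show "argmax x \<in> M_T" "G (argmax x, x) = u1 x"
    by auto
qed

lemma u1_closed: "closed {x. b \<le> u1 x}"
  unfolding closed_sequential_limits
proof (intro allI impI, elim conjE)
  fix X x assume X: "\<forall>n. X n \<in> {x. b \<le> u1 x}" "X \<longlonglongrightarrow> x"
  define \<mu> where "\<mu> = (\<lambda>n. argmax (X n))"
  have \<mu>: "\<mu> n \<in> M_T" "G (\<mu> n, X n) = u1 (X n)" for n
    by (simp_all add: \<mu>_def argmax)
  obtain r l where r: "strict_mono r" "l \<in> Dom_T T" "((\<lambda>n. (\<mu> n, X n)) \<circ> r) \<longlonglongrightarrow> l"
    using compact[of "\<lambda>n. (\<mu> n, X n)" b] \<mu> X(1) by (auto simp: Dom_T_M_T)
  have "(\<lambda>n. snd (((\<lambda>n. (\<mu> n, X n)) \<circ> r) n)) \<longlonglongrightarrow> snd l"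
    by (intro tendsto_snd r(3))
  then have "snd l = x"
    using LIMSEQ_unique[OF _ LIMSEQ_subseq_LIMSEQ[OF X(2) r(1)]] by (simp add: o_def)
  have "b \<le> G l"
    by (rule G_limit[OF _ r(3,2) _ tendsto_const]) (use \<mu> X(1) in \<open>auto simp: Dom_T_M_T\<close>)
  also have "\<dots> \<le> u1 x"
    using G_le_u1[of "fst l" x] r(2) \<open>snd l = x\<close> by (cases l) (auto simp: Dom_T_M_T)
  finally show "x \<in> {x. b \<le> u1 x}" by simp
qed

lemma G_gap:
  assumes "\<mu> \<in> M_T"
  shows "G (\<mu>, x0) + 1 / (2 * \<epsilon>) * ip (\<mu> - m0) (\<mu> - m0) \<le> G (m0, x0)"
proof -
  have "ip (m0 - m0) (m0 - m0) = 0"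
    unfolding ip_diff(1) by simp
  moreover have "3 / (2 * \<epsilon>) * z = 3 / 2 * (z / \<epsilon>)" "1 / (2 * \<epsilon>) * z = 1 / 2 * (z / \<epsilon>)" for z
    by simp_all
  ultimately show ?thesis
    using maximal[of \<mu>] assms unfolding G_def pen_def fst_conv Dom_T_M_T by simp
qed

lemma u1_x0: "u1 x0 = G (m0, x0)"
proof (rule antisym)
  show "u1 x0 \<le> G (m0, x0)"
    unfolding u1_def
  proof (rule cSUP_least)
    fix \<mu> assume "\<mu> \<in> M_T"
    have "0 \<le> 1 / (2 * \<epsilon>) * ip (\<mu> - m0) (\<mu> - m0)"
      using \<epsilon> ip_nonneg by simp
    then show "G (\<mu>, x0) \<le> G (m0, x0)"
      using G_gap[OF \<open>\<mu> \<in> M_T\<close>] by linarith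
  qed (use m0 in auto)
qed (rule G_le_u1[OF m0])

text \<open>A limit of maximizers is again a maximizer above \<open>x0\<close> by upper
  semicontinuity. The gap in \<open>G_gap\<close> then puts it at distance 0 from \<open>m0\<close>
  in the norm of the test family, and the family separates measures.\<close>

lemma maximizers_converge:
  assumes \<mu>: "\<And>n. \<mu> n \<in> M_T" "\<And>n. G (\<mu> n, X n) = u1 (X n)"
    and X: "X \<longlonglongrightarrow> x0" "(\<lambda>n. u1 (X n)) \<longlonglongrightarrow> u1 x0"
  shows "\<exists>r. strict_mono (r :: nat \<Rightarrow> nat) \<and> (\<lambda>n. (\<mu> (r n), X (r n))) \<longlonglongrightarrow> (m0, x0)"
proof -
  obtain K where K: "\<And>n. norm (u1 (X n)) \<le> K"
    using convergent_imp_Bseq[OF convergentI[OF X(2)]] by (auto simp: Bseq_def)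
  have low: "- K \<le> G (\<mu> n, X n)" for n
    using K[of n] \<mu>(2)[of n] by (simp add: abs_le_iff)
  obtain r l where r: "strict_mono r" "l \<in> Dom_T T" "((\<lambda>n. (\<mu> n, X n)) \<circ> r) \<longlonglongrightarrow> l"
    using compact[of "\<lambda>n. (\<mu> n, X n)" "- K"] \<mu>(1) low by (auto simp: Dom_T_M_T)
  have "(\<lambda>n. snd (((\<lambda>n. (\<mu> n, X n)) \<circ> r) n)) \<longlonglongrightarrow> snd l"
    by (intro tendsto_snd r(3))
  then have sl: "snd l = x0"
    using LIMSEQ_unique[OF _ LIMSEQ_subseq_LIMSEQ[OF X(1) r(1)]] by (simp add: o_def)
  have fl: "fst l \<in> M_T"
    using r(2) by (simp add: Dom_T_M_T)
  have "u1 x0 \<le> G l"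
  proof (rule G_limit[OF _ r(3,2)])
    show "(\<lambda>n. u1 (X (r n))) \<longlonglongrightarrow> u1 x0"
      using LIMSEQ_subseq_LIMSEQ[OF X(2) r(1)] by (simp add: o_def)
  qed (use \<mu> in \<open>auto simp: Dom_T_M_T\<close>)
  then have "1 / (2 * \<epsilon>) * ip (fst l - m0) (fst l - m0) \<le> 0"
    using G_gap[OF fl] sl u1_x0 by (cases l) simp
  then have "ip (fst l - m0) (fst l - m0) \<le> 0"
    using \<epsilon> by (simp add: field_simps)
  then have "coef (fst l - m0) k = 0" for k
    by (rule ip_eq_0_coef)
  then have "\<forall>k. coef (fst l) k = coef m0 k"
    by (simp add: coef_linear)
  then have "fst l = m0"
    using sep by (simp add: separates_measures_def)
  then have "l = (m0, x0)"
    using sl by (cases l) simp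
  then show ?thesis
    using r by (auto simp: o_def intro!: exI[of _ r])
qed

end

section \<open>Test functions on states and their derivatives\<close>

lemma matrix_mult_outer: "(\<chi> i j. h $ i * h $ j) *v v = (h \<bullet> v) *\<^sub>R (h :: real ^ 'n)"
  by (simp add: matrix_vector_mult_def vec_eq_iff inner_vec_def sum_distrib_left mult_ac)

lemma matrix_mult_scaleR_id: "(r *\<^sub>R mat 1) *v v = r *\<^sub>R (v :: real ^ 'n)"
  by (simp add: scaleR_matrix_vector_assoc[symmetric])

lemma continuous_on_vec_lambda2:
  fixes A :: "'a::topological_space \<Rightarrow> 'm::finite \<Rightarrow> 'n::finite \<Rightarrow> real"
  assumes "\<And>i j. continuous_on S (\<lambda>x. A x i j)"
  shows "continuous_on S (\<lambda>x. \<chi> i j. A x i j)"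
  by (intro continuous_on_vec_lambda assms)

context penalized begin

text \<open>
  The quartic term turns a local jet of a function that is bounded above into a global majorant
  without changing the jet.
\<close>

definition quartic :: "real ^ 'n \<Rightarrow> (real ^ 'n \<Rightarrow> real ^ 'n) \<Rightarrow> real \<Rightarrow> real \<Rightarrow> real ^ 'n \<Rightarrow> real" where
  "quartic q X \<delta> K h = q \<bullet> h + h \<bullet> X h / 2 + \<delta> * (h \<bullet> h) + K * (h \<bullet> h)\<^sup>2"

definition quartic_grad :: "real ^ 'n \<Rightarrow> (real ^ 'n \<Rightarrow> real ^ 'n) \<Rightarrow> real \<Rightarrow> real \<Rightarrow> real ^ 'n \<Rightarrow> real ^ 'n" where
  "quartic_grad q X \<delta> K h = q + X h + (2 * \<delta>) *\<^sub>R h + (4 * K * (h \<bullet> h)) *\<^sub>R h"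

definition quartic_hess :: "(real ^ 'n \<Rightarrow> real ^ 'n) \<Rightarrow> real \<Rightarrow> real \<Rightarrow> real ^ 'n \<Rightarrow> real ^ 'n ^ 'n" where
  "quartic_hess X \<delta> K h = matrix X + (2 * \<delta> + 4 * K * (h \<bullet> h)) *\<^sub>R mat 1 + (8 * K) *\<^sub>R (\<chi> i j. h $ i * h $ j)"

lemma quartic_derivative:
  assumes X: "linear X" "\<And>v w. v \<bullet> X w = X v \<bullet> w"
  shows "GDERIV (\<lambda>y. quartic q X \<delta> K (y - x1)) y :> quartic_grad q X \<delta> K (y - x1)"
proof -
  have Xd: "((\<lambda>y. X (y - x1)) has_derivative X) (at y)"
    by (rule bounded_linear.has_derivative[OF linear_conv_bounded_linear[THEN iffD1, OF X(1)], of "\<lambda>y. y - x1" "\<lambda>v. v", simplified])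
      (auto intro!: derivative_eq_intros)
  have "((\<lambda>y. quartic q X \<delta> K (y - x1)) has_derivative
      (\<lambda>v. q \<bullet> v + ((y - x1) \<bullet> X v + v \<bullet> X (y - x1)) / 2 + \<delta> * ((y - x1) \<bullet> v + v \<bullet> (y - x1))
         + K * ((2 * ((y - x1) \<bullet> v) + 2 * (v \<bullet> (y - x1))) * ((y - x1) \<bullet> (y - x1))))) (at y)"
    unfolding quartic_def by (rule derivative_eq_intros Xd refl | simp)+
  moreover have "q \<bullet> v + ((y - x1) \<bullet> X v + v \<bullet> X (y - x1)) / 2 + \<delta> * ((y - x1) \<bullet> v + v \<bullet> (y - x1))
         + K * ((2 * ((y - x1) \<bullet> v) + 2 * (v \<bullet> (y - x1))) * ((y - x1) \<bullet> (y - x1))) = v \<bullet> quartic_grad q X \<delta> K (y - x1)" for v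
    by (simp add: quartic_grad_def inner_add_right X(2)[of "y - x1" v] inner_commute[of _ v])
  ultimately show ?thesis
    by (simp add: gderiv_def)
qed

lemma quartic_grad_derivative:
  assumes X: "linear X"
  shows "((\<lambda>y. quartic_grad q X \<delta> K (y - x1)) has_derivative (\<lambda>v. quartic_hess X \<delta> K (y - x1) *v v)) (at y)"
proof -
  have Xd: "((\<lambda>y. X (y - x1)) has_derivative X) (at y)"
    by (rule bounded_linear.has_derivative[OF linear_conv_bounded_linear[THEN iffD1, OF X], of "\<lambda>y. y - x1" "\<lambda>v. v", simplified])
      (auto intro!: derivative_eq_intros)
  have "((\<lambda>y. quartic_grad q X \<delta> K (y - x1)) has_derivative
      (\<lambda>v. X v + (2 * \<delta>) *\<^sub>R v + ((4 * K * ((y - x1) \<bullet> (y - x1))) *\<^sub>R v + (4 * K * ((y - x1) \<bullet> v + v \<bullet> (y - x1))) *\<^sub>R (y - x1)))) (at y)"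
    unfolding quartic_grad_def by (rule derivative_eq_intros Xd refl | simp)+
  moreover have "X v + (2 * \<delta>) *\<^sub>R v + ((4 * K * ((y - x1) \<bullet> (y - x1))) *\<^sub>R v + (4 * K * ((y - x1) \<bullet> v + v \<bullet> (y - x1))) *\<^sub>R (y - x1))
      = quartic_hess X \<delta> K (y - x1) *v v" for v
    unfolding quartic_hess_def matrix_vector_mult_add_rdistrib matrix_mult_scaleR_id fun_cong[OF matrix_vector_mul(2)[OF X]]
      scaleR_matrix_vector_assoc[symmetric] matrix_mult_outer
    by (simp add: scaleR_add_left inner_commute[of v])
  ultimately show ?thesis
    by simp
qed

text \<open>\<open>pen\<close> is quadratic along \<open>dirac x\<close>, so the quotient is its
  linear coefficient plus a multiple of \<open>h\<close>.\<close>

lemma pen_occ_derivative: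
  "((\<lambda>h. (pen (\<mu> + h *\<^sub>R dirac x) - pen \<mu>) / h) \<longlongrightarrow> pot p x / \<epsilon> + 3 / \<epsilon> * pot (\<mu> - m0) x) (at_right 0)"
proof -
  let ?d = "dirac x"
  have quot: "(pen (\<mu> + h *\<^sub>R ?d) - pen \<mu>) / h = pot p x / \<epsilon> + 3 / \<epsilon> * pot (\<mu> - m0) x + h * (3 / (2 * \<epsilon>) * ip ?d ?d)"
    if "h > 0" for h
  proof -
    have "ip (\<mu> + h *\<^sub>R ?d - m0) (\<mu> + h *\<^sub>R ?d - m0) = ip (\<mu> - m0) (\<mu> - m0) + 2 * h * pot (\<mu> - m0) x + h\<^sup>2 * ip ?d ?d"
    proof -
      have "\<mu> + h *\<^sub>R ?d - m0 = (\<mu> - m0) + h *\<^sub>R ?d"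
        by simp
      then show ?thesis
        by (simp only: ip_add ip_scaleR ip_commute[of ?d "\<mu> - m0"] ip_dirac[of "\<mu> - m0" x])
          (simp add: power2_eq_square algebra_simps)
    qed
    moreover have "ip p (\<mu> + h *\<^sub>R ?d) = ip p \<mu> + h * pot p x"
      by (simp add: ip_add ip_scaleR ip_dirac)
    ultimately show ?thesis
      using that \<epsilon> by (simp add: pen_def field_simps power2_eq_square)
  qed
  have "((\<lambda>h. pot p x / \<epsilon> + 3 / \<epsilon> * pot (\<mu> - m0) x + h * (3 / (2 * \<epsilon>) * ip ?d ?d)) \<longlongrightarrow>
      pot p x / \<epsilon> + 3 / \<epsilon> * pot (\<mu> - m0) x + 0 * (3 / (2 * \<epsilon>) * ip ?d ?d)) (at_right 0)"
    by (intro tendsto_intros)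
  then have "((\<lambda>h. pot p x / \<epsilon> + 3 / \<epsilon> * pot (\<mu> - m0) x + h * (3 / (2 * \<epsilon>) * ip ?d ?d)) \<longlongrightarrow>
      pot p x / \<epsilon> + 3 / \<epsilon> * pot (\<mu> - m0) x) (at_right 0)"
    by simp
  moreover have "\<forall>\<^sub>F h in at_right 0. pot p x / \<epsilon> + 3 / \<epsilon> * pot (\<mu> - m0) x + h * (3 / (2 * \<epsilon>) * ip ?d ?d) = (pen (\<mu> + h *\<^sub>R ?d) - pen \<mu>) / h"
    unfolding eventually_at_right_field by (intro exI[of _ 1]) (auto simp: quot)
  ultimately show ?thesis
    by (rule Lim_transform_eventually)
qed

definition occ :: "'n state \<Rightarrow> real" where
  "occ \<xi> = pot p (snd \<xi>) / \<epsilon> + 3 / \<epsilon> * pot (fst \<xi> - m0) (snd \<xi>)"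

lemma continuous_occ: "continuous_on (M_plus \<times> UNIV) occ"
  unfolding occ_def
  by (intro continuous_intros continuous_on_compose2[OF continuous_pot]
      continuous_pot_diff[unfolded case_prod_beta']) (use \<epsilon> in auto)

lemma C12_test_function:
  assumes X: "linear X" "\<And>v w. v \<bullet> X w = X v \<bullet> w"
  shows "C12_with (\<lambda>\<xi>. b + quartic q X \<delta> K (snd \<xi> - x1) + pen (fst \<xi>)) occ
     (\<lambda>\<xi>. quartic_grad q X \<delta> K (snd \<xi> - x1)) (\<lambda>\<xi>. quartic_hess X \<delta> K (snd \<xi> - x1))"
proof -
  have D: "(Dom :: 'n state set) \<subseteq> M_plus \<times> UNIV"
    using M_q_M_plus by (auto simp: Dom_def)
  have cX: "continuous_on UNIV X"
    using X(1) by (simp add: linear_continuous_on linear_conv_bounded_linear)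
  note ci = continuous_intros continuous_on_compose2[OF cX] continuous_on_vec_lambda2
  have "continuous_on Dom (\<lambda>\<xi>::'n state. b + quartic q X \<delta> K (snd \<xi> - x1) + pen (fst \<xi>))"
    unfolding quartic_def by (intro ci continuous_on_compose2[OF continuous_pen]) (use D in auto)
  moreover have "continuous_on Dom occ"
    by (rule continuous_on_subset[OF continuous_occ D])
  moreover have "continuous_on Dom (\<lambda>\<xi>::'n state. quartic_grad q X \<delta> K (snd \<xi> - x1))"
    unfolding quartic_grad_def by (intro ci | simp)+
  moreover have "continuous_on Dom (\<lambda>\<xi>::'n state. quartic_hess X \<delta> K (snd \<xi> - x1))"
    unfolding quartic_hess_def by (intro ci | simp)+
  moreover have "has_occ_derivative (\<lambda>\<xi>. b + quartic q X \<delta> K (snd \<xi> - x1) + pen (fst \<xi>)) (occ (\<mu>, y)) (\<mu>, y)" for \<mu> y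
    using pen_occ_derivative by (simp add: has_occ_derivative_def occ_def)
  moreover have "GDERIV (\<lambda>y. b + quartic q X \<delta> K (y - x1) + pen \<mu>) y :> quartic_grad q X \<delta> K (y - x1)" for \<mu> y
    using quartic_derivative[OF X] unfolding gderiv_def by (auto intro!: derivative_eq_intros)
  ultimately show ?thesis
    using quartic_grad_derivative[OF X(1)] by (auto simp: C12_with_def)
qed

lemma upper_jet_global:
  assumes jet: "upper_jet u1 x1 q X" and "\<delta> > 0"
  shows "\<exists>K. \<forall>y. u1 y \<le> u1 x1 + quartic q X \<delta> K (y - x1)"
proof -
  have X: "linear X"
    using jet by (simp add: upper_jet_def)
  obtain \<tau> where \<tau>: "\<tau> > 0" "\<And>h. norm h < \<tau> \<Longrightarrow> u1 (x1 + h) \<le> u1 x1 + q \<bullet> h + h \<bullet> X h / 2 + \<delta> * (norm h)\<^sup>2"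
    using jet \<open>\<delta> > 0\<close> unfolding upper_jet_def by blast
  obtain C where C: "\<And>x. u1 x \<le> C" using u1_bounded by blast
  obtain B where B: "B > 0" "\<And>h. norm (X h) \<le> B * norm h"
    using linear_bounded_pos[OF X] by blast
  define C1 where "C1 = C - u1 x1"
  have "C1 \<ge> 0" using C[of x1] by (simp add: C1_def)
  \<comment> \<open>With \<open>s = norm h / \<tau>\<close>, which is at least 1 outside the ball,
    the three summands dominate the constant, linear and quadratic contributions, each by a multiple
    of \<open>s ^ 4\<close>.\<close>
  define K where "K = C1 / \<tau> ^ 4 + norm q / \<tau> ^ 3 + B / \<tau>\<^sup>2"
  have K: "K \<ge> 0" using \<tau>(1) B(1) \<open>C1 \<ge> 0\<close> by (simp add: K_def)
  have "u1 (x1 + h) \<le> u1 x1 + quartic q X \<delta> K h" for h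
  proof (cases "norm h < \<tau>")
    case True
    have "0 \<le> K * (h \<bullet> h)\<^sup>2" using K by simp
    then show ?thesis
      using \<tau>(2)[OF True] by (simp add: quartic_def power2_norm_eq_inner)
  next
    case False
    define s where "s = norm h / \<tau>"
    have s: "s \<ge> 1" using False \<tau>(1) by (simp add: s_def)
    have hs: "norm h = \<tau> * s" using \<tau>(1) by (simp add: s_def)
    have s4: "1 \<le> s ^ 4" "s \<le> s ^ 4" "s\<^sup>2 \<le> s ^ 4"
      using s power_increasing[of 1 4 s] power_increasing[of 2 4 s] by (auto simp: one_le_power)
    have "(h \<bullet> h)\<^sup>2 = \<tau> ^ 4 * s ^ 4"
      by (simp add: power2_norm_eq_inner[symmetric] hs power_mult_distrib flip: power_mult)
    then have "K * (h \<bullet> h)\<^sup>2 = C1 * s ^ 4 + norm q * \<tau> * s ^ 4 + B * \<tau>\<^sup>2 * s ^ 4"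
      using \<tau>(1) by (simp add: K_def field_simps power2_eq_square eval_nat_numeral)
    moreover have "C1 * 1 \<le> C1 * s ^ 4"
      using s4(1) \<open>C1 \<ge> 0\<close> by (intro mult_left_mono)
    moreover have "- (q \<bullet> h) \<le> norm q * \<tau> * s ^ 4"
    proof -
      have "- (q \<bullet> h) \<le> norm q * norm h"
        using norm_cauchy_schwarz[of "- q" h] by simp
      also have "\<dots> = norm q * \<tau> * s" by (simp add: hs)
      also have "\<dots> \<le> norm q * \<tau> * s ^ 4"
        using s4(2) \<tau>(1) by (intro mult_left_mono) auto
      finally show ?thesis .
    qed
    moreover have "- (h \<bullet> X h) / 2 \<le> B * \<tau>\<^sup>2 * s ^ 4"
    proof -
      have "- (h \<bullet> X h) \<le> norm h * norm (X h)"
        using norm_cauchy_schwarz[of "- h" "X h"] by simp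
      also have "\<dots> \<le> norm h * (B * norm h)"
        by (intro mult_left_mono B) auto
      also have "\<dots> = B * \<tau>\<^sup>2 * s\<^sup>2"
        by (simp add: hs power2_eq_square)
      also have "\<dots> \<le> B * \<tau>\<^sup>2 * s ^ 4"
        using s4(3) B(1) by (intro mult_left_mono) auto
      finally have "- (h \<bullet> X h) \<le> B * \<tau>\<^sup>2 * s ^ 4" .
      moreover have "0 \<le> B * \<tau>\<^sup>2 * s ^ 4" using B(1) by simp
      ultimately show ?thesis by linarith
    qed
    moreover have "0 \<le> \<delta> * (h \<bullet> h)" using \<open>\<delta> > 0\<close> by simp
    moreover have "u1 (x1 + h) \<le> u1 x1 + C1"
      using C by (simp add: C1_def)
    ultimately show ?thesis
      unfolding quartic_def by linarith
  qed
  from this[of "_ - x1"] show ?thesis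
    by (intro exI[of _ K]) simp
qed

text \<open>\<open>u - pen\<close> lies below \<open>u1\<close> with equality at a maximizing
  measure, so a majorant of \<open>u1\<close> plus \<open>pen\<close> touches \<open>u\<close> from
  above there. The slack \<delta> stays in the Hessian and disappears only in the closure of the
  semijet.\<close>

lemma semijet_of_upper_jet:
  assumes jet: "upper_jet u1 x1 q X" and "\<delta> > 0" and \<mu>: "\<mu> \<in> M_T" "G (\<mu>, x1) = u1 x1"
  shows "(occ (\<mu>, x1), q, matrix X + (2 * \<delta>) *\<^sub>R mat 1) \<in> semijet_plus T u (\<mu>, x1)"
proof -
  have X: "linear X" "\<And>v w. v \<bullet> X w = X v \<bullet> w"
    using jet by (simp_all add: upper_jet_def)
  obtain K where K: "\<And>y. u1 y \<le> u1 x1 + quartic q X \<delta> K (y - x1)"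
    using upper_jet_global[OF jet \<open>\<delta> > 0\<close>] by blast
  let ?\<phi> = "\<lambda>\<xi>::'n state. u1 x1 + quartic q X \<delta> K (snd \<xi> - x1) + pen (fst \<xi>)"
  let ?g = "\<lambda>\<xi>::'n state. quartic_grad q X \<delta> K (snd \<xi> - x1)" and ?H = "\<lambda>\<xi>::'n state. quartic_hess X \<delta> K (snd \<xi> - x1)"
  have "C12_with ?\<phi> occ ?g ?H"
    by (rule C12_test_function[OF X])
  moreover have "u (\<mu>, x1) - ?\<phi> (\<mu>, x1) = 0"
    using \<mu>(2) linear_0[OF X(1)] by (simp add: G_def quartic_def)
  moreover have "u \<zeta> - ?\<phi> \<zeta> \<le> 0" if "\<zeta> \<in> Dom_T T" for \<zeta>
    using G_le_u1[of "fst \<zeta>" "snd \<zeta>"] that K[of "snd \<zeta>"] by (simp add: Dom_T_M_T G_def)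
  moreover have "?g (\<mu>, x1) = q"
    using linear_0[OF X(1)] by (simp add: quartic_grad_def)
  moreover have "?H (\<mu>, x1) = matrix X + (2 * \<delta>) *\<^sub>R mat 1"
    by (simp add: quartic_hess_def vec_eq_iff)
  ultimately show ?thesis
    unfolding semijet_plus_def mem_Collect_eq
    by (intro exI[of _ ?\<phi>] exI[of _ occ] exI[of _ ?g] exI[of _ ?H]) simp
qed

text \<open>Maximizing measures above the jet points converge to \<open>m0\<close> along a
  subsequence. The occupation derivatives tend to the value at \<open>m0\<close>, where the
  quadratic part of \<open>pen\<close> contributes nothing, and \<open>u\<close> converges along the
  sequence because \<open>u1\<close> and \<open>pen\<close> do.\<close>

theorem closed_semijet_of_limit:
  assumes X: "xs \<longlonglongrightarrow> x0" "(\<lambda>n. u1 (xs n)) \<longlonglongrightarrow> u1 x0"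
    and jet: "\<And>n. upper_jet u1 (xs n) (qs n) (Xs n)"
    and lim: "qs \<longlonglongrightarrow> q" "(\<lambda>n. matrix (Xs n)) \<longlonglongrightarrow> \<Gamma>"
  shows "(pot p x0 / \<epsilon>, q, \<Gamma>) \<in> closed_semijet_plus T u (m0, x0)"
proof -
  define \<mu> where "\<mu> = (\<lambda>n. argmax (xs n))"
  have \<mu>: "\<mu> n \<in> M_T" "G (\<mu> n, xs n) = u1 (xs n)" for n
    by (simp_all add: \<mu>_def argmax)
  obtain r where r: "strict_mono r" "(\<lambda>n. (\<mu> (r n), xs (r n))) \<longlonglongrightarrow> (m0, x0)"
    using maximizers_converge[OF \<mu> X] by blast
  define \<xi>s where "\<xi>s = (\<lambda>n. (\<mu> (r n), xs (r n)))"
  define d where "d = (\<lambda>n. 1 / real (Suc n))"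
  define \<zeta>s where "\<zeta>s = (\<lambda>n. (occ (\<xi>s n), qs (r n), matrix (Xs (r n)) + (2 * d n) *\<^sub>R mat 1 :: real ^ 'n ^ 'n))"
  have \<xi>: "\<xi>s \<longlonglongrightarrow> (m0, x0)" "\<And>n. \<xi>s n \<in> Dom_T T"
    using r(2) \<mu>(1) by (auto simp: \<xi>s_def Dom_T_M_T)
  have d: "d \<longlonglongrightarrow> 0"
    unfolding d_def by (rule LIMSEQ_Suc[OF lim_1_over_n])
  have sub: "(\<lambda>n. a (r n)) \<longlonglongrightarrow> l" if "a \<longlonglongrightarrow> l" for a :: "nat \<Rightarrow> 'b::topological_space" and l
    using LIMSEQ_subseq_LIMSEQ[OF that r(1)] by (simp add: o_def)
  have "\<zeta>s n \<in> semijet_plus T u (\<xi>s n)" for n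
    unfolding \<zeta>s_def \<xi>s_def by (rule semijet_of_upper_jet[OF jet _ \<mu>]) (simp add: d_def)
  moreover have "(\<lambda>n. u (\<xi>s n)) \<longlonglongrightarrow> u (m0, x0)"
  proof -
    have "(\<lambda>n. u1 (xs (r n)) + pen (fst (\<xi>s n))) \<longlonglongrightarrow> u1 x0 + pen (fst (m0, x0))"
      by (intro tendsto_add sub X pen_tendsto \<xi> base)
    moreover have "u1 (xs (r n)) + pen (fst (\<xi>s n)) = u (\<xi>s n)" for n
      using \<mu>(2)[of "r n"] by (simp add: G_def \<xi>s_def)
    ultimately show ?thesis
      using u1_x0 by (simp add: G_def)
  qed
  moreover have "\<zeta>s \<longlonglongrightarrow> (pot p x0 / \<epsilon>, q, \<Gamma>)"
  proof -
    have "(\<lambda>n. occ (\<xi>s n)) \<longlonglongrightarrow> occ (m0, x0)"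
      by (rule continuous_on_tendsto_compose[OF continuous_occ \<xi>(1)])
        (use m0 \<xi>(2) in \<open>auto intro!: always_eventually M_T_M_plus simp: Dom_T_M_T mem_Times_iff\<close>)
    moreover have "occ (m0, x0) = pot p x0 / \<epsilon>"
      unfolding occ_def fst_conv snd_conv pot_linear(1) by simp
    moreover have "(\<lambda>n. matrix (Xs (r n)) + (2 * d n) *\<^sub>R mat 1) \<longlonglongrightarrow> \<Gamma> + (2 * 0) *\<^sub>R (mat 1 :: real ^ 'n ^ 'n)"
      by (intro tendsto_intros sub[OF lim(2)] d)
    ultimately show ?thesis
      unfolding \<zeta>s_def by (intro tendsto_Pair sub lim) simp_all
  qed
  ultimately show ?thesis
    unfolding closed_semijet_plus_def semijet_closure_def mem_Collect_eq
    using \<xi> by (intro exI[of _ \<zeta>s] exI[of _ \<xi>s]) auto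
qed

end

section \<open>Sign reversal, matrix limits and translation of jets\<close>

lemma C1b_continuous: "g \<in> C1b \<Longrightarrow> continuous_on UNIV g"
  by (auto simp: C1b_def gderiv_def continuous_on_eq_continuous_at intro: has_derivative_continuous)

lemma C1b_abs_le_norm:
  assumes "g \<in> C1b"
  shows "\<bar>g x\<bar> \<le> C1_norm g"
proof -
  have "bounded (range g)" "bounded (range (grad g))"
    using assms by (auto simp: C1b_def)
  then have bdd: "bdd_above (range (\<lambda>x. \<bar>g x\<bar>))" "bdd_above (range (\<lambda>x. norm (grad g x)))"
    by (auto simp: bounded_iff bdd_above_def)
  have "\<bar>g x\<bar> \<le> (SUP x. \<bar>g x\<bar>)"
    by (rule cSUP_upper[OF UNIV_I bdd(1)])
  moreover have "0 \<le> norm (grad g x)" by simp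
  moreover have "norm (grad g x) \<le> (SUP x. norm (grad g x))"
    by (rule cSUP_upper[OF UNIV_I bdd(2)])
  ultimately show ?thesis
    unfolding C1_norm_def by linarith
qed

lemma C12_with_uminus:
  assumes "C12_with \<phi> a g H"
  shows "C12_with (\<lambda>\<xi>. - \<phi> \<xi>) (\<lambda>\<xi>. - a \<xi>) (\<lambda>\<xi>. - g \<xi>) (\<lambda>\<xi>. - H \<xi>)"
proof -
  have occ: "has_occ_derivative (\<lambda>\<xi>. - \<phi> \<xi>) (- l) (\<nu>, x)" if "has_occ_derivative \<phi> l (\<nu>, x)" for l \<nu> x
  proof -
    have "((\<lambda>h. - ((\<phi> (\<nu> + h *\<^sub>R dirac x, x) - \<phi> (\<nu>, x)) / h)) \<longlongrightarrow> - l) (at_right 0)"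
      using that by (intro tendsto_minus) (simp add: has_occ_derivative_def)
    moreover have "- ((\<phi> (\<nu> + h *\<^sub>R dirac x, x) - \<phi> (\<nu>, x)) / h) = (- \<phi> (\<nu> + h *\<^sub>R dirac x, x) - - \<phi> (\<nu>, x)) / h" for h
      by (simp add: minus_divide_left)
    ultimately show ?thesis
      by (simp add: has_occ_derivative_def)
  qed
  have gd: "GDERIV (\<lambda>y. - F y) x :> - D" if "GDERIV F x :> D" for F and D x :: "real ^ 'n"
    using has_derivative_minus[OF that[unfolded gderiv_def]] by (simp add: gderiv_def)
  have hd: "((\<lambda>y. - F y) has_derivative (\<lambda>v. (- A) *v v)) (at x)"
    if "(F has_derivative (\<lambda>v. A *v v)) (at x)" for F and A :: "real ^ 'n ^ 'n" and x
  proof -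
    have "(- A) *v v = - (A *v v)" for v
      by (simp add: matrix_vector_mult_def vec_eq_iff sum_negf)
    then show ?thesis
      using has_derivative_minus[OF that] by simp
  qed
  show ?thesis
    using assms unfolding C12_with_def
    by (auto intro!: continuous_on_minus occ gd hd)
qed

lemma semijet_plus_uminus:
  assumes "(a, g, H) \<in> semijet_plus T (\<lambda>\<xi>. - w \<xi>) \<xi>"
  shows "(- a, - g, - H) \<in> semijet_minus T w \<xi>"
proof -
  obtain \<phi> a' g' H' where 1: "C12_with \<phi> a' g' H'" "a = a' \<xi>" "g = g' \<xi>" "H = H' \<xi>"
    and 2: "- w \<xi> - \<phi> \<xi> = 0" "\<And>\<zeta>. \<zeta> \<in> Dom_T T \<Longrightarrow> - w \<zeta> - \<phi> \<zeta> \<le> 0"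
    using assms unfolding semijet_plus_def by blast
  have "w \<xi> - - \<phi> \<xi> = 0" "\<And>\<zeta>. \<zeta> \<in> Dom_T T \<Longrightarrow> 0 \<le> w \<zeta> - - \<phi> \<zeta>"
    using 2 by force+
  then show ?thesis
    unfolding semijet_minus_def mem_Collect_eq 1(2-4)
    using C12_with_uminus[OF 1(1)]
    by (intro exI[of _ "\<lambda>\<xi>. - \<phi> \<xi>"] exI[of _ "\<lambda>\<xi>. - a' \<xi>"] exI[of _ "\<lambda>\<xi>. - g' \<xi>"] exI[of _ "\<lambda>\<xi>. - H' \<xi>"]) simp
qed

lemma closed_semijet_plus_uminus:
  assumes "(a, g, H) \<in> closed_semijet_plus T (\<lambda>\<xi>. - w \<xi>) \<xi>"
  shows "(- a, - g, - H) \<in> closed_semijet_minus T w \<xi>"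
proof -
  obtain \<zeta>s \<xi>s where s: "\<And>n::nat. \<xi>s n \<in> Dom_T T" "\<And>n. \<zeta>s n \<in> semijet_plus T (\<lambda>\<xi>. - w \<xi>) (\<xi>s n)"
    "\<xi>s \<longlonglongrightarrow> \<xi>" "(\<lambda>n. - w (\<xi>s n)) \<longlonglongrightarrow> - w \<xi>" "\<zeta>s \<longlonglongrightarrow> (a, g, H)"
    using assms unfolding closed_semijet_plus_def semijet_closure_def by blast
  have "- \<zeta>s n \<in> semijet_minus T w (\<xi>s n)" for n
    using semijet_plus_uminus[of "fst (\<zeta>s n)" "fst (snd (\<zeta>s n))" "snd (snd (\<zeta>s n))"] s(2)[of n]
    by (cases "\<zeta>s n") simp
  moreover have "(\<lambda>n. w (\<xi>s n)) \<longlonglongrightarrow> w \<xi>"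
    using tendsto_minus[OF s(4)] by simp
  moreover have "(\<lambda>n. - \<zeta>s n) \<longlonglongrightarrow> (- a, - g, - H)"
    using tendsto_minus[OF s(5)] by simp
  ultimately show ?thesis
    unfolding closed_semijet_minus_def semijet_closure_def mem_Collect_eq
    using s(1,3) by (intro exI[of _ "\<lambda>n. - \<zeta>s n"] exI[of _ \<xi>s]) blast
qed

lemma sum_UNIV_Plus: "(\<Sum>i\<in>UNIV. F i) = (\<Sum>k\<in>UNIV. F (Inl k)) + (\<Sum>k\<in>UNIV. F (Inr k))"
  for F :: "'a::finite + 'b::finite \<Rightarrow> real"
  by (simp add: UNIV_Plus_UNIV[symmetric] sum.Plus del: UNIV_Plus_UNIV)

lemma block_matrix_quadratic:
  fixes v :: "real ^ ('n::finite + 'n)"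
  defines "a \<equiv> \<chi> k. v $ Inl k" and "b \<equiv> \<chi> k. v $ Inr k"
  shows "v \<bullet> (block_matrix A B C D *v v) = a \<bullet> (A *v a) + a \<bullet> (B *v b) + b \<bullet> (C *v a) + b \<bullet> (D *v b)"
  by (simp add: block_matrix_def matrix_vector_mult_def inner_vec_def sum_UNIV_Plus a_def b_def
      distrib_left sum.distrib)

text \<open>Polarization at pairs of axis vectors bounds every entry. This gives the compactness by
  which Hessians of approximating jets converge along a subsequence.\<close>

lemma bounded_quadratic_matrix:
  fixes X :: "real ^ 'n \<Rightarrow> real ^ 'n::finite"
  assumes X: "linear X" "\<And>v w. v \<bullet> X w = X v \<bullet> w" and q: "\<And>h. \<bar>h \<bullet> X h\<bar> \<le> C * (norm h)\<^sup>2"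
  shows "norm (matrix X) \<le> real CARD('n) * real CARD('n) * C"
proof -
  have entry: "\<bar>matrix X $ i $ j\<bar> \<le> C" for i j
  proof -
    let ?v = "axis i 1 :: real ^ 'n" and ?w = "axis j 1 :: real ^ 'n"
    have "4 * (?v \<bullet> X ?w) = (?v + ?w) \<bullet> X (?v + ?w) - (?v - ?w) \<bullet> X (?v - ?w)"
      using X(2)[of ?w ?v] by (simp add: linear_add[OF X(1)] linear_diff[OF X(1)] inner_add_left inner_add_right
          inner_diff_left inner_diff_right inner_commute[of "X ?w" ?v])
    moreover have "C * (norm (?v + ?w))\<^sup>2 + C * (norm (?v - ?w))\<^sup>2 = 4 * C"
      by (simp add: norm_sq_add norm_sq_diff algebra_simps)
    ultimately have "\<bar>?v \<bullet> X ?w\<bar> \<le> C"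
      using q[of "?v + ?w"] q[of "?v - ?w"] by linarith
    then show ?thesis
      by (simp add: matrix_def inner_axis')
  qed
  have "norm (matrix X) \<le> (\<Sum>i\<in>UNIV. norm (matrix X $ i))"
    unfolding norm_vec_def by (rule L2_set_le_sum) simp
  also have "\<dots> \<le> (\<Sum>i\<in>UNIV. \<Sum>j\<in>UNIV. \<bar>matrix X $ i $ j\<bar>)"
    by (intro sum_mono norm_le_l1_cart)
  also have "\<dots> \<le> (\<Sum>i\<in>(UNIV :: 'n set). \<Sum>j\<in>(UNIV :: 'n set). C)"
    by (intro sum_mono entry)
  finally show ?thesis
    by simp
qed

lemma symmetric_matrix_of_self_adjoint:
  fixes X :: "real ^ 'n \<Rightarrow> real ^ 'n::finite"
  assumes "\<And>v w. v \<bullet> X w = X v \<bullet> w"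
  shows "transpose (matrix X) = matrix X"
proof -
  have "X (axis i 1) $ j = X (axis j 1) $ i" for i j
    using assms[of "axis j 1" "axis i 1"] by (simp add: inner_axis inner_axis')
  then show ?thesis
    by (simp add: vec_eq_iff transpose_def matrix_def)
qed

lemma sym_matrices_limit:
  fixes A :: "nat \<Rightarrow> real ^ 'n ^ 'n"
  assumes "A \<longlonglongrightarrow> \<Gamma>" "\<And>n. transpose (A n) = A n"
  shows "\<Gamma> \<in> sym_matrices"
proof -
  have lim: "(\<lambda>n. A n $ i $ j) \<longlonglongrightarrow> \<Gamma> $ i $ j" for i j
    by (intro tendsto_vec_nth assms(1))
  have "A n $ j $ i = A n $ i $ j" for n i j
    using assms(2)[of n] by (simp add: vec_eq_iff transpose_def)
  then have "(\<lambda>n. A n $ i $ j) \<longlonglongrightarrow> \<Gamma> $ j $ i" for i j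
    using lim[of j i] by simp
  then have "\<Gamma> $ i $ j = \<Gamma> $ j $ i" for i j
    using lim LIMSEQ_unique by blast
  then show ?thesis
    by (simp add: sym_matrices_def vec_eq_iff transpose_def)
qed

lemma matrix_vector_tendsto:
  fixes A :: "nat \<Rightarrow> real ^ 'n ^ 'n"
  assumes "A \<longlonglongrightarrow> \<Gamma>"
  shows "(\<lambda>n. h \<bullet> (A n *v h)) \<longlonglongrightarrow> h \<bullet> (\<Gamma> *v h)"
proof -
  have "linear (\<lambda>A :: real ^ 'n ^ 'n. A *v h)"
    by (intro linearI) (simp_all add: matrix_vector_mult_add_rdistrib scaleR_matrix_vector_assoc)
  then have "bounded_linear (\<lambda>A :: real ^ 'n ^ 'n. A *v h)"
    by (simp add: linear_conv_bounded_linear)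
  then show ?thesis
    by (intro tendsto_intros bounded_linear.tendsto[OF _ assms])
qed

lemma upper_jet_shift:
  assumes "upper_jet (\<lambda>h. F (x + h) - k - d \<bullet> h) h0 p X"
  shows "upper_jet F (x + h0) (d + p) X"
proof -
  have "\<exists>\<tau>>0. \<forall>h. norm h < \<tau> \<longrightarrow> F (x + h0 + h) \<le> F (x + h0) + (d + p) \<bullet> h + h \<bullet> X h / 2 + \<delta> * (norm h)\<^sup>2"
    if \<delta>: "\<delta> > 0" for \<delta>
  proof -
    obtain \<tau> where \<tau>: "\<tau> > 0" "\<And>h. norm h < \<tau> \<Longrightarrow>
        F (x + (h0 + h)) - k - d \<bullet> (h0 + h) \<le> F (x + h0) - k - d \<bullet> h0 + p \<bullet> h + h \<bullet> X h / 2 + \<delta> * (norm h)\<^sup>2"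
      using assms \<delta> unfolding upper_jet_def by blast
    have "F (x + h0 + h) \<le> F (x + h0) + (d + p) \<bullet> h + h \<bullet> X h / 2 + \<delta> * (norm h)\<^sup>2" if "norm h < \<tau>" for h
      using \<tau>(2)[OF that] by (simp add: inner_add_left inner_add_right add.assoc)
    then show ?thesis
      using \<tau>(1) by blast
  qed
  then show ?thesis
    using assms unfolding upper_jet_def by blast
qed

theorem lemma5p1:
  fixes f :: "nat \<Rightarrow> real ^ 'n \<Rightarrow> real"
    and T \<epsilon> :: real
    and u w :: "(real ^ 'n) signed_measure \<times> (real ^ 'n) \<Rightarrow> real"
    and \<mu> \<nu> :: "(real ^ 'n) signed_measure"
    and x y :: "real ^ 'n"
  assumes "T > 0"
    and "\<And>k. f k \<in> C1b"
    and "separates_measures f"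
    and "\<exists>c. c \<noteq> 0 \<and> f 0 = (\<lambda>_. c)"
    and "summable (\<lambda>k. (C1_norm (f k))\<^sup>2)"
    and "(\<Sum>k. (C1_norm (f k))\<^sup>2) \<le> 1"
    and "usc_on (Dom_T T) u" and "upper_coercive_on (Dom_T T) u"
    and "lsc_on (Dom_T T) w" and "lower_coercive_on (Dom_T T) w"
    and "\<epsilon> > 0"
    and "(\<mu>, x) \<in> Dom_T T" and "(\<nu>, y) \<in> Dom_T T"
    and "\<And>\<xi> \<zeta>. \<xi> \<in> Dom_T T \<Longrightarrow> \<zeta> \<in> Dom_T T \<Longrightarrow>
           doubled f u w \<epsilon> \<xi> \<zeta> \<le> doubled f u w \<epsilon> (\<mu>, x) (\<nu>, y)"
  shows "Theta f \<epsilon> \<mu> \<nu> \<in> Cb \<and>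
    is_linear_derivative M_q (\<lambda>\<sigma>. 1 / (2 * \<epsilon>) * (varrho f (\<sigma> - \<nu>))\<^sup>2) (\<lambda>\<sigma>. Theta f \<epsilon> \<sigma> \<nu>) \<and>
    (\<exists>\<Gamma>1 \<in> sym_matrices. \<exists>\<Gamma>2 \<in> sym_matrices.
       (Theta f \<epsilon> \<mu> \<nu> x, (1 / \<epsilon>) *\<^sub>R (x - y), \<Gamma>1) \<in> closed_semijet_plus T u (\<mu>, x) \<and>
       (Theta f \<epsilon> \<mu> \<nu> y, (1 / \<epsilon>) *\<^sub>R (x - y), \<Gamma>2) \<in> closed_semijet_minus T w (\<nu>, y) \<and>
       quad_le (- (3 / \<epsilon>) *\<^sub>R block_matrix (mat 1) 0 0 (mat 1)) (block_matrix \<Gamma>1 0 0 (- \<Gamma>2)) \<and>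
       quad_le (block_matrix \<Gamma>1 0 0 (- \<Gamma>2))
         ((3 / \<epsilon>) *\<^sub>R block_matrix (mat 1) (- mat 1) (- mat 1) (mat 1)))"
proof -
  interpret test_family f "\<lambda>k. C1_norm (f k)"
    using assms(2,5) by unfold_locales (auto intro: C1b_continuous C1b_abs_le_norm)
  note \<epsilon> = \<open>\<epsilon> > 0\<close>
  define p where "p = \<mu> - \<nu>"
  define \<Delta> where "\<Delta> = (1 / \<epsilon>) *\<^sub>R (x - y)"
  define I where "I = (\<lambda>\<sigma> m. ip (\<sigma> - m) (\<sigma> - m) / \<epsilon>)"
  have I_self: "I m m = 0" and I_nonneg: "0 \<le> I \<sigma> m" for \<sigma> m
    using \<epsilon> ip_nonneg by (simp_all add: I_def) (simp add: ip_def coef_linear)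
  have I_eq: "I \<sigma> m = ip (\<sigma> - m) (\<sigma> - m) / \<epsilon>" for \<sigma> m
    by (simp add: I_def)
  have key: "(u (\<sigma>, a) - ip p \<sigma> / \<epsilon> - I \<sigma> \<mu>) + (- w (\<zeta>, b) + ip p \<zeta> / \<epsilon> - I \<zeta> \<nu>)
      \<le> (u (\<mu>, x) - ip p \<mu> / \<epsilon>) + (- w (\<nu>, y) + ip p \<nu> / \<epsilon>) + ((norm (a - b))\<^sup>2 - (norm (x - y))\<^sup>2) / (2 * \<epsilon>)"
    if "(\<sigma>, a) \<in> Dom_T T" "(\<zeta>, b) \<in> Dom_T T" for \<sigma> \<zeta> a b
  proof -
    define A where "A = \<sigma> - \<mu>"
    define B where "B = \<zeta> - \<nu>"
    have s: "\<sigma> - \<zeta> = p + (A - B)"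
      by (simp add: A_def B_def p_def)
    \<comment> \<open>Equivalent to |A - B|^2 \<le> 2|A|^2 + 2|B|^2. It removes the only term that
      couples the two measures after expansion around \<open>p\<close>.\<close>
    have "0 \<le> ip (A + B) (A + B)"
      by (rule ip_nonneg)
    then have "ip (\<sigma> - \<zeta>) (\<sigma> - \<zeta>) \<le> ip p p + 2 * ip p A - 2 * ip p B + 2 * ip A A + 2 * ip B B"
      unfolding s by (simp add: ip_add ip_diff ip_commute[of A p] ip_commute[of B p] ip_commute[of B A])
    then have "ip (\<sigma> - \<zeta>) (\<sigma> - \<zeta>) / (2 * \<epsilon>) \<le> (ip p p + 2 * ip p A - 2 * ip p B + 2 * ip A A + 2 * ip B B) / (2 * \<epsilon>)"
      using \<epsilon> by (intro divide_right_mono) auto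
    also have "\<dots> = ip p p / (2 * \<epsilon>) + ip p \<sigma> / \<epsilon> - ip p \<mu> / \<epsilon> - ip p \<zeta> / \<epsilon> + ip p \<nu> / \<epsilon> + I \<sigma> \<mu> + I \<zeta> \<nu>"
      using \<epsilon> by (simp add: I_def A_def[symmetric] B_def[symmetric] add_divide_distrib diff_divide_distrib)
        (simp add: A_def B_def ip_diff diff_divide_distrib)
    finally have "ip (\<sigma> - \<zeta>) (\<sigma> - \<zeta>) / (2 * \<epsilon>) \<le> ip p p / (2 * \<epsilon>) + ip p \<sigma> / \<epsilon> - ip p \<mu> / \<epsilon> - ip p \<zeta> / \<epsilon> + ip p \<nu> / \<epsilon> + I \<sigma> \<mu> + I \<zeta> \<nu>" .
    moreover have "u (\<sigma>, a) - w (\<zeta>, b) - (ip (\<sigma> - \<zeta>) (\<sigma> - \<zeta>) / (2 * \<epsilon>) + (norm (a - b))\<^sup>2 / (2 * \<epsilon>))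
        \<le> u (\<mu>, x) - w (\<nu>, y) - (ip p p / (2 * \<epsilon>) + (norm (x - y))\<^sup>2 / (2 * \<epsilon>))"
      using assms(14)[OF that] by (simp add: doubled_def rho_def varrho_sq ip_nonneg p_def add_divide_distrib)
    ultimately show ?thesis
      by (simp add: diff_divide_distrib)
  qed
  have usc_w: "usc_on (Dom_T T) (\<lambda>\<xi>. - w \<xi>)"
    using assms(9) unfolding usc_on_def lsc_on_def by (metis (no_types, lifting) Collect_cong minus_less_iff)
  have co_w: "upper_coercive_on (Dom_T T) (\<lambda>\<xi>. - w \<xi>)"
    unfolding upper_coercive_on_def
  proof (intro allI impI)
    fix b and \<xi> :: "nat \<Rightarrow> 'n state" assume "\<forall>n. \<xi> n \<in> Dom_T T \<and> b \<le> - w (\<xi> n)"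
    then have "\<forall>n. \<xi> n \<in> Dom_T T \<and> w (\<xi> n) \<le> - b"
      by (simp add: le_minus_iff)
    then show "\<exists>r l. strict_mono r \<and> l \<in> Dom_T T \<and> (\<xi> \<circ> r) \<longlonglongrightarrow> l"
      using assms(10) unfolding lower_coercive_on_def by blast
  qed
  interpret P1: penalized f "\<lambda>k. C1_norm (f k)" T \<epsilon> u p \<mu> x
  proof
    fix \<sigma> assume "(\<sigma>, x) \<in> Dom_T T"
    from key[OF this assms(13)]
    show "u (\<sigma>, x) - ip p \<sigma> / \<epsilon> - ip (\<sigma> - \<mu>) (\<sigma> - \<mu>) / \<epsilon> \<le> u (\<mu>, x) - ip p \<mu> / \<epsilon>"
      unfolding I_self I_eq[of \<sigma>] by simp
  qed (use assms in auto)
  \<comment> \<open>For \<open>- w\<close> the linear term has the opposite sign, hence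
    \<open>- p\<close>; negating the jets at the end restores the common \<Theta> and
    \<Delta>.\<close>
  interpret P2: penalized f "\<lambda>k. C1_norm (f k)" T \<epsilon> "\<lambda>\<xi>. - w \<xi>" "- p" \<nu> y
  proof
    fix \<sigma> assume "(\<sigma>, y) \<in> Dom_T T"
    from key[OF assms(12) this]
    show "- w (\<sigma>, y) - ip (- p) \<sigma> / \<epsilon> - ip (\<sigma> - \<nu>) (\<sigma> - \<nu>) / \<epsilon> \<le> - w (\<nu>, y) - ip (- p) \<nu> / \<epsilon>"
      unfolding I_self I_eq[of \<sigma>] ip_uminus by simp
  qed (use assms usc_w co_w in auto)
  \<comment> \<open>At the attained measures the penalties are \<open>3 / 2\<close> times
    \<open>I\<close>, so they dominate the single \<open>I\<close> required by
    \<open>key\<close>.\<close>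
  have le: "P1.u1 a + P2.u1 b \<le> P1.u1 x + P2.u1 y + ((norm (a - b))\<^sup>2 - (norm (x - y))\<^sup>2) / (2 * \<epsilon>)" for a b
  proof -
    define \<sigma> where "\<sigma> = P1.argmax a"
    define \<zeta> where "\<zeta> = P2.argmax b"
    have h: "3 / (2 * \<epsilon>) * z = 3 / 2 * (z / \<epsilon>)" for z
      by simp
    have "P1.u1 a = u (\<sigma>, a) - ip p \<sigma> / \<epsilon> - 3 / 2 * I \<sigma> \<mu>"
      using P1.argmax(2)[of a] unfolding \<sigma>_def[symmetric] P1.G_def P1.pen_def h I_def by simp
    moreover have "P2.u1 b = - w (\<zeta>, b) + ip p \<zeta> / \<epsilon> - 3 / 2 * I \<zeta> \<nu>"
      using P2.argmax(2)[of b] unfolding \<zeta>_def[symmetric] P2.G_def P2.pen_def h I_def ip_uminus by simp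
    moreover have "P1.u1 x = u (\<mu>, x) - ip p \<mu> / \<epsilon>"
      using I_self[of \<mu>] unfolding P1.u1_x0 P1.G_def P1.pen_def h I_def by simp
    moreover have "P2.u1 y = - w (\<nu>, y) + ip p \<nu> / \<epsilon>"
      using I_self[of \<nu>] unfolding P2.u1_x0 P2.G_def P2.pen_def h I_def ip_uminus by simp
    moreover have "(\<sigma>, a) \<in> Dom_T T" "(\<zeta>, b) \<in> Dom_T T"
      using P1.argmax(1)[of a] P2.argmax(1)[of b] by (simp_all add: \<sigma>_def \<zeta>_def P1.Dom_T_M_T P2.Dom_T_M_T)
    ultimately show ?thesis
      using key[of \<sigma> a \<zeta> b] I_nonneg[of \<sigma> \<mu>] I_nonneg[of \<zeta> \<nu>] by linarith
  qed
  \<comment> \<open>Subtracting values and the slopes \<open>\<Delta>\<close>,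
    \<open>- \<Delta>\<close> moves the maximum to the origin: the linear part of
    \<open>|x + h - (y + k)|^2 / (2 * \<epsilon>)\<close> is exactly
    \<open>\<Delta> \<bullet> (h - k)\<close>.\<close>
  define U where "U = (\<lambda>h. P1.u1 (x + h) - P1.u1 x - \<Delta> \<bullet> h)"
  define V where "V = (\<lambda>h. P2.u1 (y + h) - P2.u1 y - (- \<Delta>) \<bullet> h)"
  have UV: "U h + V k \<le> 1 / \<epsilon> / 2 * (norm (h - k))\<^sup>2" for h k
  proof -
    have "(norm (x + h - (y + k)))\<^sup>2 = (norm (x - y))\<^sup>2 + 2 * ((x - y) \<bullet> (h - k)) + (norm (h - k))\<^sup>2"
      using norm_sq_add[of "x - y" "h - k"] by (simp add: algebra_simps)
    then have "((norm (x + h - (y + k)))\<^sup>2 - (norm (x - y))\<^sup>2) / (2 * \<epsilon>) = \<Delta> \<bullet> (h - k) + 1 / \<epsilon> / 2 * (norm (h - k))\<^sup>2"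
      using \<epsilon> unfolding \<Delta>_def inner_scaleR_left by (simp add: field_simps del: inner_diff_left)
    then show ?thesis
      using le[of "x + h" "y + k"] by (simp add: U_def V_def inner_diff_right)
  qed
  have zero: "U 0 = 0" "V 0 = 0"
    by (simp_all add: U_def V_def)
  have shift: "closed {h. b \<le> F (z + h) - k - d \<bullet> h}"
    if "\<And>b. closed {x. b \<le> F x}" for b k and F :: "real ^ 'n \<Rightarrow> real" and z d
  proof -
    have "closed {h. b \<le> F (z + h)}" for b
      using closed_vimage[OF that[of b], of "\<lambda>h. z + h"] by (simp add: vimage_def continuous_intros)
    then have "closed {h. b \<le> F (z + h) + (- k - d \<bullet> h)}"
      by (rule usc_add_continuous) (intro continuous_intros)
    then show ?thesis
      by (simp add: algebra_simps)
  qed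
  interpret D: doubled_maximum U V "1 / \<epsilon>" "3 / \<epsilon>"
  proof
    show "closed {h. b \<le> U h}" "closed {h. b \<le> V h}" for b
      unfolding U_def V_def by (intro shift P1.u1_closed P2.u1_closed)+
    show "U h \<le> 1 / \<epsilon> / 2 * (norm h)\<^sup>2" "V h \<le> 1 / \<epsilon> / 2 * (norm h)\<^sup>2" for h
      using UV[of h 0] UV[of 0 h] zero by simp_all
  qed (use \<epsilon> zero UV in \<open>auto simp: divide_strict_right_mono\<close>)
  define Q where "Q = (\<lambda>n (a, b, q, s, X, Y). let e = 1 / real (Suc n) in
    norm a < e \<and> norm b < e \<and> norm q < e \<and> norm s < e \<and> \<bar>U a\<bar> < e \<and> \<bar>V b\<bar> < e \<and>
    upper_jet U a q X \<and> upper_jet V b s Y \<and>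
    (\<forall>h. - (3 / \<epsilon>) * (norm h)\<^sup>2 \<le> h \<bullet> X h) \<and> (\<forall>h. - (3 / \<epsilon>) * (norm h)\<^sup>2 \<le> h \<bullet> Y h) \<and>
    (\<forall>h k. h \<bullet> X h + k \<bullet> Y k \<le> 3 / \<epsilon> * (norm (h - k))\<^sup>2 + e * ((norm h)\<^sup>2 + (norm k)\<^sup>2)))"
  have "\<exists>t. Q n t" for n
    using D.jets_near_maximum[of "1 / real (Suc n)"] unfolding Q_def by (simp add: Let_def)
  then obtain t where t: "\<And>n. Q n (t n)"
    by metis
  define as where "as = (\<lambda>n. fst (t n))"
  define bs where "bs = (\<lambda>n. fst (snd (t n)))"
  define qs where "qs = (\<lambda>n. fst (snd (snd (t n))))"
  define ss where "ss = (\<lambda>n. fst (snd (snd (snd (t n)))))"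
  define Xs where "Xs = (\<lambda>n. fst (snd (snd (snd (snd (t n))))))"
  define Ys where "Ys = (\<lambda>n. snd (snd (snd (snd (snd (t n))))))"
  define e where "e = (\<lambda>n. 1 / real (Suc n))"
  have "t n = (as n, bs n, qs n, ss n, Xs n, Ys n)" for n
    by (simp add: as_def bs_def qs_def ss_def Xs_def Ys_def)
  then have Qn: "Q n (as n, bs n, qs n, ss n, Xs n, Ys n)" for n
    using t[of n] by simp
  have small: "norm (as n) < e n" "norm (bs n) < e n" "norm (qs n) < e n" "norm (ss n) < e n" "norm (U (as n)) < e n" "norm (V (bs n)) < e n"
    and jets: "upper_jet U (as n) (qs n) (Xs n)" "upper_jet V (bs n) (ss n) (Ys n)"
    and low: "\<And>h. - (3 / \<epsilon>) * (norm h)\<^sup>2 \<le> h \<bullet> Xs n h" "\<And>h. - (3 / \<epsilon>) * (norm h)\<^sup>2 \<le> h \<bullet> Ys n h"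
    and up: "\<And>h k. h \<bullet> Xs n h + k \<bullet> Ys n k \<le> 3 / \<epsilon> * (norm (h - k))\<^sup>2 + e n * ((norm h)\<^sup>2 + (norm k)\<^sup>2)" for n
    using Qn[of n] by (simp_all add: Q_def Let_def e_def)
  have e0: "e \<longlonglongrightarrow> 0"
    unfolding e_def by (rule LIMSEQ_Suc[OF lim_1_over_n])
  have to0: "z \<longlonglongrightarrow> 0" if "\<And>n. norm (z n) < e n" for z :: "nat \<Rightarrow> 'b::real_normed_vector"
    by (rule Lim_null_comparison[OF _ e0]) (use that in \<open>auto intro: always_eventually less_imp_le\<close>)
  have lin: "linear (Xs n)" "linear (Ys n)" "\<And>v w. v \<bullet> Xs n w = Xs n v \<bullet> w" "\<And>v w. v \<bullet> Ys n w = Ys n v \<bullet> w" for n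
    using jets[of n] by (simp_all add: upper_jet_def)
  define C where "C = 3 / \<epsilon> + 1"
  have "e n \<le> 1" for n
    by (simp add: e_def)
  then have en: "e n * (norm h)\<^sup>2 \<le> 1 * (norm h)\<^sup>2" for n and h :: "real ^ 'n"
    by (intro mult_right_mono) auto
  have low1: "- (3 / \<epsilon>) * (norm h)\<^sup>2 \<le> h \<bullet> Xs n h" and low2: "- (3 / \<epsilon>) * (norm h)\<^sup>2 \<le> h \<bullet> Ys n h" for h n
    by (rule low)+
  have up1: "h \<bullet> Xs n h + k \<bullet> Ys n k \<le> 3 / \<epsilon> * (norm (h - k))\<^sup>2 + e n * ((norm h)\<^sup>2 + (norm k)\<^sup>2)" for h n k
    by (rule up)
  have "\<bar>h \<bullet> Xs n h\<bar> \<le> C * (norm h)\<^sup>2" "\<bar>h \<bullet> Ys n h\<bar> \<le> C * (norm h)\<^sup>2" for n h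
  proof -
    have "h \<bullet> Xs n h \<le> 3 / \<epsilon> * (norm h)\<^sup>2 + e n * (norm h)\<^sup>2" "h \<bullet> Ys n h \<le> 3 / \<epsilon> * (norm h)\<^sup>2 + e n * (norm h)\<^sup>2"
      using up1[of h n 0] up1[of 0 n h] linear_0[OF lin(1)] linear_0[OF lin(2)] by simp_all
    moreover have "0 \<le> (norm h)\<^sup>2"
      by simp
    ultimately show "\<bar>h \<bullet> Xs n h\<bar> \<le> C * (norm h)\<^sup>2" "\<bar>h \<bullet> Ys n h\<bar> \<le> C * (norm h)\<^sup>2"
      using low1[of h n] low2[of h n] en[of n h] unfolding C_def distrib_right abs_le_iff by linarith+
  qed
  then have nb: "norm (matrix (Xs n)) \<le> real CARD('n) * real CARD('n) * C" "norm (matrix (Ys n)) \<le> real CARD('n) * real CARD('n) * C" for n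
    using lin by (auto intro!: bounded_quadratic_matrix)
  \<comment> \<open>Both Hessians are treated as one pair so that they converge along a common
    subsequence.\<close>
  have "bounded (range (\<lambda>n. (matrix (Xs n), matrix (Ys n))))"
    by (rule bounded_subset[OF bounded_Times[OF bounded_cball[of 0 "real CARD('n) * real CARD('n) * C"] bounded_cball[of 0 "real CARD('n) * real CARD('n) * C"]]])
      (use nb in auto)
  then obtain \<Gamma> r where r: "strict_mono r" "((\<lambda>n. (matrix (Xs n), matrix (Ys n))) \<circ> r) \<longlonglongrightarrow> \<Gamma>"
    using bounded_imp_convergent_subsequence by blast
  define \<Gamma>1 where "\<Gamma>1 = fst \<Gamma>"
  \<comment> \<open>\<open>\<Gamma>2\<close> belongs to \<open>- w\<close>; the matrix for
    \<open>w\<close> is \<open>- \<Gamma>2\<close>, whence the double negations in the block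
    matrices below.\<close>
  define \<Gamma>2 where "\<Gamma>2 = snd \<Gamma>"
  have lim1: "(\<lambda>n. matrix (Xs (r n))) \<longlonglongrightarrow> \<Gamma>1" and lim2: "(\<lambda>n. matrix (Ys (r n))) \<longlonglongrightarrow> \<Gamma>2"
    using tendsto_fst[OF r(2)] tendsto_snd[OF r(2)] by (simp_all add: \<Gamma>1_def \<Gamma>2_def o_def)
  have sub: "(\<lambda>n. z (r n)) \<longlonglongrightarrow> l" if "z \<longlonglongrightarrow> l" for z :: "nat \<Rightarrow> 'b::topological_space" and l
    using LIMSEQ_subseq_LIMSEQ[OF that r(1)] by (simp add: o_def)
  have sym: "\<Gamma>1 \<in> sym_matrices" "- \<Gamma>2 \<in> sym_matrices"
  proof -
    show "\<Gamma>1 \<in> sym_matrices"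
      by (rule sym_matrices_limit[OF lim1 symmetric_matrix_of_self_adjoint[OF lin(3)]])
    have "\<Gamma>2 \<in> sym_matrices"
      by (rule sym_matrices_limit[OF lim2 symmetric_matrix_of_self_adjoint[OF lin(4)]])
    then show "- \<Gamma>2 \<in> sym_matrices"
      by (simp add: sym_matrices_def transpose_def vec_eq_iff)
  qed
  have "(pot p x / \<epsilon>, \<Delta>, \<Gamma>1) \<in> closed_semijet_plus T u (\<mu>, x)"
  proof (rule P1.closed_semijet_of_limit)
    have "(\<lambda>n. x + as (r n)) \<longlonglongrightarrow> x + 0"
      by (intro tendsto_intros sub to0 small)
    then show "(\<lambda>n. x + as (r n)) \<longlonglongrightarrow> x" by simp
    have "(\<lambda>n. U (as (r n)) + P1.u1 x + \<Delta> \<bullet> as (r n)) \<longlonglongrightarrow> 0 + P1.u1 x + \<Delta> \<bullet> 0"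
      by (intro tendsto_intros sub to0[of as] sub[OF to0[of "\<lambda>n. U (as n)"]] small)
    then show "(\<lambda>n. P1.u1 (x + as (r n))) \<longlonglongrightarrow> P1.u1 x"
      by (simp add: U_def)
    show "upper_jet P1.u1 (x + as (r n)) (\<Delta> + qs (r n)) (Xs (r n))" for n
      using jets(1) unfolding U_def by (rule upper_jet_shift)
    have "(\<lambda>n. \<Delta> + qs (r n)) \<longlonglongrightarrow> \<Delta> + 0"
      by (intro tendsto_intros sub to0 small)
    then show "(\<lambda>n. \<Delta> + qs (r n)) \<longlonglongrightarrow> \<Delta>" by simp
  qed (rule lim1)
  then have J1: "(Theta f \<epsilon> \<mu> \<nu> x, \<Delta>, \<Gamma>1) \<in> closed_semijet_plus T u (\<mu>, x)"
    by (simp add: Theta_pot p_def)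
  have "(pot (- p) y / \<epsilon>, - \<Delta>, \<Gamma>2) \<in> closed_semijet_plus T (\<lambda>\<xi>. - w \<xi>) (\<nu>, y)"
  proof (rule P2.closed_semijet_of_limit)
    have "(\<lambda>n. y + bs (r n)) \<longlonglongrightarrow> y + 0"
      by (intro tendsto_intros sub to0 small)
    then show "(\<lambda>n. y + bs (r n)) \<longlonglongrightarrow> y" by simp
    have "(\<lambda>n. V (bs (r n)) + P2.u1 y + (- \<Delta>) \<bullet> bs (r n)) \<longlonglongrightarrow> 0 + P2.u1 y + (- \<Delta>) \<bullet> 0"
      by (intro tendsto_intros sub to0[of bs] sub[OF to0[of "\<lambda>n. V (bs n)"]] small)
    then show "(\<lambda>n. P2.u1 (y + bs (r n))) \<longlonglongrightarrow> P2.u1 y"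
      by (simp add: V_def)
    show "upper_jet P2.u1 (y + bs (r n)) (- \<Delta> + ss (r n)) (Ys (r n))" for n
      using jets(2) unfolding V_def by (rule upper_jet_shift)
    have "(\<lambda>n. - \<Delta> + ss (r n)) \<longlonglongrightarrow> - \<Delta> + 0"
      by (intro tendsto_intros sub to0 small)
    then show "(\<lambda>n. - \<Delta> + ss (r n)) \<longlonglongrightarrow> - \<Delta>" by simp
  qed (rule lim2)
  from closed_semijet_plus_uminus[OF this]
  have J2: "(Theta f \<epsilon> \<mu> \<nu> y, \<Delta>, - \<Gamma>2) \<in> closed_semijet_minus T w (\<nu>, y)"
    by (simp add: Theta_pot pot_linear(1) p_def diff_divide_distrib)
  have mX: "matrix (Xs n) *v h = Xs n h" "matrix (Ys n) *v h = Ys n h" for n h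
    using fun_cong[OF matrix_vector_mul(2)[OF lin(1)]] fun_cong[OF matrix_vector_mul(2)[OF lin(2)]] by simp_all
  have q1: "- (3 / \<epsilon>) * (norm h)\<^sup>2 \<le> h \<bullet> (\<Gamma>1 *v h)" for h
    by (rule LIMSEQ_le_const[OF matrix_vector_tendsto[OF lim1]]) (use low(1) in \<open>simp add: mX\<close>)
  have q2: "- (3 / \<epsilon>) * (norm h)\<^sup>2 \<le> h \<bullet> (\<Gamma>2 *v h)" for h
    by (rule LIMSEQ_le_const[OF matrix_vector_tendsto[OF lim2]]) (use low(2) in \<open>simp add: mX\<close>)
  have q3: "h \<bullet> (\<Gamma>1 *v h) + k \<bullet> (\<Gamma>2 *v k) \<le> 3 / \<epsilon> * (norm (h - k))\<^sup>2" for h k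
  proof -
    have "(\<lambda>n. 3 / \<epsilon> * (norm (h - k))\<^sup>2 + e (r n) * ((norm h)\<^sup>2 + (norm k)\<^sup>2)) \<longlonglongrightarrow> 3 / \<epsilon> * (norm (h - k))\<^sup>2 + 0 * ((norm h)\<^sup>2 + (norm k)\<^sup>2)"
      by (intro tendsto_intros sub e0)
    moreover have "(\<lambda>n. h \<bullet> (matrix (Xs (r n)) *v h) + k \<bullet> (matrix (Ys (r n)) *v k)) \<longlonglongrightarrow> h \<bullet> (\<Gamma>1 *v h) + k \<bullet> (\<Gamma>2 *v k)"
      by (intro tendsto_add matrix_vector_tendsto lim1 lim2)
    ultimately have "h \<bullet> (\<Gamma>1 *v h) + k \<bullet> (\<Gamma>2 *v k) \<le> 3 / \<epsilon> * (norm (h - k))\<^sup>2 + 0 * ((norm h)\<^sup>2 + (norm k)\<^sup>2)"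
      by (intro LIMSEQ_le) (use up in \<open>auto simp: mX\<close>)
    then show ?thesis by simp
  qed
  have neg1: "(- mat 1) *v h = - h" for h :: "real ^ 'n"
    using matrix_vector_mult_diff_rdistrib[of 0 "mat 1" h] by simp
  have L: "quad_le (- (3 / \<epsilon>) *\<^sub>R block_matrix (mat 1) 0 0 (mat 1)) (block_matrix \<Gamma>1 0 0 (- (- \<Gamma>2)))"
    unfolding quad_le_def
  proof
    fix v :: "real ^ ('n + 'n)"
    let ?a = "\<chi> k. v $ Inl k" and ?b = "\<chi> k. v $ Inr k"
    have "v \<bullet> ((- (3 / \<epsilon>) *\<^sub>R block_matrix (mat 1) 0 0 (mat 1)) *v v) = - (3 / \<epsilon>) * (norm ?a)\<^sup>2 + - (3 / \<epsilon>) * (norm ?b)\<^sup>2"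
      unfolding scaleR_matrix_vector_assoc[symmetric] inner_scaleR_right block_matrix_quadratic
      by (simp only: matrix_vector_mul_lid matrix_vector_mult_0 inner_zero_right power2_norm_eq_inner distrib_left add_0_right)
    then show "v \<bullet> ((- (3 / \<epsilon>) *\<^sub>R block_matrix (mat 1) 0 0 (mat 1)) *v v) \<le> v \<bullet> (block_matrix \<Gamma>1 0 0 (- (- \<Gamma>2)) *v v)"
      using q1[of ?a] q2[of ?b] unfolding block_matrix_quadratic by simp
  qed
  have R: "quad_le (block_matrix \<Gamma>1 0 0 (- (- \<Gamma>2))) ((3 / \<epsilon>) *\<^sub>R block_matrix (mat 1) (- mat 1) (- mat 1) (mat 1))"
    unfolding quad_le_def
  proof
    fix v :: "real ^ ('n + 'n)"
    let ?a = "\<chi> k. v $ Inl k" and ?b = "\<chi> k. v $ Inr k"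
    have "v \<bullet> (((3 / \<epsilon>) *\<^sub>R block_matrix (mat 1) (- mat 1) (- mat 1) (mat 1)) *v v) = 3 / \<epsilon> * (norm (?a - ?b))\<^sup>2"
      unfolding scaleR_matrix_vector_assoc[symmetric] inner_scaleR_right block_matrix_quadratic neg1 norm_sq_diff
      by (simp add: power2_norm_eq_inner inner_commute[of ?b ?a])
    then show "v \<bullet> (block_matrix \<Gamma>1 0 0 (- (- \<Gamma>2)) *v v) \<le> v \<bullet> (((3 / \<epsilon>) *\<^sub>R block_matrix (mat 1) (- mat 1) (- mat 1) (mat 1)) *v v)"
      using q3[of ?a ?b] unfolding block_matrix_quadratic by simp
  qed
  show ?thesis
    using Theta_Cb Theta_linear_derivative[OF M_q_M_plus \<epsilon>] sym J1 J2 L R unfolding \<Delta>_def by blast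
qed

end
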